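(* Let $s=s(n)$ be a sequence of positive integers with $s=\Omega(n^{1/2})$ and $s\le n/2$. Then the following two statements hold. (0) There exist sets $A=A_n\subseteq[n]$ with $|A|=s$ such that, for every sequence of probabilities $p=p(n)$ with $p=o\left((ns)^{-1/3}\right)$, whp $A\cup[n]_p$ is not Schur. (1) For all sets $A=A_n\subseteq[n]$ with $|A|=s$ and every sequence of probabilities $p=p(n)$ with $p=\omega\left((n^{13}s)^{-1/27}\log n\right)$, whp $A\cup[n]_p$ is Schur.
   Context: $[n]=\{1,\dots,n\}$. For $p\in[0,1]$, $[n]_p$ denotes the random subset of $[n]$ obtained by including each element independently with probability $p$. A Schur triple in a set $A\subseteq\mathbb{N}$ is a triple $(x,y,z)\in A^3$ with $x+y=z$ (the case $x=y$ is allowed). A set $A\subseteq\mathbb{N}$ is called Schur if every colouring of the elements of $A$ with two colours contains a monochromatic Schur triple. All quantities depend on $n$ and asymptotics are as $n\to\infty$ (so conditions need only hold for all sufficiently large $n$); $f=o(g)$ means $f/g\to0$, $f=\omega(g)$ means $f/g\to\infty$, and $f=\Omega(g)$ means $f\ge c_0 g$ for some constant $c_0>0$. An event holds whp if its probability tends to $1$ as $n\to\infty$. *)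

theory Defs
  imports "HOL-Probability.Probability" "HOL-Library.Landau_Symbols"
begin

text \<open>
  The definitions are meant for sets of positive integers; a set containing \<open>0\<close> would be Schur
  because of the degenerate triple \<open>(0, 0, 0)\<close>.
\<close>

definition schur_triple :: "nat set \<Rightarrow> nat \<Rightarrow> nat \<Rightarrow> nat \<Rightarrow> bool" where
  "schur_triple A x y z \<longleftrightarrow> x \<in> A \<and> y \<in> A \<and> z \<in> A \<and> x + y = z"

text \<open>
  Two-colourings of \<open>A\<close> are given by total functions, of which only the values on \<open>A\<close> matter.
\<close>

definition is_schur :: "nat set \<Rightarrow> bool" where
  "is_schur A \<longleftrightarrow>
     (\<forall>c :: nat \<Rightarrow> bool. \<exists>x y z. schur_triple A x y z \<and> c x = c y \<and> c y = c z)"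

text \<open>
  The distribution of \<open>[n]\<^sub>p\<close>, obtained from independent Bernoulli variables indexed by \<open>{1..n}\<close>.
  Meaningful for \<open>0 \<le> p \<le> 1\<close> only.
\<close>

definition random_subset :: "nat \<Rightarrow> real \<Rightarrow> nat set pmf" where
  "random_subset n p =
     map_pmf (\<lambda>f. {x \<in> {1..n}. f x}) (Pi_pmf {1..n} False (\<lambda>_. bernoulli_pmf p))"

end

theory Submission imports Defs begin

text \<open>
  Part (1). An element \<open>a \<in> A\<close> forbids red pairs \<open>{x, |x - a|}\<close> if it is red, and blue ones if it is
  blue. Fingerprints of \<open>O(n^(2/3) s^(-1/3))\<close> elements of the random set \<open>R\<close> therefore place its red
  and blue parts into containers, one of which, \<open>C\<close>, contains few pairs \<open>{x, |x - a|}\<close> for some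
  \<open>a \<in> A\<close>. All of \<open>R\<close> outside \<open>C\<close> then has one colour. Let \<open>B\<close> be the complement of \<open>C\<close>. Since
  \<open>(|x - a|, y, |z - a|)\<close> is a Schur triple whenever \<open>(x, y, z)\<close> is, either \<open>B\<close> contains
  \<open>\<Omega>(n^2)\<close> Schur triples, or there are \<open>\<Omega>(n^2)\<close> Schur triples in \<open>C\<close> each of whose elements is
  completed to a Schur triple by \<open>\<Omega>(n)\<close> pairs from \<open>B\<close>. A triple in \<open>B\<close>, or a Schur triple
  together with three such pairs, inside \<open>R\<close> is a contradiction, and by Janson's inequality \<open>R\<close> avoids
  them with probability at most \<open>exp (- c min (n^5 p^9) (n p))\<close>, which beats the number
  \<open>exp (O(n^(2/3) s^(-1/3) log n))\<close> of containers.

  Part (0). Let \<open>A\<close> consist of the \<open>s\<close> largest elements, coloured red. What is needed is a red subset of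
  \<open>R - A\<close> that meets every Schur triple in \<open>R - A\<close>, contains none, and has no two elements with sum in
  \<open>A\<close>. It exists unless the triples, linked through common elements and through such sums, contain a
  closed path. Prolonging a path costs a factor \<open>O(n p^2 + n s p^3) = o(1)\<close>, and the expected number of
  closed paths tends to zero.
\<close>

section \<open>Random subsets and Janson's inequality\<close>

text \<open>In part (1) the \<open>2^s\<close> colourings of \<open>A\<close> cannot be enumerated,
  since \<open>s\<close> may far exceed the fingerprint size \<open>m\<close>. Colours of
  \<open>A\<close> are deduced instead: if \<open>y\<close> and \<open>|y - a|\<close> lie in red
  fingerprints, \<open>a\<close> is blue. Two red fingerprints yield of order
  \<open>m^2 s / n\<close> such \<open>a\<close>, and a third, blue one then excludes linearly many
  elements from the blue part once \<open>m * (m^2 s / n)\<close> exceeds a multiple of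
  \<open>n\<close>. This fixes \<open>m\<close> at the order of \<open>n^(2/3) s^(-1/3)\<close>. A
  Schur triple with three completing pairs has nine elements and five free parameters, hence
  \<open>n^5 p^9\<close>; at \<open>p = (n^13 s)^(-1/27)\<close> this equals
  \<open>n^(2/3) s^(-1/3)\<close>. The other term \<open>n p\<close> is then at least of the same
  order because \<open>s = Omega(n^(1/2))\<close>, and when \<open>s\<close> is of order
  \<open>n^(1/2)\<close> it is the term that needs the full factor \<open>log n\<close>. In part
  (0), \<open>n s p^3\<close> counts the ways to pass through a sum in \<open>A\<close> to a new
  triple, and \<open>n p^2\<close> those to pass to a triple through a common element. The bound on
  \<open>p\<close> controls the first; the second follows because
  \<open>s = Omega(n^(1/2))\<close>.\<close>

abbreviation expect :: "nat \<Rightarrow> real \<Rightarrow> (nat set \<Rightarrow> real) \<Rightarrow> real" where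
  "expect n p g \<equiv> measure_pmf.expectation (random_subset n p) g"

abbreviation probR :: "nat \<Rightarrow> real \<Rightarrow> nat set set \<Rightarrow> real" where
  "probR n p E \<equiv> measure_pmf.prob (random_subset n p) E"

lemma set_pmf_random_subset: "set_pmf (random_subset n p) \<subseteq> Pow {1..n}"
  by (auto simp: random_subset_def)

lemma finite_set_pmf_random_subset: "finite (set_pmf (random_subset n p))"
  by (rule finite_subset[OF set_pmf_random_subset]) auto

lemma integrable_random_subset [simp]:
  fixes g :: "nat set \<Rightarrow> real"
  shows "integrable (measure_pmf (random_subset n p)) g"
  by (rule integrable_measure_pmf_finite[OF finite_set_pmf_random_subset])

text \<open>Exposes the coin of \<open>v\<close> alone: \<open>Q\<close> is the law of
  \<open>R - {v}\<close>. From here on the product measure enters only through this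
  decomposition.\<close>

lemma random_subset_split:
  assumes "v \<in> {1..n}"
  shows "\<exists>Q. finite (set_pmf Q) \<and> random_subset n p =
    bernoulli_pmf p \<bind> (\<lambda>y. map_pmf (\<lambda>R. if y then insert v R else R) Q) \<and>
    (\<forall>R\<in>set_pmf Q. v \<notin> R)"
proof -
  let ?A = "{1..n} - {v}"
  let ?P = "Pi_pmf ?A False (\<lambda>_. bernoulli_pmf p)"
  define r where "r = (\<lambda>f. {x \<in> ?A. f x})"
  define Q where "Q = map_pmf r ?P"
  have ins: "{1..n} = insert v ?A" using assms by auto
  have "random_subset n p = map_pmf (\<lambda>f. {x \<in> {1..n}. f x})
      (bernoulli_pmf p \<bind> (\<lambda>y. ?P \<bind> (\<lambda>f. return_pmf (f(v := y)))))"
    unfolding random_subset_def by (subst ins, subst Pi_pmf_insert') auto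
  also have "\<dots> = bernoulli_pmf p \<bind> (\<lambda>y. ?P \<bind> (\<lambda>f. return_pmf {x \<in> {1..n}. (f(v := y)) x}))"
    by (simp add: map_bind_pmf)
  also have "\<dots> = bernoulli_pmf p \<bind> (\<lambda>y. ?P \<bind> (\<lambda>f. return_pmf (if y then insert v (r f) else r f)))"
  proof -
    have "{x \<in> {1..n}. (f(v := y)) x} = (if y then insert v (r f) else r f)" for f y
      using assms by (auto simp: r_def)
    then show ?thesis by simp
  qed
  also have "\<dots> = bernoulli_pmf p \<bind> (\<lambda>y. map_pmf (\<lambda>R. if y then insert v R else R) Q)"
    unfolding Q_def by (simp add: map_pmf_def bind_assoc_pmf bind_return_pmf)
  finally have "random_subset n p = \<dots>" .
  moreover have "set_pmf Q \<subseteq> Pow ?A" by (auto simp: Q_def r_def)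
  then have "finite (set_pmf Q)" "\<forall>R\<in>set_pmf Q. v \<notin> R"
    by (auto intro: finite_subset)
  ultimately show ?thesis by blast
qed

text \<open>The indicator kills the branch without \<open>v\<close>; in the other branch
  \<open>h\<close> already sees \<open>insert v R\<close>, whose law does not depend on the coin of
  \<open>v\<close>.\<close>

lemma expect_mem:
  fixes h :: "nat set \<Rightarrow> real"
  assumes v: "v \<in> {1..n}" and p: "0 \<le> p" "p \<le> 1"
  shows "expect n p (\<lambda>R. of_bool (v \<in> R) * h R) = p * expect n p (\<lambda>R. h (insert v R))"
proof -
  obtain Q where fin: "finite (set_pmf Q)" and nQ: "\<forall>R\<in>set_pmf Q. v \<notin> R"
    and eq: "random_subset n p = bernoulli_pmf p \<bind> (\<lambda>y. map_pmf (\<lambda>R. if y then insert v R else R) Q)"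
    using random_subset_split[OF v] by blast
  have E: "expect n p g = p * measure_pmf.expectation Q (\<lambda>R. g (insert v R))
      + (1 - p) * measure_pmf.expectation Q g" for g :: "nat set \<Rightarrow> real"
    unfolding eq
    by (subst pmf_expectation_bind[where A = UNIV]) (use fin p in \<open>auto simp: UNIV_bool\<close>)
  have z: "measure_pmf.expectation Q (\<lambda>R. of_bool (v \<in> R) * h R) = 0"
    using nQ by (subst integral_cong_AE[where g = "\<lambda>_. 0"]) (auto simp: AE_measure_pmf_iff)
  show ?thesis unfolding E z by (simp add: algebra_simps)
qed

lemma expect_subset:
  fixes g :: "nat set \<Rightarrow> real"
  assumes "S \<subseteq> {1..n}" and p: "0 \<le> p" "p \<le> 1"
  shows "expect n p (\<lambda>R. of_bool (S \<subseteq> R) * g R) = p ^ card S * expect n p (\<lambda>R. g (R \<union> S))"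
proof -
  have "finite S" using assms(1) by (rule finite_subset) auto
  then show ?thesis using assms(1)
  proof (induction S arbitrary: g rule: finite_induct)
    case (insert v S)
    have "expect n p (\<lambda>R. of_bool (insert v S \<subseteq> R) * g R)
        = expect n p (\<lambda>R. of_bool (v \<in> R) * (of_bool (S \<subseteq> R) * g R))"
      by (rule Bochner_Integration.integral_cong) auto
    also have "\<dots> = p * expect n p (\<lambda>R. of_bool (S \<subseteq> insert v R) * g (insert v R))"
      by (rule expect_mem) (use insert.prems p in auto)
    also have "(\<lambda>R. of_bool (S \<subseteq> insert v R) * g (insert v R)) = (\<lambda>R. of_bool (S \<subseteq> R) * g (insert v R))"
      using insert.hyps by (simp add: subset_insert)
    also have "p * expect n p \<dots> = p * (p ^ card S * expect n p (\<lambda>R. g (insert v (R \<union> S))))"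
      using insert.IH[of "\<lambda>R. g (insert v R)"] insert.prems by simp
    finally show ?case using insert.hyps by simp
  qed simp
qed

lemma prob_expect: "probR n p {R. P R} = expect n p (\<lambda>R. of_bool (P R))"
proof -
  have "expect n p (\<lambda>R. of_bool (P R)) = expect n p (indicator {R. P R})"
    by (rule Bochner_Integration.integral_cong) (auto simp: indicator_def)
  then show ?thesis by simp
qed

lemma prob_subset:
  assumes "S \<subseteq> {1..n}" "0 \<le> p" "p \<le> 1"
  shows "probR n p {R. S \<subseteq> R} = p ^ card S"
  using expect_subset[OF assms, of "\<lambda>_. 1"] by (simp add: prob_expect)

text \<open>
  A form of Janson's inequality for the lower tail at zero. Thinning the product of the indicators
  by \<open>\<theta> = 1/(2\<Lambda>)\<close> keeps each factor from losing more than half of its expected effect, so no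
  correlation inequality is needed beyond \<open>E[1[S \<subseteq> R] g(R)] = p^|S| E[g(R \<union> S)]\<close>.
\<close>

lemma janson:
  fixes S :: "'i \<Rightarrow> nat set" and \<Lambda> :: real
  assumes fin: "finite I" and S: "\<And>i. i \<in> I \<Longrightarrow> S i \<subseteq> {1..n}"
    and p: "0 \<le> p" "p \<le> 1" and L: "\<Lambda> \<ge> 1"
    and bound: "\<And>i. i \<in> I \<Longrightarrow> (\<Sum>j | j \<in> I \<and> S j \<inter> S i \<noteq> {}. p ^ card (S j - S i)) \<le> \<Lambda>"
  shows "probR n p {R. \<forall>i\<in>I. \<not> S i \<subseteq> R} \<le> exp (- (\<Sum>i\<in>I. p ^ card (S i)) / (4 * \<Lambda>))"
proof -
  define \<theta> where "\<theta> = 1 / (2 * \<Lambda>)"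
  have th: "0 < \<theta>" "\<theta> \<le> 1 / 2" "\<theta> * \<Lambda> = 1 / 2"
    using L by (auto simp: \<theta>_def field_simps)
  define f where "f = (\<lambda>i R. 1 - \<theta> * of_bool (S i \<subseteq> R))"
  have f01: "0 \<le> f i R" "f i R \<le> 1" for i R using th by (auto simp: f_def)
  define Y where "Y = (\<lambda>J R. \<Prod>i\<in>J. f i R)"
  have Y01: "0 \<le> Y J R" "Y J R \<le> 1" for J R
    by (auto simp: Y_def f01 intro!: prod_nonneg prod_le_1)
  have Ymono: "Y J R' \<le> Y J R" if "R \<subseteq> R'" for J R R'
    unfolding Y_def by (rule prod_mono) (use that th f01 in \<open>auto simp: f_def\<close>)
  have Yexp: "0 \<le> expect n p (Y J)" for J
    by (rule integral_nonneg_AE) (auto simp: Y01)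
  \<comment> \<open>Weierstrass' product inequality, by telescoping. After \<open>T\<close> has been
    added to \<open>R\<close>, the event \<open>S j \<subseteq> R \<union> T\<close> concerns
    \<open>S j - T\<close> only.\<close>
  have bern: "1 - \<theta> * (\<Sum>j\<in>J. of_bool (S j - T \<subseteq> R)) \<le> Y J (R \<union> T)" if "finite J" for J T R
    using that
  proof (induction J rule: finite_induct)
    case (insert i J)
    have "Y (insert i J) (R \<union> T) = f i (R \<union> T) * Y J (R \<union> T)"
      using insert.hyps by (simp add: Y_def)
    also have "\<dots> = Y J (R \<union> T) - \<theta> * of_bool (S i - T \<subseteq> R) * Y J (R \<union> T)"
      by (auto simp: f_def algebra_simps)
    also have "\<dots> \<ge> Y J (R \<union> T) - \<theta> * of_bool (S i - T \<subseteq> R)"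
      using mult_left_mono[OF Y01(2)[of J "R \<union> T"], of "\<theta> * of_bool (S i - T \<subseteq> R)"] th by simp
    finally show ?case using insert by (simp add: algebra_simps del: sum_of_bool_eq)
  qed (simp add: Y_def)
  have step: "expect n p (Y (insert i J)) \<le> (1 - \<theta> * p ^ card (S i) / 2) * expect n p (Y J)"
    if J: "J \<subseteq> I" "finite J" and i: "i \<in> I" "i \<notin> J" for i J
  proof -
    \<comment> \<open>Adding \<open>S i\<close> to \<open>R\<close> leaves the factors in
      \<open>J2\<close> unchanged; only those in \<open>J1\<close> react, and \<open>bound\<close>
      controls their total effect.\<close>
    define J1 where "J1 = {j\<in>J. S j \<inter> S i \<noteq> {}}"
    define J2 where "J2 = {j\<in>J. S j \<inter> S i = {}}"
    have J12: "J = J1 \<union> J2" "J1 \<inter> J2 = {}" "finite J1" "finite J2"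
      using J by (auto simp: J1_def J2_def)
    have split: "Y J R = Y J1 R * Y J2 R" for R
      unfolding Y_def using J12 by (metis prod.union_disjoint)
    have ind: "Y J2 (R \<union> S i) = Y J2 R" for R
      unfolding Y_def f_def J2_def
      by (rule prod.cong) (auto simp: of_bool_def)
    have sub: "S j - S i \<subseteq> {1..n}" if "j \<in> J1" for j
      using S[of j] that J by (auto simp: J1_def)
    have one: "expect n p (\<lambda>R. of_bool (S j - S i \<subseteq> R) * Y J2 R)
        \<le> p ^ card (S j - S i) * expect n p (Y J2)" if "j \<in> J1" for j
    proof -
      have "expect n p (\<lambda>R. of_bool (S j - S i \<subseteq> R) * Y J2 R)
        = p ^ card (S j - S i) * expect n p (\<lambda>R. Y J2 (R \<union> (S j - S i)))"
        by (rule expect_subset[OF sub[OF that] p])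
      also have "\<dots> \<le> p ^ card (S j - S i) * expect n p (Y J2)"
        using p by (intro mult_left_mono integral_mono Ymono) auto
      finally show ?thesis .
    qed
    have "expect n p (Y J2) * (1 - \<theta> * (\<Sum>j\<in>J1. p ^ card (S j - S i)))
        \<le> expect n p (Y J2) - \<theta> * (\<Sum>j\<in>J1. expect n p (\<lambda>R. of_bool (S j - S i \<subseteq> R) * Y J2 R))"
    proof -
      have "(\<Sum>j\<in>J1. expect n p (\<lambda>R. of_bool (S j - S i \<subseteq> R) * Y J2 R))
          \<le> (\<Sum>j\<in>J1. p ^ card (S j - S i)) * expect n p (Y J2)"
        unfolding sum_distrib_right by (rule sum_mono[OF one])
      from mult_left_mono[OF this, of \<theta>] th show ?thesis by (simp add: algebra_simps)
    qed
    also have "\<dots> = expect n p (\<lambda>R. (1 - \<theta> * (\<Sum>j\<in>J1. of_bool (S j - S i \<subseteq> R))) * Y J2 R)"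
      by (simp add: algebra_simps sum_distrib_left sum_distrib_right)
    also have "\<dots> \<le> expect n p (\<lambda>R. Y J (R \<union> S i))"
      by (intro integral_mono) (auto simp: split ind intro!: mult_right_mono bern J12 Y01)
    finally have A: "expect n p (Y J2) * (1 - \<theta> * (\<Sum>j\<in>J1. p ^ card (S j - S i)))
        \<le> expect n p (\<lambda>R. Y J (R \<union> S i))" .
    have "(\<Sum>j\<in>J1. p ^ card (S j - S i)) \<le> (\<Sum>j | j \<in> I \<and> S j \<inter> S i \<noteq> {}. p ^ card (S j - S i))"
      by (rule sum_mono2) (use fin J p in \<open>auto simp: J1_def\<close>)
    also have "\<dots> \<le> \<Lambda>" by (rule bound[OF i(1)])
    finally have "\<theta> * (\<Sum>j\<in>J1. p ^ card (S j - S i)) \<le> 1 / 2"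
      using th by (metis mult_left_mono less_imp_le)
    then have "expect n p (Y J2) * (1 / 2) \<le> expect n p (Y J2) * (1 - \<theta> * (\<Sum>j\<in>J1. p ^ card (S j - S i)))"
      by (intro mult_left_mono Yexp) auto
    moreover have "expect n p (Y J) \<le> expect n p (Y J2)"
    proof (intro integral_mono)
      show "Y J R \<le> Y J2 R" for R
        unfolding split using mult_right_mono[OF Y01(2)[of J1 R] Y01(1)[of J2 R]] by simp
    qed auto
    ultimately have half: "expect n p (Y J) / 2 \<le> expect n p (\<lambda>R. Y J (R \<union> S i))"
      using A by simp
    have "expect n p (Y (insert i J)) = expect n p (\<lambda>R. Y J R - \<theta> * (of_bool (S i \<subseteq> R) * Y J R))"
      using i J by (intro Bochner_Integration.integral_cong) (auto simp: Y_def f_def algebra_simps)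
    also have "\<dots> = expect n p (Y J) - \<theta> * (p ^ card (S i) * expect n p (\<lambda>R. Y J (R \<union> S i)))"
      using expect_subset[OF S[OF i(1)] p, of "Y J"] by simp
    also have "\<dots> \<le> expect n p (Y J) - \<theta> * (p ^ card (S i) * (expect n p (Y J) / 2))"
      using th p half by (intro diff_left_mono mult_left_mono) auto
    finally show ?thesis by (simp add: algebra_simps)
  qed
  have "expect n p (Y J) \<le> exp (- \<theta> / 2 * (\<Sum>i\<in>J. p ^ card (S i)))" if "J \<subseteq> I" for J
    using finite_subset[OF that fin] that
  proof (induction J rule: finite_induct)
    case (insert i J)
    have "expect n p (Y (insert i J)) \<le> (1 - \<theta> * p ^ card (S i) / 2) * expect n p (Y J)"
      using insert by (intro step) auto
    also have "\<dots> \<le> exp (- (\<theta> * p ^ card (S i) / 2)) * expect n p (Y J)"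
      using exp_ge_add_one_self[of "- (\<theta> * p ^ card (S i) / 2)"]
      by (intro mult_right_mono Yexp) auto
    also have "\<dots> \<le> exp (- (\<theta> * p ^ card (S i) / 2)) * exp (- \<theta> / 2 * (\<Sum>i\<in>J. p ^ card (S i)))"
      using insert by (intro mult_left_mono) auto
    also have "\<dots> = exp (- \<theta> / 2 * (\<Sum>i\<in>insert i J. p ^ card (S i)))"
      using insert.hyps by (simp add: exp_add[symmetric] algebra_simps)
    finally show ?case .
  qed (simp add: Y_def)
  from this[of I] have main: "expect n p (Y I) \<le> exp (- \<theta> / 2 * (\<Sum>i\<in>I. p ^ card (S i)))" by simp
  have "probR n p {R. \<forall>i\<in>I. \<not> S i \<subseteq> R} \<le> expect n p (Y I)"
    unfolding prob_expect
  proof (intro integral_mono)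
    show "of_bool (\<forall>i\<in>I. \<not> S i \<subseteq> R) \<le> Y I R" for R
      using Y01(1)[of I R] by (auto simp: Y_def f_def)
  qed auto
  also note main
  also have "- \<theta> / 2 * (\<Sum>i\<in>I. p ^ card (S i)) = - (\<Sum>i\<in>I. p ^ card (S i)) / (4 * \<Lambda>)"
    by (simp add: \<theta>_def)
  finally show ?thesis .
qed

section \<open>Containers for colourings without monochromatic Schur triples\<close>

text \<open>The absolute difference \<open>|y - a|\<close>: of the two truncated differences at
  least one is 0.\<close>

definition dst :: "nat \<Rightarrow> nat \<Rightarrow> nat" where
  "dst y a = (y - a) + (a - y)"

definition hits :: "nat set \<Rightarrow> nat \<Rightarrow> nat" where
  "hits C a = card {y \<in> C. dst y a \<in> C}"

text \<open>The colour \<open>True\<close> is called red, \<open>False\<close> blue.\<close>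

definition mono_free :: "nat set \<Rightarrow> (nat \<Rightarrow> bool) \<Rightarrow> bool" where
  "mono_free V \<kappa> \<longleftrightarrow> (\<forall>x y z. schur_triple V x y z \<longrightarrow> \<not> (\<kappa> x = \<kappa> y \<and> \<kappa> y = \<kappa> z))"

lemma is_schur_iff: "is_schur V \<longleftrightarrow> (\<nexists>\<kappa>. mono_free V \<kappa>)"
  unfolding is_schur_def mono_free_def by blast

section \<open>Double counting and averaging\<close>

lemma card_fibres_le:
  assumes "finite B" "finite X" "f ` X \<subseteq> B" "\<And>b. b \<in> B \<Longrightarrow> card {x \<in> X. f x = b} \<le> k"
  shows "card X \<le> k * card B"
proof -
  have "X = (\<Union>b\<in>B. {x \<in> X. f x = b})" using assms(3) by auto
  then have "card X \<le> (\<Sum>b\<in>B. card {x \<in> X. f x = b})"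
    using card_UN_le[OF assms(1), of "\<lambda>b. {x \<in> X. f x = b}"] by simp
  also have "\<dots> \<le> (\<Sum>b\<in>B. k)" using assms(4) by (intro sum_mono) auto
  finally show ?thesis by (simp add: mult.commute)
qed

lemma card_le_two: "X \<subseteq> {a, b} \<Longrightarrow> card X \<le> 2"
  using card_mono[of "{a, b}" X] card_insert_le_m1[of 2 "{b}" a] by simp

text \<open>Reverse Markov inequality: an element contributes less than \<theta> unless it lies in
  \<open>T\<close> or has \<open>g\<close> at least \<theta>, and in these cases at most
  \<open>D\<close>. The fingerprint \<open>T\<close> is set aside because \<open>stuck\<close>
  excludes it.\<close>

lemma markov_card:
  fixes g :: "'a \<Rightarrow> real" and D \<theta> L :: real
  assumes "finite C" "finite T" "\<And>x. x \<in> C \<Longrightarrow> g x \<le> D" "0 \<le> D" "0 \<le> \<theta>"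
    and L: "L \<le> (\<Sum>x\<in>C. g x)"
  shows "L - \<theta> * card C - D * card T \<le> D * card {x \<in> C - T. \<theta> \<le> g x}"
proof -
  let ?X = "{x \<in> C - T. \<theta> \<le> g x}"
  have "(\<Sum>x\<in>C. g x) \<le> (\<Sum>x\<in>C. \<theta> + D * of_bool (x \<in> T) + D * of_bool (x \<in> ?X))"
    using assms by (intro sum_mono) (auto simp: of_bool_def intro: add_increasing)
  also have "\<dots> = \<theta> * card C + D * card (C \<inter> T) + D * card (C \<inter> ?X)"
    using assms by (simp add: sum.distrib sum_distrib_left[symmetric] Int_def mult.commute)
  also have "card (C \<inter> T) \<le> card T" using assms by (intro card_mono) auto
  also have "C \<inter> ?X = ?X" by auto
  finally show ?thesis using L \<open>0 \<le> D\<close> by (simp add: mult_left_mono)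
qed

section \<open>Fingerprints and capped coverage\<close>

definition cov :: "('a \<Rightarrow> 'b set) \<Rightarrow> 'a set \<Rightarrow> 'b \<Rightarrow> nat" where
  "cov N T u = card {x \<in> T. u \<in> N x}"

text \<open>The elements whose addition to \<open>T\<close> would still gain at least \<theta>. The
  cap \<open>M\<close> keeps the gain from piling up on few \<open>u\<close>; for
  \<open>M = 1\<close> the total gain is the size of the union of the \<open>N x\<close>.\<close>

definition stuck :: "('a \<Rightarrow> 'b set) \<Rightarrow> 'a set \<Rightarrow> nat \<Rightarrow> real \<Rightarrow> 'a set \<Rightarrow> 'a set" where
  "stuck N C M \<theta> T = {x \<in> C - T. \<theta> \<le> real (card {u \<in> N x. cov N T u < M})}"

lemma cov_less_one: "finite T \<Longrightarrow> cov N T u < 1 \<longleftrightarrow> u \<notin> (\<Union>x\<in>T. N x)"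
  by (auto simp: cov_def)

lemma sum_min_one_cov:
  assumes "finite U" "finite T" "\<And>x. x \<in> T \<Longrightarrow> N x \<subseteq> U"
  shows "(\<Sum>u\<in>U. min 1 (cov N T u)) = card (\<Union>x\<in>T. N x)"
proof -
  have "(\<Sum>u\<in>U. min 1 (cov N T u)) = (\<Sum>u\<in>U. of_bool (u \<in> (\<Union>x\<in>T. N x)))"
  proof (intro sum.cong refl)
    fix u
    have "cov N T u = 0 \<longleftrightarrow> u \<notin> (\<Union>x\<in>T. N x)" using cov_less_one[OF assms(2), of N u] by simp
    then show "min 1 (cov N T u) = of_bool (u \<in> (\<Union>x\<in>T. N x))"
      by (cases "u \<in> (\<Union>x\<in>T. N x)") auto
  qed
  also have "\<dots> = card (U \<inter> (\<Union>x\<in>T. N x))" using assms(1) by (simp add: Int_def)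
  also have "U \<inter> (\<Union>x\<in>T. N x) = (\<Union>x\<in>T. N x)" using assms(3) by auto
  finally show ?thesis .
qed

text \<open>
  The container principle: \<open>T\<close> is a largest subset with the stated gain, so if it is not full then
  no further element of \<open>I\<close> has gain \<open>\<theta>\<close>, and \<open>I\<close> avoids a set that depends on \<open>T\<close> only.
\<close>

lemma fingerprint:
  fixes N :: "'a \<Rightarrow> 'b set" and \<theta> :: real
  assumes finI: "finite I" and "I \<subseteq> C" and finU: "finite U" and N: "\<And>x. x \<in> I \<Longrightarrow> N x \<subseteq> U"
  shows "\<exists>T\<subseteq>I. card T \<le> m \<and> \<theta> * card T \<le> real (\<Sum>u\<in>U. min M (cov N T u)) \<and>
    (card T = m \<or> stuck N C M \<theta> T \<inter> I = {})"
proof -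
  define F where "F = {T. T \<subseteq> I \<and> card T \<le> m \<and> \<theta> * card T \<le> real (\<Sum>u\<in>U. min M (cov N T u))}"
  have "finite F" using finI by (auto simp: F_def)
  moreover have "{} \<in> F" by (auto simp: F_def intro: sum_nonneg)
  ultimately have "Max (card ` F) \<in> card ` F" by (intro Max_in) auto
  then obtain T where T: "T \<in> F" and "card T = Max (card ` F)" by auto
  then have mx: "card T' \<le> card T" if "T' \<in> F" for T'
    using that \<open>finite F\<close> by simp
  have finT: "finite T" using T finI by (auto simp: F_def intro: finite_subset)
  have "x \<notin> stuck N C M \<theta> T" if small: "card T < m" and x: "x \<in> I" for x
  proof
    assume st: "x \<in> stuck N C M \<theta> T"
    then have xT: "x \<notin> T" and gain: "\<theta> \<le> real (card {u \<in> N x. cov N T u < M})"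
      by (auto simp: stuck_def)
    have ci: "cov N (insert x T) u = cov N T u + of_bool (u \<in> N x)" for u
    proof -
      have "{y \<in> insert x T. u \<in> N y} = (if u \<in> N x then insert x {y \<in> T. u \<in> N y} else {y \<in> T. u \<in> N y})"
        by auto
      then show ?thesis using finT xT by (auto simp: cov_def)
    qed
    have "(\<Sum>u\<in>U. min M (cov N (insert x T) u))
        = (\<Sum>u\<in>U. min M (cov N T u) + of_bool (u \<in> N x \<and> cov N T u < M))"
      by (intro sum.cong) (auto simp: ci)
    also have "\<dots> = (\<Sum>u\<in>U. min M (cov N T u)) + card (U \<inter> {u. u \<in> N x \<and> cov N T u < M})"
      using finU by (simp add: sum.distrib)
    also have "U \<inter> {u. u \<in> N x \<and> cov N T u < M} = {u \<in> N x. cov N T u < M}"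
      using N[OF x] by auto
    finally have "insert x T \<in> F"
      using T gain x small xT finT by (auto simp: F_def algebra_simps simp del: of_nat_sum)
    from mx[OF this] show False using xT finT by simp
  qed
  then show ?thesis using T by (intro exI[of _ T]) (auto simp: F_def)
qed

section \<open>Triples \<open>(x, y, a)\<close> with \<open>dst y a = x\<close>\<close>

definition nbr :: "nat set \<Rightarrow> nat set \<Rightarrow> nat \<Rightarrow> nat set" where
  "nbr A C x = {y \<in> C. \<exists>a\<in>A. dst y a = x}"

text \<open>With \<open>nbr\<close>, one of two projections of the relation
  \<open>dst y a = x\<close>: \<open>nbr\<close> forgets which \<open>a\<close> joins
  \<open>x\<close> to \<open>y\<close>, and \<open>dif\<close> recovers the \<open>a\<close> once
  \<open>x\<close> is confined to a fingerprint \<open>T\<close>.\<close>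

definition dif :: "nat set \<Rightarrow> nat set \<Rightarrow> nat \<Rightarrow> nat set" where
  "dif A T y = {a \<in> A. dst y a \<in> T}"

lemma dst_eq_iff: "dst y a = x \<longleftrightarrow> y = a + x \<or> a = y + x"
  by (auto simp: dst_def)

lemma card_nbr_le: "finite A \<Longrightarrow> card (nbr A C x) \<le> 2 * card A"
proof -
  assume A: "finite A"
  have "nbr A C x \<subseteq> (\<lambda>a. a + x) ` A \<union> (\<lambda>a. a - x) ` A"
    by (force simp: nbr_def dst_eq_iff)
  then have "card (nbr A C x) \<le> card ((\<lambda>a. a + x) ` A \<union> (\<lambda>a. a - x) ` A)"
    using A by (intro card_mono) auto
  also have "\<dots> \<le> card A + card A"
    by (rule order_trans[OF card_Un_le]) (intro add_mono card_image_le A)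
  finally show ?thesis by simp
qed

text \<open>Double counting of the pairs \<open>(a, y)\<close> with \<open>y\<close> outside
  \<open>S\<close>: the distance \<open>x = dst y a\<close> and \<open>y\<close> determine
  \<open>a\<close> up to the two choices \<open>y + x\<close> and \<open>y - x\<close>, hence the
  division by 2.\<close>

lemma sum_nbr_ge:
  assumes A: "finite A" and C: "finite C" and S: "finite S"
    and h: "\<And>a. a \<in> A \<Longrightarrow> h \<le> real (hits C a)"
  shows "real (card A) * (h - card S) / 2 \<le> (\<Sum>x\<in>C. real (card (nbr A C x - S)))"
proof -
  define P where "P = (SIGMA a:A. {y \<in> C - S. dst y a \<in> C})"
  define Q where "Q = (SIGMA x:C. nbr A C x - S)"
  have finQ: "finite Q" using C by (auto simp: Q_def nbr_def)
  have "card P \<le> 2 * card Q"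
  proof (rule card_fibres_le[where f = "\<lambda>(a, y). (dst y a, y)"])
    show "finite P" using A C by (auto simp: P_def)
    show "(\<lambda>(a, y). (dst y a, y)) ` P \<subseteq> Q" by (auto simp: P_def Q_def nbr_def)
    show "card {p \<in> P. (case p of (a, y) \<Rightarrow> (dst y a, y)) = b} \<le> 2" for b
      by (rule card_le_two[of _ "(snd b + fst b, snd b)" "(snd b - fst b, snd b)"])
        (auto simp: dst_def split: prod.splits)
  qed (rule finQ)
  moreover have "real (card P) = (\<Sum>a\<in>A. real (card {y \<in> C - S. dst y a \<in> C}))"
    using A C by (simp add: P_def)
  moreover have "h - card S \<le> real (card {y \<in> C - S. dst y a \<in> C})" if "a \<in> A" for a
  proof -
    have "hits C a \<le> card ({y \<in> C - S. dst y a \<in> C} \<union> S)"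
      unfolding hits_def using C S by (intro card_mono) auto
    also have "\<dots> \<le> card {y \<in> C - S. dst y a \<in> C} + card S" by (rule card_Un_le)
    finally show ?thesis using h[OF that] by linarith
  qed
  then have "(\<Sum>a\<in>A. h - card S) \<le> (\<Sum>a\<in>A. real (card {y \<in> C - S. dst y a \<in> C}))"
    by (rule sum_mono)
  moreover have "real (card Q) = (\<Sum>x\<in>C. real (card (nbr A C x - S)))"
    using C by (simp add: Q_def nbr_def)
  ultimately show ?thesis by simp
qed

text \<open>Each \<open>x\<close> covering \<open>y\<close> has its own \<open>a\<close>, so much
  coverage means many elements of \<open>A\<close>. This is how the gain of the first stage becomes
  a supply of forced colours in the second.\<close>

lemma cov_le_card_dif:
  assumes "finite A" "y \<in> C"
  shows "cov (nbr A C) T y \<le> card (dif A T y)"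
proof -
  have "{x \<in> T. y \<in> nbr A C x} \<subseteq> dst y ` dif A T y"
    using assms by (auto simp: nbr_def dif_def)
  then have "cov (nbr A C) T y \<le> card (dst y ` dif A T y)"
    unfolding cov_def using assms by (intro card_mono) (auto simp: dif_def)
  also have "\<dots> \<le> card (dif A T y)" using assms by (intro card_image_le) (auto simp: dif_def)
  finally show ?thesis .
qed

lemma sum_dif_le:
  assumes "finite A" "finite C" "finite T"
  shows "(\<Sum>y\<in>C. card (dif A T y)) \<le> 2 * card T * card A"
proof -
  have "(\<Sum>y\<in>C. card (dif A T y)) = card (SIGMA y:C. dif A T y)"
    using assms by (simp add: dif_def)
  also have "\<dots> \<le> 2 * card (T \<times> A)"
  proof (rule card_fibres_le[where f = "\<lambda>(y, a). (dst y a, a)"])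
    show "card {p \<in> SIGMA y:C. dif A T y. (case p of (y, a) \<Rightarrow> (dst y a, a)) = b} \<le> 2" for b
      by (rule card_le_two[of _ "(snd b + fst b, snd b)" "(snd b - fst b, snd b)"])
        (auto simp: dst_def split: prod.splits)
  qed (use assms in \<open>auto simp: dif_def\<close>)
  finally show ?thesis by (simp add: card_cartesian_product)
qed

lemma sum_cov_le:
  assumes "finite U" "finite T" "\<And>x. x \<in> T \<Longrightarrow> card (N x) \<le> k" "\<And>x. x \<in> T \<Longrightarrow> finite (N x)"
  shows "(\<Sum>u\<in>U. cov N T u) \<le> card T * k"
proof -
  have "(\<Sum>u\<in>U. cov N T u) = (\<Sum>u\<in>U. \<Sum>x\<in>T. of_bool (u \<in> N x))"
    using assms(2) by (simp add: cov_def Int_def)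
  also have "\<dots> = (\<Sum>x\<in>T. \<Sum>u\<in>U. of_bool (u \<in> N x))" by (rule sum.swap)
  also have "\<dots> \<le> (\<Sum>x\<in>T. k)"
  proof (rule sum_mono)
    fix x assume x: "x \<in> T"
    have "(\<Sum>u\<in>U. of_bool (u \<in> N x)) = card (U \<inter> N x)" using assms(1) by simp
    also have "\<dots> \<le> card (N x)" using assms(4)[OF x] by (intro card_mono) auto
    finally show "(\<Sum>u\<in>U. of_bool (u \<in> N x)) \<le> k" using assms(3)[OF x] by simp
  qed
  finally show ?thesis by simp
qed

section \<open>The three fingerprint stages\<close>

lemma stage_one:
  fixes \<delta> :: real
  assumes A: "finite A" "card A > 0" and n: "n > 0" and C: "C \<subseteq> {1..n}" and I: "I \<subseteq> C" and d: "0 < \<delta>"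
    and h: "\<And>a. a \<in> A \<Longrightarrow> \<delta> * n \<le> real (hits C a)"
    and M: "4 * real (card A) * m \<le> \<delta> * n * M" "M > 0"
  shows "\<exists>T\<subseteq>I. card T \<le> m \<and>
    (card T = m \<and> card A * \<delta> / 8 * m \<le> real (\<Sum>y\<in>C. min M (cov (nbr A C) T y)) \<or>
     stuck (nbr A C) C M (card A * \<delta> / 8) T \<inter> I = {} \<and>
     \<delta> * n / 16 - m \<le> real (card (stuck (nbr A C) C M (card A * \<delta> / 8) T)))"
proof -
  let ?N = "nbr A C"
  have finC: "finite C" using C by (rule finite_subset) auto
  have finI: "finite I" using I finC by (rule finite_subset)
  obtain T where T: "T \<subseteq> I" "card T \<le> m"
    and val: "card A * \<delta> / 8 * card T \<le> real (\<Sum>y\<in>C. min M (cov ?N T y))"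
    and alt: "card T = m \<or> stuck ?N C M (card A * \<delta> / 8) T \<inter> I = {}"
    using fingerprint[OF finI I finC, of ?N m "real (card A) * \<delta> / 8" M] by (auto simp: nbr_def)
  have finT: "finite T" using T finI by (auto intro: finite_subset)
  \<comment> \<open>The saturated elements. The neighbourhoods of \<open>T\<close> have total size
    at most \<open>2 * m * card A\<close>, and \<open>M\<close> exceeds the average of this over
    \<open>n\<close> elements by a factor of at least 2/\<delta>. So at most
    \<open>\<delta> * n / 2\<close> elements are saturated, and at least half of the guaranteed
    \<open>\<delta> * n\<close> hits survives for every \<open>a\<close>.\<close>
  define S where "S = {y \<in> C. M \<le> cov ?N T y}"
  have finS: "finite S" using finC by (simp add: S_def)
  have "M * card S \<le> (\<Sum>y\<in>S. cov ?N T y)"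
    using sum_bounded_below[of S M "cov ?N T"] by (auto simp: S_def mult.commute)
  also have "\<dots> \<le> (\<Sum>y\<in>C. cov ?N T y)"
    using finC by (intro sum_mono2) (auto simp: S_def)
  also have "\<dots> \<le> card T * (2 * card A)"
    using finC finT A by (intro sum_cov_le card_nbr_le) (auto simp: nbr_def)
  also have "\<dots> \<le> m * (2 * card A)" using T by simp
  finally have "real (M * card S) \<le> real (m * (2 * card A))" by (simp only: of_nat_le_iff)
  then have "real M * card S \<le> real m * (2 * real (card A))" by simp
  then have "real M * card S \<le> real M * (\<delta> * n / 2)" using M(1) by argo
  then have S: "card S \<le> \<delta> * n / 2" using M by simp
  have gain: "{u \<in> ?N x. cov ?N T u < M} = ?N x - S" for x by (auto simp: S_def nbr_def)
  have "real (card A) * (\<delta> * n - card S) / 2 \<le> (\<Sum>x\<in>C. real (card (?N x - S)))"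
    by (rule sum_nbr_ge[OF A(1) finC finS h])
  moreover have "real (card A) * (\<delta> * n - \<delta> * n / 2) / 2 \<le> real (card A) * (\<delta> * n - card S) / 2"
    using S by (intro divide_right_mono mult_left_mono) auto
  ultimately have "card A * \<delta> * n / 4 \<le> (\<Sum>x\<in>C. real (card (?N x - S)))" by (simp add: algebra_simps)
  note mk = markov_card[OF finC finT _ _ _ this, of "2 * real (card A)" "real (card A) * \<delta> / 8"]
  have mk: "card A * \<delta> * n / 4 - card A * \<delta> / 8 * card C - 2 * real (card A) * card T
     \<le> 2 * real (card A) * card {x \<in> C - T. card A * \<delta> / 8 \<le> real (card (?N x - S))}"
  proof -
    have "card (?N x - S) \<le> 2 * card A" for x
      using order_trans[OF card_mono card_nbr_le[OF A(1), of C x], of "?N x - S"] finC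
      by (auto simp: nbr_def)
    then have "real (card (?N x - S)) \<le> 2 * real (card A)" for x
      by (metis of_nat_le_iff of_nat_mult of_nat_numeral)
    then show ?thesis using mk d by simp
  qed
  have "card C \<le> n" using card_mono[OF _ C] by simp
  then have "card A * \<delta> / 8 * card C \<le> card A * \<delta> / 8 * n" using d by (intro mult_left_mono) auto
  moreover have "2 * real (card A) * card T \<le> 2 * real (card A) * m" using T by (intro mult_left_mono) auto
  ultimately have "2 * real (card A) * (\<delta> * n / 16 - m)
     \<le> 2 * real (card A) * card {x \<in> C - T. card A * \<delta> / 8 \<le> real (card (?N x - S))}"
    using mk by (simp add: algebra_simps)
  then have "\<delta> * n / 16 - m \<le> real (card (stuck ?N C M (card A * \<delta> / 8) T))"
    using A unfolding stuck_def gain by simp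
  then show ?thesis using T val alt by blast
qed

text \<open>Each \<open>y\<close> offers the set \<open>dif A T1 y\<close> of elements of
  \<open>A\<close> that a red \<open>y\<close> would force to be blue; \<theta> is a quarter of the
  average offer guaranteed by \<open>deg\<close>. A full \<open>T\<close> collects at least
  \<open>m * \<theta>\<close> elements, which is at least \<open>4 * n / m\<close> by
  \<open>large\<close>. If fewer are collected, they account for at most half of the offers, and
  since the cap \<open>M\<close> bounds what a single \<open>y\<close> counts, many \<open>y\<close>
  still offer \<theta> new elements.\<close>

lemma stage_two:
  fixes \<delta> \<theta> :: real
  assumes A: "finite A" "card A > 0" and n: "n > 0" and C: "C \<subseteq> {1..n}" and I: "I \<subseteq> C" and d: "0 < \<delta>"
    and m: "m > 0" and T1: "finite T1" "card T1 \<le> m"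
    and deg: "card A * \<delta> / 8 * m \<le> real (\<Sum>y\<in>C. min M (cov (nbr A C) T1 y))"
    and M: "\<delta> * n * M \<le> 8 * real (card A) * m" "M > 0"
    and small: "4 * real n / m \<le> \<delta> * card A / 32"
    and large: "128 * (real n)\<^sup>2 \<le> real m ^ 3 * card A * \<delta>"
    and \<theta>_def: "\<theta> = real m * card A * \<delta> / (32 * real n)"
  shows "\<exists>T\<subseteq>I. card T \<le> m \<and>
    (4 * real n / m \<le> card (\<Union>y\<in>T. dif A T1 y) \<or>
     stuck (dif A T1) C 1 \<theta> T \<inter> I = {} \<and>
     \<delta>\<^sup>2 * n / 256 - m \<le> real (card (stuck (dif A T1) C 1 \<theta> T)))"
proof -
  let ?N = "dif A T1"
  have finC: "finite C" using C by (rule finite_subset) auto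
  have finI: "finite I" using I finC by (rule finite_subset)
  obtain T where T: "T \<subseteq> I" "card T \<le> m"
    and val: "\<theta> * card T \<le> real (\<Sum>a\<in>A. min 1 (cov ?N T a))"
    and alt: "card T = m \<or> stuck ?N C 1 \<theta> T \<inter> I = {}"
    using fingerprint[OF finI I A(1), of ?N m \<theta> 1] by (auto simp: dif_def)
  have finT: "finite T" using T finI by (auto intro: finite_subset)
  define A0 where "A0 = (\<Union>y\<in>T. ?N y)"
  have A0: "A0 \<subseteq> A" "finite A0" using A by (auto simp: A0_def dif_def intro: finite_subset)
  have eq: "(\<Sum>a\<in>A. min 1 (cov ?N T a)) = card A0"
    unfolding A0_def by (rule sum_min_one_cov[OF A(1) finT]) (auto simp: dif_def)
  have val: "\<theta> * card T \<le> card A0" using val unfolding eq .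
  have th: "0 \<le> \<theta>" using d by (simp add: \<theta>_def)
  show ?thesis
  proof (cases "4 * real n / m \<le> card A0")
    case True
    then show ?thesis using T unfolding A0_def by blast
  next
    case False
    have "4 * real n / m \<le> \<theta> * m"
      using large m n by (simp add: \<theta>_def field_simps power2_eq_square power3_eq_cube)
    then have "card T \<noteq> m" using False val by auto
    with alt have disj: "stuck ?N C 1 \<theta> T \<inter> I = {}" by blast
    have gain: "{u \<in> ?N y. cov ?N T u < 1} = ?N y - A0" for y
      using cov_less_one[OF finT, of ?N] by (auto simp: A0_def)
    define g where "g = (\<lambda>y. real (min M (card (?N y - A0))))"
    have "real (min M (cov (nbr A C) T1 y)) - card (dif A0 T1 y) \<le> g y" if "y \<in> C" for y
    proof -
      have fin: "finite (?N y)" using A by (simp add: dif_def)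
      have "card (?N y) \<le> card ((?N y - A0) \<union> dif A0 T1 y)"
        using A A0 by (intro card_mono) (auto simp: dif_def)
      also have "\<dots> \<le> card (?N y - A0) + card (dif A0 T1 y)" by (rule card_Un_le)
      finally show ?thesis using cov_le_card_dif[OF A(1) that, of T1] by (auto simp: g_def)
    qed
    then have "(\<Sum>y\<in>C. real (min M (cov (nbr A C) T1 y)) - card (dif A0 T1 y)) \<le> (\<Sum>y\<in>C. g y)"
      by (rule sum_mono)
    moreover have "real (\<Sum>y\<in>C. card (dif A0 T1 y)) \<le> real (2 * card T1 * card A0)"
      using sum_dif_le[OF A0(2) finC T1(1)] by (simp only: of_nat_le_iff)
    moreover have "real (2 * card T1 * card A0) \<le> 2 * real m * (\<delta> * card A / 32)"
    proof -
      have "real (card T1) * real (card A0) \<le> real m * (\<delta> * card A / 32)"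
        using T1 False small by (intro mult_mono) auto
      then show ?thesis by (simp add: algebra_simps)
    qed
    ultimately have "card A * \<delta> * m / 16 \<le> (\<Sum>y\<in>C. g y)"
      using deg by (simp add: sum_subtractf algebra_simps)
    from markov_card[OF finC finT _ _ th this, of M]
    have mk: "card A * \<delta> * m / 16 - \<theta> * card C - real M * card T
       \<le> real M * card {y \<in> C - T. \<theta> \<le> g y}" by (simp add: g_def)
    have "card C \<le> n" using card_mono[OF _ C] by simp
    then have "\<theta> * card C \<le> \<theta> * n" using th by (intro mult_left_mono) auto
    also have "\<theta> * n = card A * \<delta> * m / 32" using n by (simp add: \<theta>_def)
    finally have "card A * \<delta> * m / 32 \<le> real M * (card {y \<in> C - T. \<theta> \<le> g y} + card T)"
      using mk by (simp add: algebra_simps)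
    also have "\<dots> \<le> real M * (card (stuck ?N C 1 \<theta> T) + m)"
    proof -
      have "card {y \<in> C - T. \<theta> \<le> g y} \<le> card (stuck ?N C 1 \<theta> T)"
        unfolding stuck_def gain using finC by (intro card_mono) (auto simp: g_def)
      then show ?thesis using T by (intro mult_left_mono) auto
    qed
    finally have mM: "card A * \<delta> * m / 32 \<le> real M * (card (stuck ?N C 1 \<theta> T) + m)" .
    have "real M * (\<delta>\<^sup>2 * n / 256) \<le> real M * (card (stuck ?N C 1 \<theta> T) + m)"
    proof -
      have "\<delta> / 256 * (\<delta> * n * M) \<le> \<delta> / 256 * (8 * real (card A) * m)"
        using d by (intro mult_left_mono[OF M(1)]) auto
      then show ?thesis using mM unfolding power2_eq_square by argo
    qed
    then have "\<delta>\<^sup>2 * n / 256 \<le> card (stuck ?N C 1 \<theta> T) + m" using M(2) by simp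
    then show ?thesis using T disj by (intro exI[of _ T]) auto
  qed
qed

text \<open>To be applied to those elements of \<open>A\<close> that are already known to be blue.
  They may be far fewer than all of \<open>A\<close>; by \<open>large\<close>, \<open>m\<close>
  gains of \<open>card A * \<delta> / 8\<close> nevertheless add up to
  \<open>\<delta> * n / 2\<close> elements.\<close>

lemma stage_three:
  fixes \<delta> :: real
  assumes A: "finite A" and n: "n > 0" and C: "C \<subseteq> {1..n}" and I: "I \<subseteq> C" and d: "0 < \<delta>" and m: "m > 0"
    and h: "\<And>a. a \<in> A \<Longrightarrow> \<delta> * n \<le> real (hits C a)"
    and large: "4 * real n / m \<le> card A"
  shows "\<exists>T\<subseteq>I. card T \<le> m \<and>
    (\<delta> * n / 2 \<le> card (\<Union>x\<in>T. nbr A C x) \<or>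
     stuck (nbr A C) C 1 (card A * \<delta> / 8) T \<inter> I = {} \<and>
     \<delta> * n / 16 - m \<le> real (card (stuck (nbr A C) C 1 (card A * \<delta> / 8) T)))"
proof -
  let ?N = "nbr A C" and ?\<theta> = "real (card A) * \<delta> / 8"
  have A0: "real (card A) > 0" using large m n by (smt (verit) divide_pos_pos of_nat_0_less_iff)
  have finC: "finite C" using C by (rule finite_subset) auto
  have finI: "finite I" using I finC by (rule finite_subset)
  obtain T where T: "T \<subseteq> I" "card T \<le> m"
    and val: "?\<theta> * card T \<le> real (\<Sum>y\<in>C. min 1 (cov ?N T y))"
    and alt: "card T = m \<or> stuck ?N C 1 ?\<theta> T \<inter> I = {}"
    using fingerprint[OF finI I finC, of ?N m ?\<theta> 1] by (auto simp: nbr_def)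
  have finT: "finite T" using T finI by (auto intro: finite_subset)
  define Y where "Y = (\<Union>x\<in>T. ?N x)"
  have finY: "finite Y" using finC by (auto simp: Y_def nbr_def intro: finite_subset)
  have eq: "(\<Sum>y\<in>C. min 1 (cov ?N T y)) = card Y"
    unfolding Y_def by (rule sum_min_one_cov[OF finC finT]) (auto simp: nbr_def)
  have val: "?\<theta> * card T \<le> card Y" using val unfolding eq .
  show ?thesis
  proof (cases "\<delta> * n / 2 \<le> card Y")
    case True
    then show ?thesis using T unfolding Y_def by blast
  next
    case False
    have "4 * real n \<le> card A * m" using large m by (simp add: field_simps)
    from mult_left_mono[OF this, of "\<delta> / 8"] have "\<delta> * n / 2 \<le> ?\<theta> * m"
      using d by (simp add: algebra_simps)
    then have "card T \<noteq> m" using False val by auto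
    with alt have disj: "stuck ?N C 1 ?\<theta> T \<inter> I = {}" by blast
    have gain: "{u \<in> ?N y. cov ?N T u < 1} = ?N y - Y" for y
      using cov_less_one[OF finT, of ?N] by (auto simp: Y_def)
    have "real (card A) * (\<delta> * n - card Y) / 2 \<le> (\<Sum>x\<in>C. real (card (?N x - Y)))"
      by (rule sum_nbr_ge[OF A(1) finC finY h])
    moreover have "real (card A) * (\<delta> * n - \<delta> * n / 2) / 2 \<le> real (card A) * (\<delta> * n - card Y) / 2"
      using False by (intro divide_right_mono mult_left_mono) auto
    ultimately have "card A * \<delta> * n / 4 \<le> (\<Sum>x\<in>C. real (card (?N x - Y)))" by (simp add: algebra_simps)
    note mk = markov_card[OF finC finT _ _ _ this, of "2 * real (card A)" ?\<theta>]
    have mk: "card A * \<delta> * n / 4 - ?\<theta> * card C - 2 * real (card A) * card T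
       \<le> 2 * real (card A) * card {x \<in> C - T. ?\<theta> \<le> real (card (?N x - Y))}"
    proof -
      have "card (?N x - Y) \<le> 2 * card A" for x
        using order_trans[OF card_mono card_nbr_le[OF A(1), of C x], of "?N x - Y"] finC
        by (auto simp: nbr_def)
      then have "real (card (?N x - Y)) \<le> 2 * real (card A)" for x
        by (metis of_nat_le_iff of_nat_mult of_nat_numeral)
      then show ?thesis using mk d by simp
    qed
    have "card C \<le> n" using card_mono[OF _ C] by simp
    then have "?\<theta> * card C \<le> ?\<theta> * n" using d by (intro mult_left_mono) auto
    moreover have "2 * real (card A) * card T \<le> 2 * real (card A) * m" using T by (intro mult_left_mono) auto
    ultimately have "2 * real (card A) * (\<delta> * n / 16 - m)
       \<le> 2 * real (card A) * card {x \<in> C - T. ?\<theta> \<le> real (card (?N x - Y))}"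
      using mk by (simp add: algebra_simps)
    then have "\<delta> * n / 16 - m \<le> real (card (stuck ?N C 1 ?\<theta> T))"
      using A0 unfolding stuck_def gain by simp
    then show ?thesis using T disj by blast
  qed
qed

section \<open>Shrinking a pair of containers\<close>

lemma dst_schur: "dst y a > 0 \<Longrightarrow> y + dst y a = a \<or> a + dst y a = y"
  by (auto simp: dst_def)

lemma mono_free_dst:
  assumes "mono_free V \<kappa>" "a \<in> V" "y \<in> V" "dst y a \<in> V" "dst y a > 0" "\<kappa> y = \<kappa> (dst y a)"
  shows "\<kappa> a \<noteq> \<kappa> y"
  using dst_schur[OF assms(5)] assms(1-4,6) unfolding mono_free_def schur_triple_def by metis

text \<open>One of four things happens: the red part avoids the stuck set of the first or of the
  second stage, or the blue part avoids the stuck set of the third stage, or it avoids the elements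
  that would complete a blue triple with a fingerprint element and a blue \<open>a\<close>. Each of
  these sets depends on at most three fingerprints, hence the factor 4 and the cube, and each has at
  least \<open>\<delta>\<^sup>2 * n / 512\<close> elements.\<close>

lemma container_step:
  fixes \<delta> :: real and n m :: nat and A :: "nat set"
  assumes A: "finite A" "card A > 0" and n: "n > 0" and m: "m > 0"
    and d: "0 < \<delta>" "\<delta> \<le> 1"
    and C: "Cr \<subseteq> {1..n}" "Cb \<subseteq> {1..n}"
    and h: "\<And>a. a \<in> A \<Longrightarrow> \<delta> * n \<le> real (hits Cr a)" "\<And>a. a \<in> A \<Longrightarrow> \<delta> * n \<le> real (hits Cb a)"
    and m1: "real m \<le> \<delta>\<^sup>2 * n / 512"
    and m2: "128 * (real n)\<^sup>2 \<le> real m ^ 3 * card A * \<delta>"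
    and m3: "128 * real n \<le> \<delta> * card A * m"
  shows "\<exists>\<S>. finite \<S> \<and> card \<S> \<le> 4 * card {T. T \<subseteq> {1..n} \<and> card T \<le> m} ^ 3 \<and>
    (\<forall>(Cr', Cb') \<in> \<S>. Cr' \<subseteq> {1..n} \<and> Cb' \<subseteq> {1..n} \<and>
       real (card Cr' + card Cb') + \<delta>\<^sup>2 * n / 512 \<le> card Cr + card Cb) \<and>
    (\<forall>R \<kappa>. mono_free (A \<union> R) \<kappa> \<longrightarrow> {x\<in>R. \<kappa> x} \<subseteq> Cr \<longrightarrow> {x\<in>R. \<not> \<kappa> x} \<subseteq> Cb \<longrightarrow>
       (\<exists>(Cr', Cb') \<in> \<S>. {x\<in>R. \<kappa> x} \<subseteq> Cr' \<and> {x\<in>R. \<not> \<kappa> x} \<subseteq> Cb'))"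
proof -
  define Sub where "Sub = {T. T \<subseteq> {1..n} \<and> card T \<le> m}"
  define s where "s = real (card A)"
  have s: "s > 0" using A by (simp add: s_def)
  \<comment> \<open>The number that is rounded up is at least 1, so rounding at most doubles it.
    This yields both the lower bound on \<open>M\<close> for the first stage and the upper bound for
    the second.\<close>
  define M where "M = nat \<lceil>4 * s * m / (\<delta> * n)\<rceil>"
  define X1 where "X1 = (\<lambda>T1. stuck (nbr A Cr) Cr M (card A * \<delta> / 8) T1)"
  define X2 where "X2 = (\<lambda>T1 T2. stuck (dif A T1) Cr 1 (real m * card A * \<delta> / (32 * real n)) T2)"
  define A0 where "A0 = (\<lambda>T1 T2. \<Union>y\<in>T2. dif A T1 y)"
  define X3 where "X3 = (\<lambda>T1 T2 T3. stuck (nbr (A0 T1 T2) Cb) Cb 1 (card (A0 T1 T2) * \<delta> / 8) T3)"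
  define Y where "Y = (\<lambda>T1 T2 T3. \<Union>x\<in>T3. nbr (A0 T1 T2) Cb x)"
  define F where "F = (\<lambda>T1. (Cr - X1 T1, Cb)) ` Sub \<union> (\<lambda>(T1, T2). (Cr - X2 T1 T2, Cb)) ` (Sub \<times> Sub)
     \<union> ((\<lambda>(T1, T2, T3). (Cr, Cb - X3 T1 T2 T3)) ` (Sub \<times> Sub \<times> Sub)
     \<union> (\<lambda>(T1, T2, T3). (Cr, Cb - Y T1 T2 T3)) ` (Sub \<times> Sub \<times> Sub))"
  have Fi: "(Cr - X1 T1, Cb) \<in> F" if "T1 \<in> Sub" for T1
    using that unfolding F_def by (intro UnI1 imageI)
  have Fi2: "(Cr - X2 T1 T2, Cb) \<in> F" if "T1 \<in> Sub" "T2 \<in> Sub" for T1 T2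
    unfolding F_def by (rule UnI1, rule UnI2, rule image_eqI[of _ _ "(T1, T2)"]) (use that in simp_all)
  have Fi3: "(Cr, Cb - X3 T1 T2 T3) \<in> F" if "T1 \<in> Sub" "T2 \<in> Sub" "T3 \<in> Sub" for T1 T2 T3
    unfolding F_def
    by (rule UnI2, rule UnI1, rule image_eqI[of _ _ "(T1, T2, T3)"]) (use that in simp_all)
  have Fi4: "(Cr, Cb - Y T1 T2 T3) \<in> F" if "T1 \<in> Sub" "T2 \<in> Sub" "T3 \<in> Sub" for T1 T2 T3
    unfolding F_def
    by (rule UnI2, rule UnI2, rule image_eqI[of _ _ "(T1, T2, T3)"]) (use that in simp_all)
  \<comment> \<open>\<open>F\<close> also lists fingerprints that no colouring produces and whose
    sets may be small; only the pairs that really shrink are kept.\<close>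
  define \<S> where "\<S> = {(Cr', Cb') \<in> F. real (card Cr' + card Cb') + \<delta>\<^sup>2 * n / 512 \<le> card Cr + card Cb}"
  have finSub: "finite Sub" by (auto simp: Sub_def)
  have finF: "finite F" unfolding F_def using finSub by auto
  have "{} \<in> Sub" by (auto simp: Sub_def)
  then have P: "card Sub \<ge> 1" using finSub by (metis One_nat_def Suc_leI card_gt_0_iff empty_iff)
  have "card F \<le> card Sub + card Sub * card Sub + (card Sub * (card Sub * card Sub) + card Sub * (card Sub * card Sub))"
    unfolding F_def
    using finSub
    by (intro order_trans[OF card_Un_le] add_mono order_trans[OF card_image_le])
       (auto simp: card_cartesian_product)
  also have "\<dots> \<le> 4 * card Sub ^ 3"
  proof -
    define q where "q = card Sub"
    have "1 \<le> q" using P by (simp add: q_def)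
    then have "q ^ 1 \<le> q ^ 3" "q ^ 2 \<le> q ^ 3" by (intro power_increasing; simp)+
    moreover have "q + q * q + (q * (q * q) + q * (q * q)) = q ^ 1 + q ^ 2 + 2 * q ^ 3"
      by (simp add: power3_eq_cube power2_eq_square)
    ultimately show ?thesis unfolding q_def[symmetric] by linarith
  qed
  finally have cF: "card F \<le> 4 * card Sub ^ 3" .
  have "\<S> \<subseteq> F" by (auto simp: \<S>_def)
  then have S1: "finite \<S>" "card \<S> \<le> 4 * card Sub ^ 3"
    using finF cF card_mono[OF finF] by (auto intro: finite_subset order_trans)
  have finC: "finite Cr" "finite Cb" using C by (auto intro: finite_subset)
  have del: "real (card (C' - X)) + \<delta>\<^sup>2 * n / 512 \<le> card C'"
    if "finite C'" "X \<subseteq> C'" "\<delta>\<^sup>2 * n / 512 \<le> card X" for C' X :: "nat set"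
    using that card_Diff_subset[of X C'] card_mono[of C' X] by (auto simp: finite_subset)
  have d2: "\<delta>\<^sup>2 \<le> \<delta>" using d by (simp add: power2_eq_square mult_left_le)
  have dn: "\<delta>\<^sup>2 * n \<le> \<delta> * n" using d2 by (intro mult_right_mono) auto
  have dn0: "0 \<le> \<delta>\<^sup>2 * n" by simp
  have e1: "\<delta>\<^sup>2 * n / 512 \<le> \<delta> * n / 16 - m" "\<delta>\<^sup>2 * n / 512 \<le> \<delta>\<^sup>2 * n / 256 - m" "\<delta>\<^sup>2 * n / 512 \<le> \<delta> * n / 2"
    using m1 dn dn0 by linarith+
  have "\<delta> * (s * m) \<le> 1 * (s * m)" "\<delta> * n \<le> 1 * real n"
    using d s by (intro mult_right_mono; simp)+
  then have "\<delta> * n \<le> 4 * s * m" using m3 by (simp add: s_def algebra_simps)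
  then have rat: "4 * s * m / (\<delta> * n) \<ge> 1" using d n by simp
  have Mlo: "4 * s * m / (\<delta> * n) \<le> M" using rat unfolding M_def by linarith
  have Mhi: "M \<le> 2 * (4 * s * m / (\<delta> * n))" using rat unfolding M_def by linarith
  have M0: "M > 0" using Mlo rat by (metis gr0I of_nat_0 not_one_le_zero order_trans)
  have M1: "4 * real (card A) * m \<le> \<delta> * n * M"
    using Mlo d n by (simp add: s_def field_simps)
  have M2: "\<delta> * n * M \<le> 8 * real (card A) * m"
    using Mhi d n by (simp add: s_def field_simps)
  have small: "4 * real n / m \<le> \<delta> * card A / 32"
    using m3 m by (simp add: field_simps)
  have Xs: "X1 T1 \<subseteq> Cr" "X2 T1 T2 \<subseteq> Cr" "X3 T1 T2 T3 \<subseteq> Cb" "Y T1 T2 T3 \<subseteq> Cb" for T1 T2 T3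
    by (auto simp: X1_def X2_def X3_def Y_def stuck_def nbr_def)
  have cover: "\<exists>(Cr', Cb') \<in> \<S>. {x\<in>R. \<kappa> x} \<subseteq> Cr' \<and> {x\<in>R. \<not> \<kappa> x} \<subseteq> Cb'"
    if mf: "mono_free (A \<union> R) \<kappa>" and Rr: "{x\<in>R. \<kappa> x} \<subseteq> Cr" and Rb: "{x\<in>R. \<not> \<kappa> x} \<subseteq> Cb" for R \<kappa>
  proof -
    have inS: "\<exists>(Cr', Cb') \<in> \<S>. {x\<in>R. \<kappa> x} \<subseteq> Cr' \<and> {x\<in>R. \<not> \<kappa> x} \<subseteq> Cb'"
      if "(Cr', Cb') \<in> F" "real (card Cr' + card Cb') + \<delta>\<^sup>2 * n / 512 \<le> card Cr + card Cb"
        "{x\<in>R. \<kappa> x} \<subseteq> Cr'" "{x\<in>R. \<not> \<kappa> x} \<subseteq> Cb'" for Cr' Cb'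
      using that by (intro bexI[of _ "(Cr', Cb')"]) (auto simp: \<S>_def)
    obtain T1 where T1: "T1 \<subseteq> {x\<in>R. \<kappa> x}" "card T1 \<le> m"
      and alt1: "card T1 = m \<and> card A * \<delta> / 8 * m \<le> real (\<Sum>y\<in>Cr. min M (cov (nbr A Cr) T1 y)) \<or>
         X1 T1 \<inter> {x\<in>R. \<kappa> x} = {} \<and> \<delta> * n / 16 - m \<le> real (card (X1 T1))"
      using stage_one[OF A n C(1) Rr d(1) h(1) M1 M0] unfolding X1_def by blast
    have T1S: "T1 \<in> Sub" using T1 Rr C by (auto simp: Sub_def)
    have finT1: "finite T1" using T1S by (auto simp: Sub_def intro: finite_subset)
    show ?thesis
    proof (cases "X1 T1 \<inter> {x\<in>R. \<kappa> x} = {} \<and> \<delta> * n / 16 - m \<le> real (card (X1 T1))")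
      case True
      show ?thesis
      proof (rule inS[of "Cr - X1 T1" Cb])
        show "(Cr - X1 T1, Cb) \<in> F" by (rule Fi[OF T1S])
        show "real (card (Cr - X1 T1) + card Cb) + \<delta>\<^sup>2 * n / 512 \<le> card Cr + card Cb"
          using del[OF finC(1) Xs(1) order_trans[OF e1(1) conjunct2[OF True]]] by simp
      qed (use True Rr Rb in auto)
    next
      case False
      with alt1 have deg: "card A * \<delta> / 8 * m \<le> real (\<Sum>y\<in>Cr. min M (cov (nbr A Cr) T1 y))" by blast
      have "\<exists>T2\<subseteq>{x\<in>R. \<kappa> x}. card T2 \<le> m \<and> (4 * real n / m \<le> card (A0 T1 T2) \<or>
           X2 T1 T2 \<inter> {x\<in>R. \<kappa> x} = {} \<and> \<delta>\<^sup>2 * n / 256 - m \<le> real (card (X2 T1 T2)))"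
        unfolding X2_def A0_def
        by (rule stage_two[OF A n C(1) Rr d(1) m finT1 T1(2) deg M2 M0 small m2 refl])
      then obtain T2 where T2: "T2 \<subseteq> {x\<in>R. \<kappa> x}" "card T2 \<le> m"
        and alt2: "4 * real n / m \<le> card (A0 T1 T2) \<or>
           X2 T1 T2 \<inter> {x\<in>R. \<kappa> x} = {} \<and> \<delta>\<^sup>2 * n / 256 - m \<le> real (card (X2 T1 T2))"
        by blast
      have T2S: "T2 \<in> Sub" using T2 Rr C by (auto simp: Sub_def)
      show ?thesis
      proof (cases "X2 T1 T2 \<inter> {x\<in>R. \<kappa> x} = {} \<and> \<delta>\<^sup>2 * n / 256 - m \<le> real (card (X2 T1 T2))")
        case True
        show ?thesis
        proof (rule inS[of "Cr - X2 T1 T2" Cb])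
          show "(Cr - X2 T1 T2, Cb) \<in> F" by (rule Fi2[OF T1S T2S])
          show "real (card (Cr - X2 T1 T2) + card Cb) + \<delta>\<^sup>2 * n / 512 \<le> card Cr + card Cb"
            using del[OF finC(1) Xs(2) order_trans[OF e1(2) conjunct2[OF True]]] by simp
        qed (use True Rr Rb in auto)
      next
        case False
        with alt2 have big: "4 * real n / m \<le> card (A0 T1 T2)" by blast
        have subA: "A0 T1 T2 \<subseteq> A" by (auto simp: A0_def dif_def)
        have finA0: "finite (A0 T1 T2)" using subA A by (auto intro: finite_subset)
        \<comment> \<open>Here a colour in \<open>A\<close> is deduced rather than guessed:
          \<open>y\<close> and \<open>dst y a\<close> are both red, so \<open>a\<close> is
          blue.\<close>
        have blue: "\<not> \<kappa> a" if a: "a \<in> A0 T1 T2" for a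
        proof -
          obtain y where y: "y \<in> T2" "a \<in> A" "dst y a \<in> T1" using a by (auto simp: A0_def dif_def)
          have "dst y a > 0" using y(3) T1S by (auto simp: Sub_def)
          then show ?thesis using mono_free_dst[OF mf, of a y] y T1 T2 by auto
        qed
        have hb: "\<delta> * n \<le> real (hits Cb a)" if "a \<in> A0 T1 T2" for a using h(2) subA that by blast
        have "\<exists>T3\<subseteq>{x\<in>R. \<not> \<kappa> x}. card T3 \<le> m \<and> (\<delta> * n / 2 \<le> card (Y T1 T2 T3) \<or>
             X3 T1 T2 T3 \<inter> {x\<in>R. \<not> \<kappa> x} = {} \<and> \<delta> * n / 16 - m \<le> real (card (X3 T1 T2 T3)))"
          unfolding X3_def Y_def by (rule stage_three[OF finA0 n C(2) Rb d(1) m hb big])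
        then obtain T3 where T3: "T3 \<subseteq> {x\<in>R. \<not> \<kappa> x}" "card T3 \<le> m"
          and alt3: "\<delta> * n / 2 \<le> card (Y T1 T2 T3) \<or>
             X3 T1 T2 T3 \<inter> {x\<in>R. \<not> \<kappa> x} = {} \<and> \<delta> * n / 16 - m \<le> real (card (X3 T1 T2 T3))"
          by blast
        have T3S: "T3 \<in> Sub" using T3 Rb C by (auto simp: Sub_def)
        show ?thesis
        proof (cases "X3 T1 T2 T3 \<inter> {x\<in>R. \<not> \<kappa> x} = {} \<and> \<delta> * n / 16 - m \<le> real (card (X3 T1 T2 T3))")
          case True
          show ?thesis
          proof (rule inS[of Cr "Cb - X3 T1 T2 T3"])
            show "(Cr, Cb - X3 T1 T2 T3) \<in> F" by (rule Fi3[OF T1S T2S T3S])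
            show "real (card Cr + card (Cb - X3 T1 T2 T3)) + \<delta>\<^sup>2 * n / 512 \<le> card Cr + card Cb"
              using del[OF finC(2) Xs(3) order_trans[OF e1(1) conjunct2[OF True]]] by simp
          qed (use True Rr Rb in auto)
        next
          case False
          with alt3 have big: "\<delta> * n / 2 \<le> card (Y T1 T2 T3)" by blast
          \<comment> \<open>A blue \<open>y\<close> would form a blue triple with a fingerprint
            element \<open>x\<close> and a blue \<open>a\<close>.\<close>
          have "\<kappa> y" if y: "y \<in> Y T1 T2 T3" "y \<in> R" for y
          proof (rule ccontr)
            assume ny: "\<not> \<kappa> y"
            obtain x a where x: "x \<in> T3" "a \<in> A0 T1 T2" "dst y a = x"
              using y by (auto simp: Y_def nbr_def)
            have "x > 0" using x T3S by (auto simp: Sub_def)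
            moreover have "a \<in> A \<union> R" using x(2) subA by blast
            moreover have "y \<in> A \<union> R" "x \<in> A \<union> R" "\<not> \<kappa> x" using y x(1) T3 by auto
            ultimately show False using mono_free_dst[OF mf, of a y] x(3) ny blue[OF x(2)] by auto
          qed
          then have av: "Y T1 T2 T3 \<inter> {x\<in>R. \<not> \<kappa> x} = {}" by auto
          show ?thesis
          proof (rule inS[of Cr "Cb - Y T1 T2 T3"])
            show "(Cr, Cb - Y T1 T2 T3) \<in> F" by (rule Fi4[OF T1S T2S T3S])
            show "real (card Cr + card (Cb - Y T1 T2 T3)) + \<delta>\<^sup>2 * n / 512 \<le> card Cr + card Cb"
              using del[OF finC(2) Xs(4) order_trans[OF e1(3) big]] by simp
          qed (use av Rr Rb in auto)
        qed
      qed
    qed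
  qed
  have sub: "Cr' \<subseteq> {1..n} \<and> Cb' \<subseteq> {1..n}" if "(Cr', Cb') \<in> \<S>" for Cr' Cb'
    using that C by (auto simp: \<S>_def F_def)
  show ?thesis
    unfolding Sub_def[symmetric]
    by (intro exI[of _ \<S>] conjI S1) (use sub cover in \<open>auto simp: \<S>_def\<close>)
qed

section \<open>Iterating the container step\<close>

definition sparse_at :: "real \<Rightarrow> nat \<Rightarrow> nat set \<Rightarrow> nat set \<Rightarrow> bool" where
  "sparse_at \<delta> n A C \<longleftrightarrow> (\<exists>a\<in>A. real (hits C a) < \<delta> * n)"

text \<open>A pair with a sparse side is kept, every other pair is replaced by its refinements. Each
  refinement loses a fixed fraction of \<open>n\<close>, so a \<open>k\<close> depending on \<delta>
  alone makes the third alternative impossible, and the number of containers is only a bounded power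
  of the number of fingerprints.\<close>

lemma containers_iterate:
  fixes \<delta> :: real and n m :: nat and A :: "nat set"
  assumes A: "finite A" "card A > 0" and n: "n > 0" and m: "m > 0"
    and d: "0 < \<delta>" "\<delta> \<le> 1"
    and m1: "real m \<le> \<delta>\<^sup>2 * n / 512"
    and m2: "128 * (real n)\<^sup>2 \<le> real m ^ 3 * card A * \<delta>"
    and m3: "128 * real n \<le> \<delta> * card A * m"
  shows "\<exists>\<C>. finite \<C> \<and> card \<C> \<le> (4 * card {T. T \<subseteq> {1..n} \<and> card T \<le> m} ^ 3) ^ k \<and>
    (\<forall>(Cr, Cb) \<in> \<C>. Cr \<subseteq> {1..n} \<and> Cb \<subseteq> {1..n} \<and>
       (sparse_at \<delta> n A Cr \<or> sparse_at \<delta> n A Cb \<or>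
        real (card Cr + card Cb) + k * (\<delta>\<^sup>2 * n / 512) \<le> 2 * real n)) \<and>
    (\<forall>R \<kappa>. R \<subseteq> {1..n} \<longrightarrow> mono_free (A \<union> R) \<kappa> \<longrightarrow>
       (\<exists>(Cr, Cb) \<in> \<C>. {x\<in>R. \<kappa> x} \<subseteq> Cr \<and> {x\<in>R. \<not> \<kappa> x} \<subseteq> Cb))"
    (is "\<exists>\<C>. ?P k \<C>")
proof (induction k)
  case 0
  show ?case
  proof (intro exI[of _ "{({1..n}, {1..n})}"] conjI)
    show "\<forall>R \<kappa>. R \<subseteq> {1..n} \<longrightarrow> mono_free (A \<union> R) \<kappa> \<longrightarrow>
       (\<exists>(Cr, Cb) \<in> {({1..n}, {1..n})}. {x\<in>R. \<kappa> x} \<subseteq> Cr \<and> {x\<in>R. \<not> \<kappa> x} \<subseteq> Cb)"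
      by blast
  qed simp_all
next
  case (Suc k)
  let ?N = "4 * card {T. T \<subseteq> {1..n} \<and> card T \<le> m} ^ 3"
  obtain \<C> where \<C>: "?P k \<C>" using Suc.IH by (rule exE)
  note fin\<C> = \<C>[THEN conjunct1] and card\<C> = \<C>[THEN conjunct2, THEN conjunct1]
  note prop\<C> = \<C>[THEN conjunct2, THEN conjunct2, THEN conjunct1]
  note cov\<C> = \<C>[THEN conjunct2, THEN conjunct2, THEN conjunct2]
  define good where "good = (\<lambda>(Cr, Cb). sparse_at \<delta> n A Cr \<or> sparse_at \<delta> n A Cb)"
  have sub: "Cr \<subseteq> {1..n}" "Cb \<subseteq> {1..n}" if "(Cr, Cb) \<in> \<C>" for Cr Cb
    using prop\<C> that by auto
  define Q1 where "Q1 = (\<lambda>(Cr, Cb) \<S>. \<forall>(Cr', Cb') \<in> \<S>. Cr' \<subseteq> {1..n} \<and> Cb' \<subseteq> {1..n} \<and>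
       (if good (Cr, Cb) then (Cr', Cb') = (Cr, Cb) else real (card Cr' + card Cb') + \<delta>\<^sup>2 * n / 512 \<le> card Cr + card Cb))"
  define Q2 where "Q2 = (\<lambda>(Cr, Cb) \<S>. \<forall>R \<kappa>. mono_free (A \<union> R) \<kappa> \<longrightarrow> {x\<in>R. \<kappa> x} \<subseteq> Cr \<longrightarrow> {x\<in>R. \<not> \<kappa> x} \<subseteq> Cb \<longrightarrow>
       (\<exists>(Cr', Cb') \<in> \<S>. {x\<in>R. \<kappa> x} \<subseteq> Cr' \<and> {x\<in>R. \<not> \<kappa> x} \<subseteq> Cb'))"
  define Q where "Q = (\<lambda>c \<S>. finite \<S> \<and> card \<S> \<le> ?N \<and> Q1 c \<S> \<and> Q2 c \<S>)"
  have "\<exists>\<S>. Q c \<S>" if c: "c \<in> \<C>" for c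
  proof -
    obtain Cr Cb where cc: "c = (Cr, Cb)" by fastforce
    show ?thesis
    proof (cases "good (Cr, Cb)")
      case True
      have "finite {T. T \<subseteq> {1..n} \<and> card T \<le> m}" by auto
      moreover have "{} \<in> {T. T \<subseteq> {1..n} \<and> card T \<le> m}" by auto
      ultimately have "1 \<le> card {T. T \<subseteq> {1..n} \<and> card T \<le> m}"
        by (metis One_nat_def Suc_leI card_gt_0_iff empty_iff)
      from one_le_power[OF this, of 3] have "1 \<le> ?N" by linarith
      then have "Q c {(Cr, Cb)}" 
        using sub[of Cr Cb] c[unfolded cc] True by (simp add: Q_def Q1_def Q2_def cc)
      then show ?thesis by (rule exI)
    next
      case False
      then have h: "\<delta> * n \<le> real (hits Cr a)" "\<delta> * n \<le> real (hits Cb a)" if "a \<in> A" for a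
        using that by (auto simp: good_def sparse_at_def not_less)
      have sb: "Cr \<subseteq> {1..n}" "Cb \<subseteq> {1..n}" using sub c unfolding cc by blast+
      have "\<exists>\<S>. finite \<S> \<and> card \<S> \<le> ?N \<and>
        (\<forall>(Cr', Cb') \<in> \<S>. Cr' \<subseteq> {1..n} \<and> Cb' \<subseteq> {1..n} \<and>
           real (card Cr' + card Cb') + \<delta>\<^sup>2 * n / 512 \<le> card Cr + card Cb) \<and>
        (\<forall>R \<kappa>. mono_free (A \<union> R) \<kappa> \<longrightarrow> {x\<in>R. \<kappa> x} \<subseteq> Cr \<longrightarrow> {x\<in>R. \<not> \<kappa> x} \<subseteq> Cb \<longrightarrow>
           (\<exists>(Cr', Cb') \<in> \<S>. {x\<in>R. \<kappa> x} \<subseteq> Cr' \<and> {x\<in>R. \<not> \<kappa> x} \<subseteq> Cb'))"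
        by (rule container_step[OF A n m d sb h m1 m2 m3])
      then obtain \<S> where S: "finite \<S>" "card \<S> \<le> ?N"
        "\<forall>(Cr', Cb') \<in> \<S>. Cr' \<subseteq> {1..n} \<and> Cb' \<subseteq> {1..n} \<and>
           real (card Cr' + card Cb') + \<delta>\<^sup>2 * n / 512 \<le> card Cr + card Cb"
        "\<forall>R \<kappa>. mono_free (A \<union> R) \<kappa> \<longrightarrow> {x\<in>R. \<kappa> x} \<subseteq> Cr \<longrightarrow> {x\<in>R. \<not> \<kappa> x} \<subseteq> Cb \<longrightarrow>
           (\<exists>(Cr', Cb') \<in> \<S>. {x\<in>R. \<kappa> x} \<subseteq> Cr' \<and> {x\<in>R. \<not> \<kappa> x} \<subseteq> Cb')"
        by (elim exE conjE) (rule that)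
      have "Q c \<S>" unfolding Q_def Q1_def Q2_def cc split if_not_P[OF False]
        by (intro conjI S)
      then show ?thesis by (rule exI)
    qed
  qed
  then obtain \<S> where \<S>: "\<And>c. c \<in> \<C> \<Longrightarrow> Q c (\<S> c)" by metis
  have fin: "finite \<C>" "\<And>c. c \<in> \<C> \<Longrightarrow> finite (\<S> c)" "\<And>c. c \<in> \<C> \<Longrightarrow> card (\<S> c) \<le> ?N"
    using fin\<C> \<S> by (auto simp: Q_def)
  have "card (\<Union>c\<in>\<C>. \<S> c) \<le> (\<Sum>c\<in>\<C>. card (\<S> c))" by (rule card_UN_le[OF fin(1)])
  also have "\<dots> \<le> card \<C> * ?N" using sum_mono[of \<C> "\<lambda>c. card (\<S> c)" "\<lambda>_. ?N"] fin by simp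
  also have "\<dots> \<le> ?N ^ k * ?N" using card\<C> by (intro mult_right_mono) auto
  finally have c1: "card (\<Union>c\<in>\<C>. \<S> c) \<le> ?N ^ Suc k" by (simp only: power_Suc2)
  have c2: "Cr' \<subseteq> {1..n} \<and> Cb' \<subseteq> {1..n} \<and> (sparse_at \<delta> n A Cr' \<or> sparse_at \<delta> n A Cb' \<or>
        real (card Cr' + card Cb') + Suc k * (\<delta>\<^sup>2 * n / 512) \<le> 2 * real n)"
    if mem: "(Cr', Cb') \<in> (\<Union>c\<in>\<C>. \<S> c)" for Cr' Cb'
  proof -
    obtain Cr Cb where c: "(Cr, Cb) \<in> \<C>" "(Cr', Cb') \<in> \<S> (Cr, Cb)" using mem by auto
    have q: "Cr' \<subseteq> {1..n}" "Cb' \<subseteq> {1..n}"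
       "if good (Cr, Cb) then (Cr', Cb') = (Cr, Cb) else real (card Cr' + card Cb') + \<delta>\<^sup>2 * n / 512 \<le> card Cr + card Cb"
      using \<S>[OF c(1)] c(2) by (auto simp: Q_def Q1_def)
    have old: "good (Cr, Cb) \<or> real (card Cr + card Cb) + k * (\<delta>\<^sup>2 * n / 512) \<le> 2 * real n"
      using prop\<C> c(1) by (auto simp: good_def)
    have "good (Cr', Cb') \<or> real (card Cr' + card Cb') + Suc k * (\<delta>\<^sup>2 * n / 512) \<le> 2 * real n"
      using q(3) old by (cases "good (Cr, Cb)") (auto simp: algebra_simps add_divide_distrib)
    then show ?thesis using q(1,2) by (auto simp: good_def)
  qed
  have c3: "\<exists>(Cr, Cb) \<in> (\<Union>c\<in>\<C>. \<S> c). {x\<in>R. \<kappa> x} \<subseteq> Cr \<and> {x\<in>R. \<not> \<kappa> x} \<subseteq> Cb"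
    if R: "R \<subseteq> {1..n}" "mono_free (A \<union> R) \<kappa>" for R \<kappa>
  proof -
    obtain c where c: "c \<in> \<C>" and "case c of (Cr, Cb) \<Rightarrow> {x\<in>R. \<kappa> x} \<subseteq> Cr \<and> {x\<in>R. \<not> \<kappa> x} \<subseteq> Cb"
      using cov\<C>[rule_format, OF R] by (rule bexE)
    moreover obtain Cr Cb where cc: "c = (Cr, Cb)" by (cases c)
    ultimately have R': "{x\<in>R. \<kappa> x} \<subseteq> Cr" "{x\<in>R. \<not> \<kappa> x} \<subseteq> Cb" by simp_all
    have "\<exists>(Cr', Cb') \<in> \<S> c. {x\<in>R. \<kappa> x} \<subseteq> Cr' \<and> {x\<in>R. \<not> \<kappa> x} \<subseteq> Cb'"
      using \<S>[OF c, unfolded Q_def, THEN conjunct2, THEN conjunct2, THEN conjunct2, unfolded cc Q2_def split,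
          rule_format, OF R(2) R'] unfolding cc .
    then show ?thesis using c by (elim bexE) (rule bexI, assumption, blast)
  qed
  show ?case
  proof (intro exI[of _ "\<Union>c\<in>\<C>. \<S> c"] conjI allI impI)
    show "finite (\<Union>c\<in>\<C>. \<S> c)" using fin by blast
    show "card (\<Union>c\<in>\<C>. \<S> c) \<le> ?N ^ Suc k" by (rule c1)
    show "\<forall>(Cr, Cb) \<in> (\<Union>c\<in>\<C>. \<S> c). Cr \<subseteq> {1..n} \<and> Cb \<subseteq> {1..n} \<and>
       (sparse_at \<delta> n A Cr \<or> sparse_at \<delta> n A Cb \<or>
        real (card Cr + card Cb) + Suc k * (\<delta>\<^sup>2 * n / 512) \<le> 2 * real n)"
      by (intro ballI case_prodI2, rule c2) simp
    show "\<exists>(Cr, Cb) \<in> (\<Union>c\<in>\<C>. \<S> c). {x\<in>R. \<kappa> x} \<subseteq> Cr \<and> {x\<in>R. \<not> \<kappa> x} \<subseteq> Cb"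
      if "R \<subseteq> {1..n}" "mono_free (A \<union> R) \<kappa>" for R \<kappa> by (rule c3[OF that])
  qed
qed

section \<open>Schur triples around a container\<close>

text \<open>Ordered pairs, with \<open>x = y\<close> allowed; the at most \<open>n\<close>
  degenerate ones are discarded where distinct elements are required.\<close>

definition tri :: "nat set \<Rightarrow> nat" where
  "tri X = card {(x, y). x \<in> X \<and> y \<in> X \<and> x + y \<in> X}"

definition cmp :: "nat set \<Rightarrow> nat \<Rightarrow> (nat \<times> nat) set" where
  "cmp B v = {(b, b'). b \<in> B \<and> b' \<in> B \<and> (b + b' = v \<or> v + b = b' \<or> v + b' = b)}"

text \<open>Schur's difference argument, counted: \<open>a < b < c\<close> in \<open>X\<close> gives
  the triple \<open>(b - a, c - b, c - a)\<close>. Taking one element from each third of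
  \<open>X\<close> produces \<open>t ^ 3\<close> choices. A Schur triple in \<open>Y\<close> arises
  from at most \<open>n\<close> of them, one for each \<open>a\<close>; a difference outside
  \<open>Y\<close> is charged to a pair in \<open>P\<close> together with the remaining element,
  which has three possible positions.\<close>

lemma diff_triples:
  assumes X: "X \<subseteq> {1..n}" and Y: "Y \<subseteq> {1..n}" and t: "3 * t \<le> card X"
  defines "P \<equiv> {(x, x'). x \<in> X \<and> x' \<in> X \<and> x < x' \<and> x' - x \<notin> Y}"
  shows "t ^ 3 \<le> n * tri Y + 3 * n * card P"
proof -
  have fin: "finite X" "finite Y" using X Y by (auto intro: finite_subset)
  have cX: "card X \<le> n" using card_mono[OF _ X] by simp
  have finP: "finite P" unfolding P_def using fin by (auto intro: finite_subset[of _ "X \<times> X"])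
  define f where "f = (\<lambda>i. sorted_list_of_set X ! i)"
  have f: "f i \<in> X" if "i < card X" for i
    using that fin nth_mem[of i "sorted_list_of_set X"] by (simp add: f_def)
  have fm: "f i < f j" if "i < j" "j < card X" for i j
    using that fin strict_sorted_list_of_set[of X] unfolding f_def
    by (auto simp: strict_sorted_iff sorted_wrt_iff_nth_less)
  have fi: "i = j" if "f i = f j" "i < card X" "j < card X" for i j
    using fm[of i j] fm[of j i] that by (metis less_irrefl nat_neq_iff)
  define Z where "Z = {(a, b, c). a \<in> X \<and> b \<in> X \<and> c \<in> X \<and> a < b \<and> b < c}"
  have finZ: "finite Z" unfolding Z_def using fin by (auto intro: finite_subset[of _ "X \<times> X \<times> X"])
  have "card ({..<t} \<times> {t..<2*t} \<times> {2*t..<3*t}) \<le> card Z"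
  proof (rule card_inj_on_le[of "\<lambda>(i, j, l). (f i, f j, f l)"])
    show "inj_on (\<lambda>(i, j, l). (f i, f j, f l)) ({..<t} \<times> {t..<2*t} \<times> {2*t..<3*t})"
      using t by (auto simp: inj_on_def dest!: fi)
    show "(\<lambda>(i, j, l). (f i, f j, f l)) ` ({..<t} \<times> {t..<2*t} \<times> {2*t..<3*t}) \<subseteq> Z"
      using t by (auto simp: Z_def intro!: f fm)
  qed (rule finZ)
  then have "t ^ 3 \<le> card Z" by (simp add: card_cartesian_product power3_eq_cube)
  define G where "G = {(a, b, c) \<in> Z. b - a \<in> Y \<and> c - b \<in> Y \<and> c - a \<in> Y}"
  define T where "T = {(x, y). x \<in> Y \<and> y \<in> Y \<and> x + y \<in> Y}"
  have finT: "finite T" unfolding T_def using fin by (auto intro: finite_subset[of _ "Y \<times> Y"])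
  have "card G \<le> n * card T"
  proof (rule card_fibres_le[where f = "\<lambda>(a, b, c). (b - a, c - b)"])
    show "finite G" using finZ by (auto simp: G_def intro: finite_subset)
    show "(\<lambda>(a, b, c). (b - a, c - b)) ` G \<subseteq> T" by (auto simp: G_def T_def Z_def)
    show "card {g \<in> G. (case g of (a, b, c) \<Rightarrow> (b - a, c - b)) = p} \<le> n" for p
    proof -
      have "{g \<in> G. (case g of (a, b, c) \<Rightarrow> (b - a, c - b)) = p}
          \<subseteq> (\<lambda>a. (a, a + fst p, a + fst p + snd p)) ` {1..n}"
        using X by (force simp: G_def Z_def)
      then have "card {g \<in> G. (case g of (a, b, c) \<Rightarrow> (b - a, c - b)) = p}
          \<le> card ((\<lambda>a. (a, a + fst p, a + fst p + snd p)) ` {1..n})" by (intro card_mono) auto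
      also have "\<dots> \<le> n" using card_image_le[of "{1..n}" "\<lambda>a. (a, a + fst p, a + fst p + snd p)"] by simp
      finally show ?thesis .
    qed
  qed (rule finT)
  define Q where "Q = P \<times> X"
  have Q: "card Q \<le> n * card P" using cX by (simp add: Q_def card_cartesian_product mult.commute)
  have finQ: "finite Q" using finP fin by (simp add: Q_def)
  have "Z \<subseteq> G \<union> ((\<lambda>((a, b), c). (a, b, c)) ` Q \<union> ((\<lambda>((b, c), a). (a, b, c)) ` Q \<union> (\<lambda>((a, c), b). (a, b, c)) ` Q))"
  proof
    fix z assume "z \<in> Z"
    then obtain a b c where z: "z = (a, b, c)" "a \<in> X" "b \<in> X" "c \<in> X" "a < b" "b < c" by (auto simp: Z_def)
    consider "z \<in> G" | "b - a \<notin> Y" | "c - b \<notin> Y" | "c - a \<notin> Y" using z by (auto simp: G_def Z_def)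
    then show "z \<in> G \<union> ((\<lambda>((a, b), c). (a, b, c)) ` Q \<union> ((\<lambda>((b, c), a). (a, b, c)) ` Q \<union> (\<lambda>((a, c), b). (a, b, c)) ` Q))"
    proof cases
      case 2
      then have "((a, b), c) \<in> Q" using z by (auto simp: Q_def P_def)
      then show ?thesis using z(1) by force
    next
      case 3
      then have "((b, c), a) \<in> Q" using z by (auto simp: Q_def P_def)
      then show ?thesis using z(1) by force
    next
      case 4
      then have "((a, c), b) \<in> Q" using z by (auto simp: Q_def P_def)
      then show ?thesis using z(1) by force
    qed simp
  qed
  then have "card Z \<le> card (G \<union> ((\<lambda>((a, b), c). (a, b, c)) ` Q \<union> ((\<lambda>((b, c), a). (a, b, c)) ` Q \<union> (\<lambda>((a, c), b). (a, b, c)) ` Q)))"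
    using finQ finZ by (intro card_mono) (auto simp: G_def intro: finite_subset)
  also have "\<dots> \<le> card G + (card Q + (card Q + card Q))"
    by (intro order_trans[OF card_Un_le] add_mono card_image_le finQ order_refl)
  finally have "card Z \<le> card G + 3 * card Q" by simp
  then show ?thesis using \<open>t ^ 3 \<le> card Z\<close> \<open>card G \<le> n * card T\<close> Q by (simp add: tri_def T_def)
qed

lemma card_diff_pairs_le:
  assumes "X \<subseteq> {1..n}" "finite E"
  shows "card {(x, x'). x \<in> X \<and> x' \<in> X \<and> x < x' \<and> x' - x \<in> X \<union> E} \<le> tri X + card E * n"
proof -
  have fin: "finite X" using assms by (auto intro: finite_subset)
  define T where "T = {(x, y). x \<in> X \<and> y \<in> X \<and> x + y \<in> X}"
  have finT: "finite T" unfolding T_def using fin by (auto intro: finite_subset[of _ "X \<times> X"])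
  have "{(x, x'). x \<in> X \<and> x' \<in> X \<and> x < x' \<and> x' - x \<in> X \<union> E}
     \<subseteq> (\<lambda>(d, x). (x, x + d)) ` (T \<union> E \<times> {1..n})"
  proof
    fix p assume "p \<in> {(x, x'). x \<in> X \<and> x' \<in> X \<and> x < x' \<and> x' - x \<in> X \<union> E}"
    then obtain x x' where p: "p = (x, x')" "x \<in> X" "x' \<in> X" "x < x'" "x' - x \<in> X \<union> E" by auto
    then have "(x' - x, x) \<in> T \<union> E \<times> {1..n}" using assms by (auto simp: T_def)
    then show "p \<in> (\<lambda>(d, x). (x, x + d)) ` (T \<union> E \<times> {1..n})"
      using p by (intro image_eqI[of _ _ "(x' - x, x)"]) auto
  qed
  then have "card {(x, x'). x \<in> X \<and> x' \<in> X \<and> x < x' \<and> x' - x \<in> X \<union> E} \<le> card (T \<union> E \<times> {1..n})"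
    using finT assms by (intro surj_card_le) auto
  also have "\<dots> \<le> card T + card E * n" using card_Un_le[of T "E \<times> {1..n}"] by (simp add: card_cartesian_product)
  finally show ?thesis by (simp add: tri_def T_def)
qed

text \<open>If \<open>X\<close> is large and has few Schur triples, few pairs in \<open>X\<close>
  have their difference in \<open>X\<close>, and few have it in the small set \<open>E\<close>. The
  other differences lie in \<open>Y\<close>, where \<open>diff_triples\<close> then finds many
  triples.\<close>

lemma two_classes:
  fixes \<delta> :: real
  assumes X: "X \<subseteq> {1..n}" and Y: "Y \<subseteq> {1..n}" and E: "finite E" "{1..n} \<subseteq> X \<union> Y \<union> E"
    and big: "real n \<le> 3 * card X" and small: "6000 * real (card E) \<le> n" and n: "n \<ge> 100"
    and d: "\<delta> \<le> 1 / 100000"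
    and tX: "real (tri X) < \<delta> * (real n)\<^sup>2"
  shows "\<delta> * (real n)\<^sup>2 \<le> tri Y"
proof (rule ccontr)
  assume "\<not> \<delta> * (real n)\<^sup>2 \<le> tri Y"
  then have tY: "real (tri Y) < \<delta> * (real n)\<^sup>2" by simp
  define t where "t = card X div 3"
  have t: "3 * t \<le> card X" by (simp add: t_def)
  have fin: "finite X" using X by (auto intro: finite_subset)
  define P where "P = {(x, x'). x \<in> X \<and> x' \<in> X \<and> x < x' \<and> x' - x \<notin> Y}"
  have "card P \<le> card {(x, x'). x \<in> X \<and> x' \<in> X \<and> x < x' \<and> x' - x \<in> X \<union> E}"
  proof (rule card_mono)
    show "finite {(x, x'). x \<in> X \<and> x' \<in> X \<and> x < x' \<and> x' - x \<in> X \<union> E}"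
      using fin by (auto intro: finite_subset[of _ "X \<times> X"])
    show "P \<subseteq> {(x, x'). x \<in> X \<and> x' \<in> X \<and> x < x' \<and> x' - x \<in> X \<union> E}"
    proof
      fix p assume "p \<in> P"
      then obtain x x' where p: "p = (x, x')" "x \<in> X" "x' \<in> X" "x < x'" "x' - x \<notin> Y" by (auto simp: P_def)
      have "x' \<le> n" using p X by auto
      then have "x' - x \<in> {1..n}" using p(4) by auto
      then have "x' - x \<in> X \<union> E" using E p(5) by blast
      then show "p \<in> {(x, x'). x \<in> X \<and> x' \<in> X \<and> x < x' \<and> x' - x \<in> X \<union> E}" using p by auto
    qed
  qed
  also have "\<dots> \<le> tri X + card E * n" by (rule card_diff_pairs_le[OF X E(1)])
  finally have P: "card P \<le> tri X + card E * n" .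
  have "t ^ 3 \<le> n * tri Y + 3 * n * card P"
    using diff_triples[OF X Y t] by (simp add: P_def)
  also have "\<dots> \<le> n * tri Y + 3 * n * (tri X + card E * n)" using P by (intro add_mono mult_left_mono) auto
  finally have "real (t ^ 3) \<le> real (n * tri Y + 3 * n * (tri X + card E * n))" by (simp only: of_nat_le_iff)
  then have "real t ^ 3 \<le> n * real (tri Y) + 3 * real n * (tri X + real (card E) * n)" by simp
  also have "\<dots> \<le> n * (\<delta> * (real n)\<^sup>2) + 3 * real n * (\<delta> * (real n)\<^sup>2 + real n / 6000 * n)"
    using tX tY small by (intro add_mono mult_left_mono mult_right_mono) auto
  also have "\<dots> = (4 * \<delta> + 1 / 2000) * real n ^ 3" by (simp add: power2_eq_square power3_eq_cube algebra_simps)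
  \<comment> \<open>The share 1/2000 comes from \<open>E\<close> and \<open>4 * \<delta>\<close>
    from the triples. Together they stay below 1/1000, the cube of the 1/10 in
    \<open>t \<ge> n / 10\<close>.\<close>
  also have "\<dots> < (1 / 1000) * real n ^ 3" using d n by (intro mult_strict_right_mono) auto
  also have "\<dots> = (real n / 10) ^ 3" by (simp add: power_divide)
  also have "\<dots> \<le> real t ^ 3"
  proof (intro power_mono)
    have "card X \<le> 3 * t + 2" unfolding t_def by linarith
    then show "real n / 10 \<le> real t" using big n by simp
  qed auto
  finally show False by simp
qed

lemma finite_cmp: "finite B \<Longrightarrow> finite (cmp B v)"
  unfolding cmp_def by (auto intro: finite_subset[of _ "B \<times> B"])

lemma dst_cmp:
  assumes "x + e = e'"
  shows "dst x a + dst e' a = e \<or> e + dst x a = dst e' a \<or> e + dst e' a = dst x a"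
  using assms by (auto simp: dst_def)

text \<open>Let \<open>E\<close> be the elements of \<open>C\<close> with few completing pairs in
  \<open>B\<close>. If a difference of two elements of \<open>E\<close> is not in \<open>B\<close>,
  it lies in \<open>C\<close>; since \<open>C\<close> is sparse at \<open>a\<close>, the map
  \<open>v \<mapsto> |v - a|\<close> sends both this difference and the larger element into
  \<open>B\<close>, with few exceptions, and the smaller element gains a completing pair in
  \<open>B\<close>. So most differences of a large \<open>E\<close> would lie in \<open>B\<close>
  and create too many triples there. Hence \<open>E\<close> is small, and \<open>two_classes\<close>
  applies to \<open>B\<close> and \<open>D\<close>.\<close>

lemma many_triples:
  fixes \<delta> :: real
  assumes B: "B \<subseteq> {1..n}" and a: "a \<in> {1..n}"
    and n: "n \<ge> 10 ^ 16" and d: "\<delta> = (1 / 6000) ^ 3 / 1000"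
    and h: "real (hits ({1..n} - B) a) \<le> \<delta> * n"
  shows "\<delta> * (real n)\<^sup>2 \<le> tri B \<or>
     \<delta> * (real n)\<^sup>2 \<le> tri {v \<in> {1..n} - B. \<delta> * n \<le> card (cmp B v)}"
proof (rule ccontr)
  assume neg: "\<not> ?thesis"
  define C where "C = {1..n} - B"
  define D where "D = {v \<in> C. \<delta> * n \<le> card (cmp B v)}"
  define E where "E = C - D"
  have tB: "real (tri B) < \<delta> * (real n)\<^sup>2" and tD: "real (tri D) < \<delta> * (real n)\<^sup>2"
    using neg by (auto simp: C_def D_def)
  have CE: "E \<subseteq> {1..n}" "C \<subseteq> {1..n}" "D \<subseteq> {1..n}" by (auto simp: C_def D_def E_def)
  have fin: "finite B" "finite C" "finite D" "finite E" using B CE by (auto intro: finite_subset)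
  have n': "real n \<ge> 10 ^ 16" using n by (metis of_nat_le_iff of_nat_numeral of_nat_power)
  have d0: "\<delta> > 0" "\<delta> \<le> 1 / 100000" by (simp_all add: d power_divide)
  have small: "6000 * real (card E) < n"
  proof (rule ccontr)
    assume "\<not> 6000 * real (card E) < n"
    then have big: "real n \<le> 6000 * real (card E)" by simp
    define P where "P = {(e, e'). e \<in> E \<and> e' \<in> E \<and> e < e' \<and> e' - e \<notin> B}"
    \<comment> \<open>The exceptions: \<open>a\<close> itself, which is sent to 0, and the elements
      counted by \<open>hits C a\<close>.\<close>
    define V where "V = {v \<in> C. dst v a \<notin> B}"
    have finV: "finite V" using fin by (simp add: V_def)
    have "V \<subseteq> insert a {v \<in> C. dst v a \<in> C}"
    proof
      fix v assume v: "v \<in> V"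
      have "dst v a \<le> n" using v a by (auto simp: V_def C_def dst_def)
      then show "v \<in> insert a {v \<in> C. dst v a \<in> C}"
        using v by (cases "dst v a = 0") (auto simp: V_def C_def dst_def)
    qed
    then have "card V \<le> card (insert a {v \<in> C. dst v a \<in> C})" using fin by (intro card_mono) auto
    also have "\<dots> \<le> Suc (hits C a)" unfolding hits_def using fin by (simp add: card_insert_if)
    finally have V: "real (card V) \<le> \<delta> * n + 1" using h by (simp add: C_def)
    define P1 where "P1 = (\<lambda>(v, e). (e, v)) ` (V \<times> {1..n}) \<union> (\<lambda>(x, e). (e, e + x)) ` (V \<times> {1..n})"
    define P2 where "P2 = {(e, e') \<in> P. dst (e' - e) a \<in> B \<and> dst e' a \<in> B}"
    have finP: "finite P" unfolding P_def using fin by (auto intro: finite_subset[of _ "E \<times> E"])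
    have "P \<subseteq> P1 \<union> P2"
    proof
      fix p assume "p \<in> P"
      then obtain e e' where p: "p = (e, e')" "e \<in> E" "e' \<in> E" "e < e'" "e' - e \<notin> B" by (auto simp: P_def)
      have en: "e \<in> {1..n}" "e' \<in> {1..n}" "e' \<in> C" using p CE by (auto simp: E_def)
      then have x: "e' - e \<in> C" using p unfolding C_def by auto
      show "p \<in> P1 \<union> P2"
      proof (cases "dst (e' - e) a \<in> B \<and> dst e' a \<in> B")
        case True
        then show ?thesis using p by (auto simp: P2_def P_def)
      next
        case False
        then consider "e' - e \<in> V" | "e' \<in> V" using x en by (auto simp: V_def)
        then show ?thesis
        proof cases
          case 1
          then have "p \<in> (\<lambda>(x, e). (e, e + x)) ` (V \<times> {1..n})"
            using p en by (intro image_eqI[of _ _ "(e' - e, e)"]) auto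
          then show ?thesis by (simp add: P1_def)
        next
          case 2
          then have "p \<in> (\<lambda>(v, e). (e, v)) ` (V \<times> {1..n})"
            using p en by (intro image_eqI[of _ _ "(e', e)"]) auto
          then show ?thesis by (simp add: P1_def)
        qed
      qed
    qed
    then have "card P \<le> card (P1 \<union> P2)"
      using finV finP by (intro card_mono) (auto simp: P1_def P2_def intro: finite_subset)
    also have "\<dots> \<le> card P1 + card P2" by (rule card_Un_le)
    also have "card P1 \<le> card V * n + card V * n"
      unfolding P1_def using finV
      by (intro order_trans[OF card_Un_le] add_mono order_trans[OF card_image_le])
        (auto simp: card_cartesian_product)
    also have "card P2 \<le> 2 * card (SIGMA e:E. cmp B e)"
    proof (rule card_fibres_le[where f = "\<lambda>(e, e'). (e, (dst (e' - e) a, dst e' a))"])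
      show "finite (SIGMA e:E. cmp B e)" using fin finite_cmp by auto
      show "finite P2" using finP by (auto simp: P2_def intro: finite_subset)
      show "(\<lambda>(e, e'). (e, (dst (e' - e) a, dst e' a))) ` P2 \<subseteq> (SIGMA e:E. cmp B e)"
      proof
        fix q assume "q \<in> (\<lambda>(e, e'). (e, (dst (e' - e) a, dst e' a))) ` P2"
        then obtain e e' where q: "q = (e, (dst (e' - e) a, dst e' a))" "(e, e') \<in> P2" by auto
        then show "q \<in> (SIGMA e:E. cmp B e)"
          using dst_cmp[of "e' - e" e e' a] by (auto simp: P2_def P_def cmp_def)
      qed
      show "card {p \<in> P2. (case p of (e, e') \<Rightarrow> (e, (dst (e' - e) a, dst e' a))) = b} \<le> 2" for b
        by (rule card_le_two[of _ "(fst b, fst b + a + fst (snd b))" "(fst b, fst b + (a - fst (snd b)))"])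
          (auto simp: dst_def P2_def P_def split: prod.splits)
    qed
    finally have "real (card P) \<le> real (card V * n + card V * n + 2 * card (SIGMA e:E. cmp B e))"
      by (simp only: of_nat_le_iff)
    also have "\<dots> = 2 * card V * real n + 2 * (\<Sum>e\<in>E. real (card (cmp B e)))"
      using fin finite_cmp by simp
    also have "\<dots> \<le> 2 * (\<delta> * n + 1) * n + 2 * (n * (\<delta> * n))"
    proof (intro add_mono mult_right_mono mult_left_mono)
      have "(\<Sum>e\<in>E. real (card (cmp B e))) \<le> (\<Sum>e\<in>E. \<delta> * n)"
        by (intro sum_mono) (auto simp: E_def D_def)
      also have "\<dots> = card E * (\<delta> * n)" by simp
      also have "\<dots> \<le> n * (\<delta> * n)" using d0 card_mono[OF _ CE(1)] by (intro mult_right_mono) auto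
      finally show "(\<Sum>e\<in>E. real (card (cmp B e))) \<le> n * (\<delta> * n)" .
    qed (use V in auto)
    finally have P: "real (card P) \<le> 4 * \<delta> * (real n)\<^sup>2 + 2 * n"
      by (simp add: power2_eq_square algebra_simps)
    define t where "t = card E div 3"
    have t: "3 * t \<le> card E" by (simp add: t_def)
    have "t ^ 3 \<le> n * tri B + 3 * n * card P"
      using diff_triples[OF CE(1) B t] by (simp add: P_def)
    then have "real (t ^ 3) \<le> real (n * tri B + 3 * n * card P)" by (simp only: of_nat_le_iff)
    then have "real t ^ 3 \<le> n * real (tri B) + 3 * real n * real (card P)" by simp
    also have "\<dots> \<le> n * (\<delta> * (real n)\<^sup>2) + 3 * real n * (4 * \<delta> * (real n)\<^sup>2 + 2 * n)"
      using tB P by (intro add_mono mult_left_mono) auto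
    also have "\<dots> = 13 * \<delta> * real n ^ 3 + 6 * (real n)\<^sup>2" by (simp add: power2_eq_square power3_eq_cube algebra_simps)
    \<comment> \<open>This dictates \<delta>: \<open>13 * \<delta>\<close> has to stay below
      \<open>(1 / 6000) ^ 3 / 64\<close>. Here 6000 is the bound on \<open>E\<close> that
      \<open>two_classes\<close> requires, and 64 is the cube of the loss from splitting
      \<open>E\<close> into thirds with rounding. The lower-order term is absorbed by
      \<open>n \<ge> 10 ^ 16\<close>.\<close>
    also have "\<dots> < (1 / 6000) ^ 3 / 64 * real n ^ 3"
    proof -
      have "6 < ((1 / 6000) ^ 3 / 64 - 13 * \<delta>) * 10 ^ 16" unfolding d by (simp add: power_divide)
      also have "\<dots> \<le> ((1 / 6000) ^ 3 / 64 - 13 * \<delta>) * n" using n' unfolding d by (intro mult_left_mono) (auto simp: power_divide)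
      finally have "6 * (real n)\<^sup>2 < ((1 / 6000) ^ 3 / 64 - 13 * \<delta>) * n * (real n)\<^sup>2"
        using n by (intro mult_strict_right_mono) auto
      then show ?thesis by (simp add: power2_eq_square power3_eq_cube algebra_simps)
    qed
    also have "\<dots> = (real n / 24000) ^ 3" by (simp add: power_divide)
    also have "\<dots> \<le> real t ^ 3"
    proof (intro power_mono)
      have "card E \<le> 3 * t + 2" unfolding t_def by linarith
      then show "real n / 24000 \<le> real t" using big n' by simp
    qed auto
    finally show False by simp
  qed
  have part: "{1..n} \<subseteq> B \<union> D \<union> E" by (auto simp: C_def E_def)
  have "n \<le> card (B \<union> D \<union> E)" using card_mono[OF _ part] fin by simp
  also have "\<dots> \<le> card B + card D + card E"
    by (intro order_trans[OF card_Un_le] add_mono order_refl)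
  finally have "real n \<le> 3 * card B \<or> real n \<le> 3 * card D" using small by linarith
  then show False
  proof
    assume "real n \<le> 3 * card B"
    from two_classes[OF B CE(3) fin(4) part this _ _ d0(2) tB] show False using small n tD by simp
  next
    assume "real n \<le> 3 * card D"
    from two_classes[OF CE(3) B fin(4) _ this _ _ d0(2) tD] show False using part small n tB by auto
  qed
qed

section \<open>Probability of avoiding triples and trees\<close>

text \<open>The probability of \<open>v \<in> R\<close> given \<open>W \<subseteq> R\<close>. It
  turns the terms \<open>p ^ card (S - W)\<close> of \<open>janson\<close> into products over
  \<open>S\<close>.\<close>

definition wt :: "real \<Rightarrow> nat set \<Rightarrow> nat \<Rightarrow> real" where
  "wt p W v = (if v \<in> W then 1 else p)"

lemma power_card_diff_wt: "finite S \<Longrightarrow> p ^ card (S - W) = (\<Prod>v\<in>S. wt p W v)"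
proof (induction S rule: finite_induct)
  case (insert v S)
  then show ?case by (cases "v \<in> W") (simp_all add: wt_def insert_Diff_if)
qed simp

text \<open>Janson's inequality for triples of distinct elements. At most \<open>9 * n\<close>
  triples meet a given one; those that meet it once have weight \<open>p\<^sup>2\<close>, and at
  most 27 meet it more often and have weight at most 1. This gives 36 = 9 + 27, and 288 = 4 * 36 * 2
  because discarding degenerate pairs at most halves the count.\<close>

lemma prob_no_triple:
  fixes p c :: real
  assumes B: "B \<subseteq> {1..n}" and p: "0 \<le> p" "p \<le> 1" and c: "0 < c" "c * (real n)\<^sup>2 \<le> tri B"
    and n: "2 \<le> c * n"
  shows "probR n p {R. \<not> (\<exists>x y. {x, y, x + y} \<subseteq> B \<inter> R)}
    \<le> exp (- (c * (real n)\<^sup>2 * p ^ 3 / (288 * max 1 (n * p\<^sup>2))))"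
proof -
  define I where "I = {(x, y). x \<in> B \<and> y \<in> B \<and> x + y \<in> B \<and> x \<noteq> y}"
  define S where "S = (\<lambda>(x, y). {x, y, x + y :: nat})"
  define \<Lambda> where "\<Lambda> = 36 * max 1 (n * p\<^sup>2)"
  have finB: "finite B" using B by (auto intro: finite_subset)
  have finI: "finite I" unfolding I_def using finB by (auto intro: finite_subset[of _ "B \<times> B"])
  have B0: "0 < v" if "v \<in> B" for v using that B by auto
  have S3: "card (S i) = 3" if "i \<in> I" for i
    using that B0 by (auto simp: S_def I_def card_insert_if)
  have "tri B \<le> card (I \<union> (\<lambda>x. (x, x)) ` {1..n})"
    unfolding tri_def using finI B by (intro card_mono) (auto simp: I_def)
  also have "\<dots> \<le> card I + n"
    using card_Un_le[of I "(\<lambda>x. (x, x)) ` {1..n}"] card_image_le[of "{1..n}" "\<lambda>x. (x, x)"] by simp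
  finally have "c * (real n)\<^sup>2 \<le> card I + real n" using c by linarith
  moreover have "2 * n \<le> c * (real n)\<^sup>2" using n mult_right_mono[OF n, of "real n"] by (simp add: power2_eq_square)
  ultimately have cI: "c * (real n)\<^sup>2 / 2 \<le> card I" by simp
  have "probR n p {R. \<forall>i\<in>I. \<not> S i \<subseteq> R} \<le> exp (- (\<Sum>i\<in>I. p ^ card (S i)) / (4 * \<Lambda>))"
  proof (rule janson[OF finI _ p])
    show "S i \<subseteq> {1..n}" if "i \<in> I" for i using that B by (auto simp: S_def I_def)
    show "1 \<le> \<Lambda>" by (simp add: \<Lambda>_def)
    fix i assume i: "i \<in> I"
    define W where "W = S i"
    have finW: "finite W" by (auto simp: W_def S_def split: prod.splits)
    have cW: "card W = 3" using S3[OF i] by (simp add: W_def)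
    define J where "J = {j \<in> I. S j \<inter> W \<noteq> {}}"
    define J2 where "J2 = {j \<in> J. card (S j \<inter> W) \<ge> 2}"
    have finJ: "finite J" using finI by (simp add: J_def)
    have "J \<subseteq> (\<lambda>(w, y). (w, y)) ` (W \<times> {1..n}) \<union>
        ((\<lambda>(w, y). (y, w)) ` (W \<times> {1..n}) \<union> (\<lambda>(w, y). (w - y, y)) ` (W \<times> {1..n}))"
    proof
      fix j assume "j \<in> J"
      then obtain x y where j: "j = (x, y)" "x \<in> B" "y \<in> B" "x \<in> W \<or> y \<in> W \<or> x + y \<in> W"
        by (auto simp: J_def I_def S_def)
      then have "x \<in> {1..n}" "y \<in> {1..n}" using B by auto
      note j = j(1) this j(4)
      then consider "x \<in> W" | "y \<in> W" | "x + y \<in> W" by blast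
      then show "j \<in> (\<lambda>(w, y). (w, y)) ` (W \<times> {1..n}) \<union>
        ((\<lambda>(w, y). (y, w)) ` (W \<times> {1..n}) \<union> (\<lambda>(w, y). (w - y, y)) ` (W \<times> {1..n}))"
      proof cases
        case 3
        then have "j \<in> (\<lambda>(w, y). (w - y, y)) ` (W \<times> {1..n})"
          using j by (intro image_eqI[of _ _ "(x + y, y)"]) auto
        then show ?thesis by blast
      qed (use j in auto)
    qed
    then have "card J \<le> card ((\<lambda>(w, y). (w, y)) ` (W \<times> {1..n}) \<union>
        ((\<lambda>(w, y). (y, w)) ` (W \<times> {1..n}) \<union> (\<lambda>(w, y). (w - y, y)) ` (W \<times> {1..n})))"
      using finW by (intro card_mono) auto
    also have "\<dots> \<le> card (W \<times> {1..n}) + (card (W \<times> {1..n}) + card (W \<times> {1..n}))"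
      using finW by (intro order_trans[OF card_Un_le] add_mono card_image_le) auto
    finally have cJ: "card J \<le> 9 * n" using cW by (simp add: card_cartesian_product)
    have "J2 \<subseteq> (\<lambda>(w, y). (w, y)) ` (W \<times> W) \<union>
        ((\<lambda>(w, y). (w, y - w)) ` (W \<times> W) \<union> (\<lambda>(w, y). (y - w, w)) ` (W \<times> W))"
    proof
      fix j assume j2: "j \<in> J2"
      then obtain x y where j: "j = (x, y)" by (cases j)
      have "\<not> card (S j \<inter> W) \<le> 1" using j2 by (simp add: J2_def)
      then have "\<not> S j \<inter> W \<subseteq> {z}" for z using card_mono[of "{z}" "S j \<inter> W"] by auto
      from this[of x] this[of y] this[of "x + y"]
      have "x \<in> W \<and> y \<in> W \<or> x \<in> W \<and> x + y \<in> W \<or> y \<in> W \<and> x + y \<in> W"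
        unfolding S_def j by blast
      then consider "x \<in> W" "y \<in> W" | "x \<in> W" "x + y \<in> W" | "y \<in> W" "x + y \<in> W" by blast
      then show "j \<in> (\<lambda>(w, y). (w, y)) ` (W \<times> W) \<union>
        ((\<lambda>(w, y). (w, y - w)) ` (W \<times> W) \<union> (\<lambda>(w, y). (y - w, w)) ` (W \<times> W))"
      proof cases
        case 2
        then have "j \<in> (\<lambda>(w, y). (w, y - w)) ` (W \<times> W)"
          using j by (intro image_eqI[of _ _ "(x, x + y)"]) auto
        then show ?thesis by blast
      next
        case 3
        then have "j \<in> (\<lambda>(w, y). (y - w, w)) ` (W \<times> W)"
          using j by (intro image_eqI[of _ _ "(y, x + y)"]) auto
        then show ?thesis by blast
      qed (use j in auto)
    qed
    then have "card J2 \<le> card ((\<lambda>(w, y). (w, y)) ` (W \<times> W) \<union>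
        ((\<lambda>(w, y). (w, y - w)) ` (W \<times> W) \<union> (\<lambda>(w, y). (y - w, w)) ` (W \<times> W)))"
      using finW by (intro card_mono) auto
    also have "\<dots> \<le> card (W \<times> W) + (card (W \<times> W) + card (W \<times> W))"
      using finW by (intro order_trans[OF card_Un_le] add_mono card_image_le) auto
    finally have cJ2: "card J2 \<le> 27" using cW by (simp add: card_cartesian_product)
    have "(\<Sum>j | j \<in> I \<and> S j \<inter> W \<noteq> {}. p ^ card (S j - W)) = (\<Sum>j\<in>J. p ^ card (S j - W))"
      by (simp add: J_def)
    also have "\<dots> \<le> (\<Sum>j\<in>J. p\<^sup>2 + of_bool (j \<in> J2))"
    proof (rule sum_mono)
      fix j assume j: "j \<in> J"
      show "p ^ card (S j - W) \<le> p\<^sup>2 + of_bool (j \<in> J2)"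
      proof (cases "j \<in> J2")
        case True
        have "p ^ card (S j - W) \<le> 1" using p by (simp add: power_le_one)
        then show ?thesis using True p by (simp add: add_increasing)
      next
        case False
        have "finite (S j)" using j by (auto simp: S_def split: prod.splits)
        then have "card (S j) = card (S j - W) + card (S j \<inter> W)"
          by (metis card_Diff_subset_Int card_mono Int_lower1 finite_Int le_add_diff_inverse2)
        then have "2 \<le> card (S j - W)" using False j S3[of j] by (auto simp: J2_def J_def)
        then show ?thesis using False p by (simp add: power_decreasing)
      qed
    qed
    also have "\<dots> = card J * p\<^sup>2 + card (J \<inter> J2)" using finJ by (simp add: sum.distrib Int_def)
    also have "J \<inter> J2 = J2" by (auto simp: J2_def)
    also have "card J * p\<^sup>2 + card J2 \<le> (9 * real n) * p\<^sup>2 + 27"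
      using cJ cJ2 by (intro add_mono mult_right_mono) (auto simp: of_nat_le_iff[symmetric] simp del: of_nat_le_iff)
    also have "\<dots> \<le> \<Lambda>" unfolding \<Lambda>_def by simp
    finally show "(\<Sum>j | j \<in> I \<and> S j \<inter> S i \<noteq> {}. p ^ card (S j - S i)) \<le> \<Lambda>" by (simp add: W_def)
  qed
  also have "(\<Sum>i\<in>I. p ^ card (S i)) = card I * p ^ 3" using S3 by simp
  also have "exp (- (card I * p ^ 3) / (4 * \<Lambda>)) \<le> exp (- (c * (real n)\<^sup>2 / 2 * p ^ 3) / (4 * \<Lambda>))"
  proof -
    have "c * (real n)\<^sup>2 / 2 * p ^ 3 / (4 * \<Lambda>) \<le> card I * p ^ 3 / (4 * \<Lambda>)"
      using p by (intro divide_right_mono mult_right_mono cI) (auto simp: \<Lambda>_def)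
    then show ?thesis by simp
  qed
  also have "- (c * (real n)\<^sup>2 / 2 * p ^ 3) / (4 * \<Lambda>) = - (c * (real n)\<^sup>2 * p ^ 3 / (288 * max 1 (n * p\<^sup>2)))"
    by (simp add: \<Lambda>_def)
  finally have "probR n p {R. \<forall>i\<in>I. \<not> S i \<subseteq> R} \<le> exp (- (c * (real n)\<^sup>2 * p ^ 3 / (288 * max 1 (n * p\<^sup>2))))" .
  moreover have "probR n p {R. \<not> (\<exists>x y. {x, y, x + y} \<subseteq> B \<inter> R)} \<le> probR n p {R. \<forall>i\<in>I. \<not> S i \<subseteq> R}"
    by (intro measure_pmf.finite_measure_mono) (auto simp: I_def S_def)
  ultimately show ?thesis by linarith
qed

text \<open>Each factor is split into a peak on the small set \<open>H\<close> and a background, and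
  the product is expanded. Requiring one of \<open>x\<close>, \<open>y\<close>, \<open>x + y\<close>
  to lie in \<open>H\<close> leaves at most \<open>n * h\<close> pairs, requiring two leaves
  \<open>h\<^sup>2\<close>, and requiring all three saves nothing more because two of them determine
  the third.\<close>

lemma sum_three_factors:
  fixes f1 f2 f3 :: "nat \<Rightarrow> real" and \<beta> \<epsilon>1 \<epsilon>2 \<epsilon>3 :: real
  assumes H: "finite H" "real (card H) \<le> h"
    and nn: "\<And>v. 0 \<le> f1 v" "\<And>v. 0 \<le> f2 v" "\<And>v. 0 \<le> f3 v" and b: "0 \<le> \<beta>" "0 \<le> \<epsilon>1" "0 \<le> \<epsilon>2" "0 \<le> \<epsilon>3"
    and f: "\<And>v. f1 v \<le> \<beta> * of_bool (v \<in> H) + \<epsilon>1" "\<And>v. f2 v \<le> \<beta> * of_bool (v \<in> H) + \<epsilon>2"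
      "\<And>v. f3 v \<le> \<beta> * of_bool (v \<in> H) + \<epsilon>3"
  shows "(\<Sum>(x, y)\<in>{1..n} \<times> {1..n}. f1 x * f2 y * f3 (x + y))
    \<le> (real n)\<^sup>2 * (\<epsilon>1 * \<epsilon>2 * \<epsilon>3) + n * h * \<beta> * (\<epsilon>2 * \<epsilon>3 + \<epsilon>1 * \<epsilon>3 + \<epsilon>1 * \<epsilon>2)
      + h\<^sup>2 * \<beta>\<^sup>2 * (\<epsilon>1 + \<epsilon>2 + \<epsilon>3) + h\<^sup>2 * \<beta> ^ 3"
proof -
  let ?N = "{1..n} \<times> {1..n}"
  define a1 where "a1 = (\<lambda>e :: nat \<times> nat. of_bool (fst e \<in> H) :: real)"
  define a2 where "a2 = (\<lambda>e :: nat \<times> nat. of_bool (snd e \<in> H) :: real)"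
  define a3 where "a3 = (\<lambda>e :: nat \<times> nat. of_bool (fst e + snd e \<in> H) :: real)"
  note a = a1_def a2_def a3_def
  have h0: "0 \<le> h" using H by linarith
  have cnt: "(\<Sum>e\<in>?N. of_bool (P e)) \<le> r" if "?N \<inter> {e. P e} \<subseteq> g ` X" "finite X" "real (card X) \<le> r"
    for P and r :: real and g :: "'x \<Rightarrow> nat \<times> nat" and X
  proof -
    have "(\<Sum>e\<in>?N. of_bool (P e)) = real (card (?N \<inter> {e. P e}))" by simp
    also have "card (?N \<inter> {e. P e}) \<le> card X" using that by (intro surj_card_le) auto
    finally show ?thesis using that(3) by simp
  qed
  have HN: "real (card (H \<times> {1..n})) \<le> n * h" "real (card (H \<times> H)) \<le> h\<^sup>2"
    using h0 mult_mono[OF H(2) H(2)] mult_left_mono[OF H(2), of "real n"]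
    by (simp_all add: card_cartesian_product power2_eq_square mult.commute)
  have s1: "(\<Sum>e\<in>?N. a1 e) \<le> n * h" unfolding a
    by (rule cnt[of _ "\<lambda>(w, y). (w, y)" "H \<times> {1..n}"]) (use H HN in auto)
  have s2: "(\<Sum>e\<in>?N. a2 e) \<le> n * h" unfolding a
    by (rule cnt[of _ "\<lambda>(w, y). (y, w)" "H \<times> {1..n}"]) (use H HN in auto)
  have s3: "(\<Sum>e\<in>?N. a3 e) \<le> n * h" unfolding a
  proof (rule cnt[of _ "\<lambda>(w, y). (w - y, y)" "H \<times> {1..n}"])
    show "?N \<inter> {e. fst e + snd e \<in> H} \<subseteq> (\<lambda>(w, y). (w - y, y)) ` (H \<times> {1..n})"
    proof
      fix e assume "e \<in> ?N \<inter> {e. fst e + snd e \<in> H}"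
      then show "e \<in> (\<lambda>(w, y). (w - y, y)) ` (H \<times> {1..n})"
        by (intro image_eqI[of _ _ "(fst e + snd e, snd e)"]) auto
    qed
  qed (use H HN in auto)
  have s12: "(\<Sum>e\<in>?N. a1 e * a2 e) \<le> h\<^sup>2" unfolding a of_bool_conj[symmetric]
    by (rule cnt[of _ "\<lambda>(w, y). (w, y)" "H \<times> H"]) (use H HN in auto)
  have s13: "(\<Sum>e\<in>?N. a1 e * a3 e) \<le> h\<^sup>2" unfolding a of_bool_conj[symmetric]
  proof (rule cnt[of _ "\<lambda>(w, y). (w, y - w)" "H \<times> H"])
    show "?N \<inter> {e. fst e \<in> H \<and> fst e + snd e \<in> H} \<subseteq> (\<lambda>(w, y). (w, y - w)) ` (H \<times> H)"
    proof
      fix e assume "e \<in> ?N \<inter> {e. fst e \<in> H \<and> fst e + snd e \<in> H}"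
      then show "e \<in> (\<lambda>(w, y). (w, y - w)) ` (H \<times> H)"
        by (intro image_eqI[of _ _ "(fst e, fst e + snd e)"]) auto
    qed
  qed (use H HN in auto)
  have s23: "(\<Sum>e\<in>?N. a2 e * a3 e) \<le> h\<^sup>2" unfolding a of_bool_conj[symmetric]
  proof (rule cnt[of _ "\<lambda>(w, y). (y - w, w)" "H \<times> H"])
    show "?N \<inter> {e. snd e \<in> H \<and> fst e + snd e \<in> H} \<subseteq> (\<lambda>(w, y). (y - w, w)) ` (H \<times> H)"
    proof
      fix e assume "e \<in> ?N \<inter> {e. snd e \<in> H \<and> fst e + snd e \<in> H}"
      then show "e \<in> (\<lambda>(w, y). (y - w, w)) ` (H \<times> H)"
        by (intro image_eqI[of _ _ "(snd e, fst e + snd e)"]) auto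
    qed
  qed (use H HN in auto)
  have s123: "(\<Sum>e\<in>?N. a1 e * a2 e * a3 e) \<le> h\<^sup>2"
    by (rule order_trans[OF sum_mono s12]) (auto simp: a)
  have "(\<Sum>(x, y)\<in>?N. f1 x * f2 y * f3 (x + y))
     \<le> (\<Sum>e\<in>?N. (\<beta> * a1 e + \<epsilon>1) * (\<beta> * a2 e + \<epsilon>2) * (\<beta> * a3 e + \<epsilon>3))"
    unfolding split_beta
  proof (intro sum_mono mult_mono)
    fix e
    show "f1 (fst e) \<le> \<beta> * a1 e + \<epsilon>1" "f2 (snd e) \<le> \<beta> * a2 e + \<epsilon>2" "f3 (fst e + snd e) \<le> \<beta> * a3 e + \<epsilon>3"
      unfolding a by (rule f)+
  qed (use nn b in \<open>auto simp: a\<close>)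
  also have "\<dots> = (\<Sum>e\<in>?N. \<epsilon>1 * \<epsilon>2 * \<epsilon>3 + \<beta> * \<epsilon>2 * \<epsilon>3 * a1 e + \<beta> * \<epsilon>1 * \<epsilon>3 * a2 e + \<beta> * \<epsilon>1 * \<epsilon>2 * a3 e
      + \<beta>\<^sup>2 * \<epsilon>3 * (a1 e * a2 e) + \<beta>\<^sup>2 * \<epsilon>2 * (a1 e * a3 e) + \<beta>\<^sup>2 * \<epsilon>1 * (a2 e * a3 e) + \<beta> ^ 3 * (a1 e * a2 e * a3 e))"
    by (intro sum.cong refl) (simp add: algebra_simps power2_eq_square power3_eq_cube)
  also have "\<dots> = (real n)\<^sup>2 * (\<epsilon>1 * \<epsilon>2 * \<epsilon>3) + \<beta> * \<epsilon>2 * \<epsilon>3 * (\<Sum>e\<in>?N. a1 e) + \<beta> * \<epsilon>1 * \<epsilon>3 * (\<Sum>e\<in>?N. a2 e)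
      + \<beta> * \<epsilon>1 * \<epsilon>2 * (\<Sum>e\<in>?N. a3 e) + \<beta>\<^sup>2 * \<epsilon>3 * (\<Sum>e\<in>?N. a1 e * a2 e)
      + \<beta>\<^sup>2 * \<epsilon>2 * (\<Sum>e\<in>?N. a1 e * a3 e) + \<beta>\<^sup>2 * \<epsilon>1 * (\<Sum>e\<in>?N. a2 e * a3 e)
      + \<beta> ^ 3 * (\<Sum>e\<in>?N. a1 e * a2 e * a3 e)"
    unfolding sum.distrib sum_distrib_left[symmetric] by (simp add: card_cartesian_product power2_eq_square)
  also have "\<dots> \<le> (real n)\<^sup>2 * (\<epsilon>1 * \<epsilon>2 * \<epsilon>3) + \<beta> * \<epsilon>2 * \<epsilon>3 * (n * h) + \<beta> * \<epsilon>1 * \<epsilon>3 * (n * h)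
      + \<beta> * \<epsilon>1 * \<epsilon>2 * (n * h) + \<beta>\<^sup>2 * \<epsilon>3 * h\<^sup>2 + \<beta>\<^sup>2 * \<epsilon>2 * h\<^sup>2 + \<beta>\<^sup>2 * \<epsilon>1 * h\<^sup>2 + \<beta> ^ 3 * h\<^sup>2"
    using b by (intro add_mono mult_left_mono s1 s2 s3 s12 s13 s23 s123 order_refl) auto
  also have "\<dots> = (real n)\<^sup>2 * (\<epsilon>1 * \<epsilon>2 * \<epsilon>3) + n * h * \<beta> * (\<epsilon>2 * \<epsilon>3 + \<epsilon>1 * \<epsilon>3 + \<epsilon>1 * \<epsilon>2)
      + h\<^sup>2 * \<beta>\<^sup>2 * (\<epsilon>1 + \<epsilon>2 + \<epsilon>3) + h\<^sup>2 * \<beta> ^ 3"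
    by (simp add: algebra_simps)
  finally show ?thesis .
qed

section \<open>Conditional weights of completing pairs\<close>

abbreviation psi :: "real \<Rightarrow> nat set \<Rightarrow> nat \<times> nat \<Rightarrow> real" where
  "psi p W q \<equiv> wt p W (fst q) * wt p W (snd q)"

abbreviation pair_set :: "'a \<times> 'a \<Rightarrow> 'a set" where
  "pair_set q \<equiv> {fst q, snd q}"

lemma card_cmp_le: "card (cmp {1..n} v) \<le> 3 * n"
proof -
  have "cmp {1..n} v \<subseteq> (\<lambda>b. (b, v - b)) ` {1..n} \<union> ((\<lambda>b. (b, v + b)) ` {1..n} \<union> (\<lambda>b. (v + b, b)) ` {1..n})"
    by (auto simp: cmp_def)
  then have "card (cmp {1..n} v)
      \<le> card ((\<lambda>b. (b, v - b)) ` {1..n} \<union> ((\<lambda>b. (b, v + b)) ` {1..n} \<union> (\<lambda>b. (v + b, b)) ` {1..n}))"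
    by (intro card_mono) auto
  also have "\<dots> \<le> card {1..n} + (card {1..n} + card {1..n})"
    by (intro order_trans[OF card_Un_le] add_mono card_image_le) auto
  finally show ?thesis by simp
qed

lemma card_le_three: "X \<subseteq> {a, b, c} \<Longrightarrow> card X \<le> 3"
  using card_mono[of "{a, b, c}" X] card_insert_le_m1[of 3 "{b, c}" a] card_le_two[of "{b, c}" b c, OF order_refl] by simp

lemma card_cmp_fst_le:
  assumes "finite B" "finite W"
  shows "card {q \<in> cmp B v. fst q \<in> W} \<le> 3 * card W"
proof (rule card_fibres_le[where f = fst])
  show "card {x \<in> {q \<in> cmp B v. fst q \<in> W}. fst x = b} \<le> 3" for b
    by (rule card_le_three[of _ "(b, v - b)" "(b, v + b)" "(b, b - v)"]) (auto simp: cmp_def)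
qed (use assms finite_cmp in auto)

lemma card_cmp_snd_le:
  assumes "finite B" "finite W"
  shows "card {q \<in> cmp B v. snd q \<in> W} \<le> 3 * card W"
proof (rule card_fibres_le[where f = snd])
  show "card {x \<in> {q \<in> cmp B v. snd q \<in> W}. snd x = b} \<le> 3" for b
    by (rule card_le_three[of _ "(v - b, b)" "(v + b, b)" "(b - v, b)"]) (auto simp: cmp_def)
qed (use assms finite_cmp in auto)

text \<open>Contains every \<open>v\<close> that is completed by a pair inside \<open>W\<close>;
  truncation of the differences adds nothing but 0.\<close>

definition sdiffs :: "nat set \<Rightarrow> nat set" where
  "sdiffs W = (\<lambda>(b, c). b + c) ` (W \<times> W) \<union> (\<lambda>(b, c). b - c) ` (W \<times> W)"

lemma finite_sdiffs: "finite W \<Longrightarrow> finite (sdiffs W)"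
  by (simp add: sdiffs_def)

lemma card_sdiffs_le: "finite W \<Longrightarrow> card (sdiffs W) \<le> 2 * card W * card W"
  unfolding sdiffs_def
  using card_Un_le[of "(\<lambda>(b, c). b + c) ` (W \<times> W)" "(\<lambda>(b, c). b - c) ` (W \<times> W)"]
    card_image_le[of "W \<times> W" "\<lambda>(b, c). b + c"] card_image_le[of "W \<times> W" "\<lambda>(b, c). b - c"]
  by (simp add: card_cartesian_product)

lemma cmp_both_sdiffs:
  assumes "q \<in> cmp B v" "fst q \<in> W" "snd q \<in> W"
  shows "v \<in> sdiffs W"
proof -
  obtain b c where q: "q = (b, c)" by (cases q)
  consider "v = b + c" | "v = c - b" | "v = b - c"
    using assms(1) by (auto simp: cmp_def q)
  then show ?thesis
  proof cases
    case 1
    then show ?thesis unfolding sdiffs_def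
      by (intro UnI1 image_eqI[of _ _ "(b, c)"]) (use assms q in auto)
  next
    case 2
    then show ?thesis unfolding sdiffs_def
      by (intro UnI2 image_eqI[of _ _ "(c, b)"]) (use assms q in auto)
  next
    case 3
    then show ?thesis unfolding sdiffs_def
      by (intro UnI2 image_eqI[of _ _ "(b, c)"]) (use assms q in auto)
  qed
qed

text \<open>The pairs are sorted by the number of entries in \<open>W\<close>: at most
  \<open>3 * n\<close> of weight \<open>p\<^sup>2\<close>, at most 27 + 27 of weight
  \<open>p\<close>, and at most 27 of weight 1, which occur only for \<open>v\<close> in
  \<open>sdiffs W\<close>. One entry leaves three possible partners, hence 27 = 3 * 9.\<close>

lemma sum_psi_le:
  assumes W: "finite W" "card W \<le> 9" and p: "0 \<le> p" "p \<le> 1"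
  shows "(\<Sum>q\<in>cmp {1..n} v. psi p W q) \<le> 3 * n * p\<^sup>2 + 54 * p + 27 * of_bool (v \<in> sdiffs W)" (is ?A)
    and "(\<Sum>q\<in>cmp {1..n} v. psi p W q * of_bool (fst q \<in> W \<or> snd q \<in> W))
      \<le> 54 * p + 27 * of_bool (v \<in> sdiffs W)" (is ?B)
proof -
  let ?K = "cmp {1..n} v"
  have finK: "finite ?K" by (rule finite_cmp) simp
  have c1: "(\<Sum>q\<in>?K. of_bool (fst q \<in> W)) \<le> (27 :: real)"
    using card_cmp_fst_le[of "{1..n}" W v] W finK by (simp add: Int_def)
  have c2: "(\<Sum>q\<in>?K. of_bool (snd q \<in> W)) \<le> (27 :: real)"
    using card_cmp_snd_le[of "{1..n}" W v] W finK by (simp add: Int_def)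
  have c3: "(\<Sum>q\<in>?K. of_bool (fst q \<in> W \<and> snd q \<in> W)) \<le> 27 * (of_bool (v \<in> sdiffs W) :: real)"
  proof (cases "v \<in> sdiffs W")
    case True
    have "(\<Sum>q\<in>?K. of_bool (fst q \<in> W \<and> snd q \<in> W)) \<le> (\<Sum>q\<in>?K. of_bool (fst q \<in> W) :: real)"
      by (intro sum_mono) auto
    then show ?thesis using c1 True by simp
  next
    case False
    then have "(\<Sum>q\<in>?K. of_bool (fst q \<in> W \<and> snd q \<in> W)) = (\<Sum>q\<in>?K. 0 :: real)"
      using cmp_both_sdiffs[of _ "{1..n}" v W] by (intro sum.cong) auto
    then show ?thesis using False by simp
  qed
  have "(\<Sum>q\<in>?K. psi p W q * of_bool (fst q \<in> W \<or> snd q \<in> W))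
      \<le> (\<Sum>q\<in>?K. p * of_bool (fst q \<in> W) + p * of_bool (snd q \<in> W) + of_bool (fst q \<in> W \<and> snd q \<in> W))"
    using p by (intro sum_mono) (auto simp: wt_def)
  also have "\<dots> \<le> p * 27 + p * 27 + 27 * of_bool (v \<in> sdiffs W)"
    unfolding sum.distrib sum_distrib_left[symmetric]
    using p by (intro add_mono mult_left_mono c1 c2 c3) auto
  finally show ?B by simp
  have "(\<Sum>q\<in>?K. psi p W q) \<le> (\<Sum>q\<in>?K. p\<^sup>2 + psi p W q * of_bool (fst q \<in> W \<or> snd q \<in> W))"
    using p by (intro sum_mono) (auto simp: wt_def power2_eq_square)
  also have "\<dots> = card ?K * p\<^sup>2 + (\<Sum>q\<in>?K. psi p W q * of_bool (fst q \<in> W \<or> snd q \<in> W))"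
    by (simp add: sum.distrib)
  also have "\<dots> \<le> (3 * real n) * p\<^sup>2 + (54 * p + 27 * of_bool (v \<in> sdiffs W))"
  proof (intro add_mono mult_right_mono \<open>?B\<close>)
    have "real (card ?K) \<le> real (3 * n)" using card_cmp_le[of n v] by (simp only: of_nat_le_iff)
    then show "real (card ?K) \<le> 3 * real n" by simp
  qed auto
  finally show ?A by simp
qed

text \<open>
  When \<open>B\<close> is monochromatic, the pairs of a tree force its root triple to be monochromatic in the
  other colour.
\<close>

definition free_cmp :: "nat set \<Rightarrow> nat \<Rightarrow> nat set \<Rightarrow> (nat \<times> nat) set" where
  "free_cmp B v F = {q \<in> cmp B v. fst q \<noteq> snd q \<and> fst q \<notin> F \<and> snd q \<notin> F}"

type_synonym tree = "(nat \<times> nat) \<times> (nat \<times> nat) \<times> (nat \<times> nat) \<times> (nat \<times> nat)"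

text \<open>The pairs are chosen one after the other, each avoiding the previous ones. When
  \<open>B\<close> and \<open>D\<close> are disjoint sets of positive numbers, every tree therefore
  has exactly nine elements, while each choice still loses only boundedly many options.\<close>

definition trees :: "nat set \<Rightarrow> nat set \<Rightarrow> tree set" where
  "trees B D = (SIGMA e : {(x, y). x \<in> D \<and> y \<in> D \<and> x + y \<in> D \<and> x \<noteq> y}.
     SIGMA q1 : free_cmp B (fst e) {}. SIGMA q2 : free_cmp B (snd e) (pair_set q1).
       free_cmp B (fst e + snd e) (pair_set q1 \<union> pair_set q2))"

definition tree_set :: "tree \<Rightarrow> nat set" where
  "tree_set = (\<lambda>((x, y), q1, q2, q3). {x, y, x + y} \<union> pair_set q1 \<union> pair_set q2 \<union> pair_set q3)"

lemma treesD:
  assumes "((x, y), q1, q2, q3) \<in> trees B D"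
  shows "x \<in> D" "y \<in> D" "x + y \<in> D" "x \<noteq> y" "q1 \<in> cmp B x" "q2 \<in> cmp B y" "q3 \<in> cmp B (x + y)"
    "distinct [fst q1, snd q1, fst q2, snd q2, fst q3, snd q3]"
  using assms by (auto simp: trees_def free_cmp_def)

lemma cmpD: "q \<in> cmp B v \<Longrightarrow> fst q \<in> B \<and> snd q \<in> B"
  by (auto simp: cmp_def)

lemma tree_set_subset:
  assumes "j \<in> trees B D"
  shows "tree_set j \<subseteq> D \<union> B"
proof -
  obtain x y q1 q2 q3 where j: "j = ((x, y), q1, q2, q3)" by (metis surj_pair)
  show ?thesis
    using treesD(1-3)[OF assms[unfolded j]] treesD(5-7)[OF assms[unfolded j], THEN cmpD]
    by (simp add: tree_set_def j)
qed

lemma card_free_cmp_ge: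
  assumes B: "finite B" "0 \<notin> B" and v: "v > 0" and F: "finite F" "card F \<le> 4"
  shows "card (cmp B v) \<le> card (free_cmp B v F) + 25"
proof -
  have finK: "finite (cmp B v)" by (rule finite_cmp[OF B(1)])
  \<comment> \<open>Lost are at most 12 pairs for each of the two positions that can meet
    \<open>F\<close>, and the pair with equal entries, which must be
    \<open>(v div 2, v div 2)\<close> as \<open>v\<close> is positive: 25 in all.\<close>
  have "cmp B v \<subseteq> free_cmp B v F \<union> ({q \<in> cmp B v. fst q \<in> F} \<union> ({q \<in> cmp B v. snd q \<in> F} \<union> {(v div 2, v div 2)}))"
    using v by (auto simp: free_cmp_def cmp_def)
  then have "card (cmp B v)
      \<le> card (free_cmp B v F \<union> ({q \<in> cmp B v. fst q \<in> F} \<union> ({q \<in> cmp B v. snd q \<in> F} \<union> {(v div 2, v div 2)})))"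
    using finK by (intro card_mono) (auto simp: free_cmp_def)
  also have "\<dots> \<le> card (free_cmp B v F) + (3 * card F + (3 * card F + 1))"
    by (intro order_trans[OF card_Un_le] add_mono card_cmp_fst_le card_cmp_snd_le F B) auto
  finally show ?thesis using F(2) by linarith
qed

lemma card_trees_ge:
  fixes \<delta> :: real
  assumes B: "B \<subseteq> {1..n}" and D: "D \<subseteq> {1..n}" and d: "0 < \<delta>" and n: "50 \<le> \<delta> * n"
    and tD: "\<delta> * (real n)\<^sup>2 \<le> tri D" and cD: "\<And>v. v \<in> D \<Longrightarrow> \<delta> * n \<le> card (cmp B v)"
  shows "finite (trees B D)" "\<delta> ^ 4 * real n ^ 5 / 16 \<le> card (trees B D)"
proof -
  let ?I = "{(x, y). x \<in> D \<and> y \<in> D \<and> x + y \<in> D \<and> x \<noteq> y}"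
  have fin: "finite B" "finite D" using B D by (auto intro: finite_subset)
  have finI: "finite ?I" using fin by (auto intro: finite_subset[of _ "D \<times> D"])
  have finf: "finite (free_cmp B v F)" for v F using finite_cmp[OF fin(1)] by (simp add: free_cmp_def)
  show "finite (trees B D)" unfolding trees_def by (intro finite_SigmaI finI finf)
  have fc: "\<delta> * n / 2 \<le> card (free_cmp B v F)" if "v \<in> D" "finite F" "card F \<le> 4" for v F
  proof -
    have "v > 0" "0 \<notin> B" using that(1) D B by auto
    from card_free_cmp_ge[OF fin(1) this(2,1) that(2,3)] cD[OF that(1)] n show ?thesis by linarith
  qed
  have "tri D \<le> card (?I \<union> (\<lambda>x. (x, x)) ` {1..n})"
    unfolding tri_def using finI D by (intro card_mono) auto
  also have "\<dots> \<le> card ?I + n"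
    using card_Un_le[of ?I "(\<lambda>x. (x, x)) ` {1..n}"] card_image_le[of "{1..n}" "\<lambda>x. (x, x)"] by simp
  finally have "\<delta> * (real n)\<^sup>2 \<le> card ?I + real n" using tD by linarith
  moreover have "2 * n \<le> \<delta> * (real n)\<^sup>2" using n mult_right_mono[OF n, of "real n"] by (simp add: power2_eq_square)
  ultimately have cI: "\<delta> * (real n)\<^sup>2 / 2 \<le> card ?I" by simp
  define r where "r = \<delta> * n / 2"
  have r: "0 \<le> r" using d by (simp add: r_def)
  have S: "k * l \<le> real (card (SIGMA x : X. Y x))"
    if "finite X" "\<And>x. x \<in> X \<Longrightarrow> finite (Y x)" "k \<le> card X" "\<And>x. x \<in> X \<Longrightarrow> l \<le> card (Y x)" "0 \<le> l"
    for X :: "'x set" and Y :: "'x \<Rightarrow> 'y set" and k l :: real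
  proof -
    have "k * l \<le> card X * l" using that by (intro mult_right_mono) auto
    also have "\<dots> = (\<Sum>x\<in>X. l)" by simp
    also have "\<dots> \<le> (\<Sum>x\<in>X. real (card (Y x)))" using that by (intro sum_mono) auto
    finally show ?thesis using that by simp
  qed
  have c4: "card (pair_set q1 \<union> pair_set q2) \<le> 4" for q1 q2 :: "nat \<times> nat"
    using card_Un_le[of "pair_set q1" "pair_set q2"] card_le_two[of "pair_set q1", OF order_refl]
      card_le_two[of "pair_set q2", OF order_refl] by linarith
  have c2: "card (pair_set q1) \<le> 4" for q1 :: "nat \<times> nat"
    using card_le_two[of "{fst q1, snd q1}" "fst q1" "snd q1"] by simp
  have "\<delta> * (real n)\<^sup>2 / 2 * (r * (r * r)) \<le> card (trees B D)"
    unfolding trees_def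
    by (intro S finI finite_SigmaI finf cI fc[folded r_def] c2 c4 mult_nonneg_nonneg r) auto
  then show "\<delta> ^ 4 * real n ^ 5 / 16 \<le> card (trees B D)"
    by (simp add: r_def power2_eq_square eval_nat_numeral mult_ac)
qed

lemma tree_weight:
  assumes B: "B \<subseteq> {1..n}" and D: "D \<subseteq> {1..n}" "D \<inter> B = {}"
    and t: "((x, y), q1, q2, q3) \<in> trees B D"
  shows "card (tree_set ((x, y), q1, q2, q3)) = 9"
    and "p ^ card (tree_set ((x, y), q1, q2, q3) - W)
      = wt p W x * wt p W y * wt p W (x + y) * (psi p W q1 * psi p W q2 * psi p W q3)"
proof -
  have xy: "x \<in> D" "y \<in> D" "x + y \<in> D" "x \<noteq> y" "0 < x" "0 < y"
    using treesD[OF t] D by auto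
  have q: "fst q1 \<in> B" "snd q1 \<in> B" "fst q2 \<in> B" "snd q2 \<in> B" "fst q3 \<in> B" "snd q3 \<in> B"
    "distinct [fst q1, snd q1, fst q2, snd q2, fst q3, snd q3]"
    using treesD(5-8)[OF t] by (auto dest: cmpD)
  have ne: "a \<noteq> b" if "a \<in> D" "b \<in> B" for a b using that D by auto
  define l where "l = [x, y, x + y, fst q1, snd q1, fst q2, snd q2, fst q3, snd q3]"
  have dl: "distinct l"
    using xy q ne[OF xy(1)] ne[OF xy(2)] ne[OF xy(3)] unfolding l_def by auto
  have sl: "tree_set ((x, y), q1, q2, q3) = set l" by (auto simp: tree_set_def l_def)
  show "card (tree_set ((x, y), q1, q2, q3)) = 9"
    unfolding sl distinct_card[OF dl] by (simp add: l_def)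
  show "p ^ card (tree_set ((x, y), q1, q2, q3) - W)
      = wt p W x * wt p W y * wt p W (x + y) * (psi p W q1 * psi p W q2 * psi p W q3)"
    unfolding sl by (subst power_card_diff_wt, simp, subst prod.distinct_set_conv_list[OF dl]) (simp add: l_def mult_ac)
qed

text \<open>An enumeration of the ways in which two trees intersect is avoided. For fixed
  \<open>x\<close> and \<open>y\<close> the sum over trees factorises into three branches, each a
  root element with its pair. A tree that meets \<open>W\<close> has a branch that does, so it
  suffices to bound sums with two factors \<open>f\<close>, the weight of all branches at a root
  element, and one factor \<open>g\<close>, the weight of the branches that meet \<open>W\<close>.
  With \<open>u = n * p\<^sup>2\<close>, outside a bounded set \<open>f\<close> is of order at most
  \<open>p * u\<close> and \<open>g\<close> of order at most \<open>p\<^sup>2\<close>.\<close>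

lemma tree_overlap:
  fixes p :: real
  assumes B: "B \<subseteq> {1..n}" and D: "D \<subseteq> {1..n}" "D \<inter> B = {}"
    and p: "0 \<le> p" "p \<le> 1" and np: "1 \<le> n * p" and W: "finite W" "card W \<le> 9"
    and finT: "finite (trees B D)"
  shows "(\<Sum>j | j \<in> trees B D \<and> tree_set j \<inter> W \<noteq> {}. p ^ card (tree_set j - W)) \<le> 10 ^ 12 * max 1 (n * p\<^sup>2) ^ 4"
proof -
  define u where "u = n * p\<^sup>2"
  define M where "M = max 1 u"
  have u0: "0 \<le> u" by (simp add: u_def)
  have M: "1 \<le> M" "u \<le> M" by (auto simp: M_def)
  have pu: "p \<le> u" using np p mult_right_mono[OF np p(1)] by (simp add: u_def power2_eq_square)
  \<comment> \<open>Off \<open>H\<close> the root element keeps its factor \<open>p\<close>, and no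
    pair inside \<open>W\<close> completes it. The bound on the size is 171 = 9 + 2 * 9 * 9.\<close>
  define H where "H = W \<union> sdiffs W"
  have finH: "finite H" using W finite_sdiffs by (simp add: H_def)
  have "card H \<le> card W + card (sdiffs W)" by (simp add: H_def card_Un_le)
  also have "\<dots> \<le> 9 + 2 * 9 * 9"
    using W card_sdiffs_le[OF W(1)] mult_le_mono[OF W(2) W(2)] by linarith
  finally have cH: "real (card H) \<le> 171" by simp
  \<comment> \<open>84 = 3 + 54 + 27 bounds all three kinds of pairs in terms of \<open>M\<close>.
    In \<open>\<epsilon>\<close>, 57 = 3 + 54 because \<open>p \<le> u\<close>; for
    \<open>\<epsilon>'\<close> the value 54 is rounded up.\<close>
  define \<beta> where "\<beta> = 84 * M"
  define \<epsilon> where "\<epsilon> = 57 * (p * u)"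
  define \<epsilon>' where "\<epsilon>' = 57 * p\<^sup>2"
  have nn: "0 \<le> \<beta>" "0 \<le> \<epsilon>" "0 \<le> \<epsilon>'" using M u0 p by (auto simp: \<beta>_def \<epsilon>_def \<epsilon>'_def)
  have w01: "0 \<le> wt p W v" "wt p W v \<le> 1" for v using p by (auto simp: wt_def)
  let ?K = "\<lambda>v. cmp {1..n} v"
  define hit where "hit = (\<lambda>v q. v \<in> W \<or> fst q \<in> W \<or> snd q \<in> W)"
  define f where "f = (\<lambda>v. wt p W v * (\<Sum>q\<in>?K v. psi p W q))"
  define g where "g = (\<lambda>v. wt p W v * (\<Sum>q\<in>?K v. psi p W q * of_bool (hit v q)))"
  have psi0: "0 \<le> psi p W q" for q using w01 by simp
  have f0: "0 \<le> f v" and g0: "0 \<le> g v" for v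
    unfolding f_def g_def by (intro mult_nonneg_nonneg sum_nonneg w01; simp add: psi0 w01)+
  have K: "(\<Sum>q\<in>?K v. psi p W q) \<le> 3 * u + 54 * p + 27 * of_bool (v \<in> sdiffs W)" for v
    using sum_psi_le(1)[OF W p, of n v] by (simp add: u_def)
  have K84: "(\<Sum>q\<in>?K v. psi p W q) \<le> \<beta>" for v
  proof -
    have "(\<Sum>q\<in>?K v. psi p W q) \<le> 3 * u + 54 * p + 27"
      by (rule order_trans[OF K]) (simp add: of_bool_def)
    then show ?thesis using M p unfolding \<beta>_def by linarith
  qed
  have fg: "g v \<le> f v" for v
    unfolding f_def g_def using psi0 by (intro mult_left_mono sum_mono w01) (simp add: of_bool_def)
  have fH: "f v \<le> \<beta>" for v
    unfolding f_def using mult_mono[OF w01(2)[of v] K84[of v]] w01 psi0 by (simp add: sum_nonneg)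
  have fb: "f v \<le> \<beta> * of_bool (v \<in> H) + \<epsilon>" for v
  proof (cases "v \<in> H")
    case False
    then have v: "v \<notin> W" "v \<notin> sdiffs W" by (auto simp: H_def)
    have "f v \<le> p * (3 * u + 54 * p)"
      unfolding f_def using v K[of v] p by (simp add: wt_def mult_left_mono)
    also have "\<dots> \<le> p * (57 * u)" using pu p by (intro mult_left_mono) auto
    finally show ?thesis using False by (simp add: \<epsilon>_def)
  qed (use fH[of v] nn in auto)
  have gb: "g v \<le> \<beta> * of_bool (v \<in> H) + \<epsilon>'" for v
  proof (cases "v \<in> H")
    case True
    then show ?thesis using order_trans[OF fg fH, of v] nn by auto
  next
    case False
    then have v: "v \<notin> W" "v \<notin> sdiffs W" by (auto simp: H_def)
    have "(\<Sum>q\<in>?K v. psi p W q * of_bool (hit v q)) \<le> 54 * p"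
      using sum_psi_le(2)[OF W p, of n v] v by (simp add: hit_def)
    then have "g v \<le> p * (54 * p)" unfolding g_def using v p by (simp add: wt_def mult_left_mono)
    also have "p * (54 * p) \<le> 57 * p\<^sup>2" by (simp add: power2_eq_square)
    finally show ?thesis using False by (simp add: \<epsilon>'_def)
  qed
  define J where "J = (SIGMA e : {1..n} \<times> {1..n}. ?K (fst e) \<times> ?K (snd e) \<times> ?K (fst e + snd e))"
  have finK: "finite (?K v)" for v by (rule finite_cmp) simp
  have finJ: "finite J" unfolding J_def by (intro finite_SigmaI finite_cartesian_product finK) auto
  \<comment> \<open>The last factor counts the branches that meet \<open>W\<close>. It is at least 1
    on the trees in question, and it lets the sum over \<open>J\<close> split into three
    products.\<close>
  define \<omega> where "\<omega> = (\<lambda>j :: tree. case j of ((x, y), q1, q2, q3) \<Rightarrow>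
     wt p W x * wt p W y * wt p W (x + y) * (psi p W q1 * psi p W q2 * psi p W q3) *
     (of_bool (hit x q1) + of_bool (hit y q2) + of_bool (hit (x + y) q3)))"
  have om0: "0 \<le> \<omega> j" for j
    using w01 by (auto simp: \<omega>_def split: prod.splits intro!: mult_nonneg_nonneg add_nonneg_nonneg)
  have subJ: "{j \<in> trees B D. tree_set j \<inter> W \<noteq> {}} \<subseteq> J"
  proof
    fix j assume "j \<in> {j \<in> trees B D. tree_set j \<inter> W \<noteq> {}}"
    then have t: "j \<in> trees B D" by simp
    obtain x y q1 q2 q3 where j: "j = ((x, y), q1, q2, q3)" by (metis surj_pair)
    have "cmp B v \<subseteq> ?K v" for v using B by (auto simp: cmp_def)
    then show "j \<in> J" using treesD[OF t[unfolded j]] D(1) by (auto simp: J_def j)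
  qed
  have "(\<Sum>j | j \<in> trees B D \<and> tree_set j \<inter> W \<noteq> {}. p ^ card (tree_set j - W))
      \<le> (\<Sum>j | j \<in> trees B D \<and> tree_set j \<inter> W \<noteq> {}. \<omega> j)"
  proof (rule sum_mono)
    fix j assume "j \<in> {j \<in> trees B D. tree_set j \<inter> W \<noteq> {}}"
    moreover obtain x y q1 q2 q3 where j: "j = ((x, y), q1, q2, q3)" by (metis surj_pair)
    ultimately have t: "((x, y), q1, q2, q3) \<in> trees B D" and meet: "tree_set j \<inter> W \<noteq> {}" by auto
    have "hit x q1 \<or> hit y q2 \<or> hit (x + y) q3"
      using meet by (auto simp: j tree_set_def hit_def)
    then have 1: "1 \<le> (of_bool (hit x q1) + of_bool (hit y q2) + of_bool (hit (x + y) q3) :: real)"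
      by auto
    have "wt p W x * wt p W y * wt p W (x + y) * (psi p W q1 * psi p W q2 * psi p W q3) * 1 \<le> \<omega> j"
      unfolding \<omega>_def j prod.case using w01 by (intro mult_left_mono 1) simp
    then show "p ^ card (tree_set j - W) \<le> \<omega> j"
      unfolding j tree_weight(2)[OF B D t] by simp
  qed
  also have "\<dots> \<le> (\<Sum>j\<in>J. \<omega> j)" by (rule sum_mono2[OF finJ subJ]) (rule om0)
  also have "\<dots> = (\<Sum>(x, y)\<in>{1..n} \<times> {1..n}. g x * f y * f (x + y) + f x * g y * f (x + y) + f x * f y * g (x + y))"
  proof -
    have tri: "(\<Sum>q\<in>X \<times> Y \<times> Z. F (fst q) * G (fst (snd q)) * K (snd (snd q))) = sum F X * sum G Y * sum K Z"
      if "finite X" "finite Y" "finite Z"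
      for F G K :: "nat \<times> nat \<Rightarrow> real" and X Y Z
    proof -
      have two: "(\<Sum>q\<in>X' \<times> Y'. F' (fst q) * G' (snd q)) = sum F' X' * sum G' Y'"
        for F' :: "'x \<Rightarrow> real" and G' :: "'y \<Rightarrow> real" and X' Y'
        by (simp add: sum_product sum.cartesian_product split_beta)
      show ?thesis
        using two[of F "\<lambda>q. G (fst q) * K (snd q)" X "Y \<times> Z"] two[of G K Y Z] by (simp add: mult.assoc)
    qed
    have "(\<Sum>j\<in>J. \<omega> j) = (\<Sum>e\<in>{1..n} \<times> {1..n}. \<Sum>q\<in>?K (fst e) \<times> ?K (snd e) \<times> ?K (fst e + snd e). \<omega> (e, q))"
      unfolding J_def by (subst sum.Sigma) (auto intro!: finite_cartesian_product simp: split_beta finite_cmp)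
    also have "\<dots> = (\<Sum>(x, y)\<in>{1..n} \<times> {1..n}. g x * f y * f (x + y) + f x * g y * f (x + y) + f x * f y * g (x + y))"
    proof (rule sum.cong[OF refl])
      fix e :: "nat \<times> nat" assume "e \<in> {1..n} \<times> {1..n}"
      obtain x y where e: "e = (x, y)" by (cases e)
      let ?w = "wt p W x * wt p W y * wt p W (x + y)" and ?N = "?K x \<times> ?K y \<times> ?K (x + y)"
      let ?h = "\<lambda>v q. psi p W q * of_bool (hit v q)"
      have "(\<Sum>q\<in>?N. \<omega> (e, q)) = (\<Sum>q\<in>?N.
          ?w * (?h x (fst q) * psi p W (fst (snd q)) * psi p W (snd (snd q)))
          + ?w * (psi p W (fst q) * ?h y (fst (snd q)) * psi p W (snd (snd q)))
          + ?w * (psi p W (fst q) * psi p W (fst (snd q)) * ?h (x + y) (snd (snd q))))"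
        by (intro sum.cong refl) (simp add: \<omega>_def e split_beta algebra_simps)
      also have "\<dots> = ?w * (sum (?h x) (?K x) * sum (psi p W) (?K y) * sum (psi p W) (?K (x + y)))
          + ?w * (sum (psi p W) (?K x) * sum (?h y) (?K y) * sum (psi p W) (?K (x + y)))
          + ?w * (sum (psi p W) (?K x) * sum (psi p W) (?K y) * sum (?h (x + y)) (?K (x + y)))"
        unfolding sum.distrib sum_distrib_left[symmetric]
        by (simp only: tri[OF finK finK finK, of "?h x" "psi p W" "psi p W", simplified]
            tri[OF finK finK finK, of "psi p W" "?h y" "psi p W"]
            tri[OF finK finK finK, of "psi p W" "psi p W" "?h (x + y)"]
            tri[OF finK finK finK, of "?h x" "psi p W" "psi p W"])
      also have "\<dots> = g x * f y * f (x + y) + f x * g y * f (x + y) + f x * f y * g (x + y)"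
        by (simp add: f_def g_def)
      finally show "(\<Sum>q\<in>?K (fst e) \<times> ?K (snd e) \<times> ?K (fst e + snd e). \<omega> (e, q))
        = (case e of (x, y) \<Rightarrow> g x * f y * f (x + y) + f x * g y * f (x + y) + f x * f y * g (x + y))"
        by (simp add: e)
    qed
    finally show ?thesis .
  qed
  also have "\<dots> = (\<Sum>(x, y)\<in>{1..n} \<times> {1..n}. g x * f y * f (x + y)) + (\<Sum>(x, y)\<in>{1..n} \<times> {1..n}. f x * g y * f (x + y))
      + (\<Sum>(x, y)\<in>{1..n} \<times> {1..n}. f x * f y * g (x + y))"
    by (simp add: sum.distrib split_beta)
  also have "\<dots> \<le> 3 * ((real n)\<^sup>2 * (\<epsilon>' * \<epsilon> * \<epsilon>) + n * 171 * \<beta> * (\<epsilon> * \<epsilon> + 2 * (\<epsilon>' * \<epsilon>)) + 171\<^sup>2 * \<beta>\<^sup>2 * (\<epsilon>' + 2 * \<epsilon>) + 171\<^sup>2 * \<beta> ^ 3)"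
    using sum_three_factors[OF finH cH g0 f0 f0 nn(1,3,2,2) gb fb fb, of n]
      sum_three_factors[OF finH cH f0 g0 f0 nn(1,2,3,2) fb gb fb, of n]
      sum_three_factors[OF finH cH f0 f0 g0 nn(1,2,2,3) fb fb gb, of n]
    by (simp add: algebra_simps)
  also have "\<dots> \<le> 10 ^ 12 * M ^ 4"
  proof -
    have M4: "M ^ 3 \<le> M ^ 4" using M by (intro power_increasing) auto
    have u3: "u ^ 3 * M \<le> M ^ 4" using mult_right_mono[OF power_mono[OF M(2) u0, of 3], of M] M
      by (simp add: eval_nat_numeral mult_ac)
    have M0: "0 \<le> M ^ 4" using M by simp
    have a1: "(real n)\<^sup>2 * (\<epsilon>' * \<epsilon> * \<epsilon>) \<le> 57 ^ 3 * M ^ 4"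
    proof -
      have "(real n)\<^sup>2 * (\<epsilon>' * \<epsilon> * \<epsilon>) = 57 ^ 3 * u ^ 4"
        by (simp add: \<epsilon>_def \<epsilon>'_def u_def power2_eq_square eval_nat_numeral mult_ac)
      then show ?thesis using power_mono[OF M(2) u0, of 4] by simp
    qed
    have nee: "n * \<epsilon> * \<epsilon> = 57\<^sup>2 * u ^ 3" by (simp add: \<epsilon>_def u_def power2_eq_square eval_nat_numeral mult_ac)
    have ne'e: "n * \<epsilon>' * \<epsilon> \<le> 57\<^sup>2 * M ^ 3"
    proof -
      have "n * \<epsilon>' * \<epsilon> = 57\<^sup>2 * (u * (p * u))" by (simp add: \<epsilon>_def \<epsilon>'_def u_def power2_eq_square eval_nat_numeral mult_ac)
      also have "u * (p * u) \<le> M * (M * M)" using M u0 p by (intro mult_mono) auto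
      finally show ?thesis by (simp add: eval_nat_numeral)
    qed
    have "n * \<epsilon> * \<epsilon> \<le> 57\<^sup>2 * M ^ 3" unfolding nee using power_mono[OF M(2) u0, of 3] by simp
    then have "171 * \<beta> * (n * \<epsilon> * \<epsilon> + 2 * (n * \<epsilon>' * \<epsilon>)) \<le> 171 * \<beta> * (57\<^sup>2 * M ^ 3 + 2 * (57\<^sup>2 * M ^ 3))"
      using ne'e nn by (intro mult_left_mono add_mono) auto
    also have "\<dots> = 171 * 84 * 3 * 57\<^sup>2 * M ^ 4" by (simp add: \<beta>_def eval_nat_numeral)
    finally have a2: "n * 171 * \<beta> * (\<epsilon> * \<epsilon> + 2 * (\<epsilon>' * \<epsilon>)) \<le> 171 * 84 * 3 * 57\<^sup>2 * M ^ 4"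
      by (simp add: algebra_simps)
    have e1: "\<epsilon> \<le> 57 * M" "\<epsilon>' \<le> 57 * M"
    proof -
      have "p * u \<le> 1 * M" using p M u0 by (intro mult_mono) auto
      moreover have "p\<^sup>2 \<le> 1" using p by (rule power_le_one)
      ultimately show "\<epsilon> \<le> 57 * M" "\<epsilon>' \<le> 57 * M" using M by (auto simp: \<epsilon>_def \<epsilon>'_def)
    qed
    have "171\<^sup>2 * \<beta>\<^sup>2 * (\<epsilon>' + 2 * \<epsilon>) \<le> 171\<^sup>2 * \<beta>\<^sup>2 * (171 * M)"
      using e1 by (intro mult_left_mono) auto
    also have "\<dots> = 171\<^sup>2 * 84\<^sup>2 * 171 * M ^ 3" by (simp add: \<beta>_def eval_nat_numeral)
    finally have a3: "171\<^sup>2 * \<beta>\<^sup>2 * (\<epsilon>' + 2 * \<epsilon>) \<le> 171\<^sup>2 * 84\<^sup>2 * 171 * M ^ 4"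
      by (rule order_trans) (use M4 in simp)
    have a4: "171\<^sup>2 * \<beta> ^ 3 \<le> 171\<^sup>2 * 84 ^ 3 * M ^ 4" using M4 by (simp add: \<beta>_def power_mult_distrib)
    have "3 * ((real n)\<^sup>2 * (\<epsilon>' * \<epsilon> * \<epsilon>) + n * 171 * \<beta> * (\<epsilon> * \<epsilon> + 2 * (\<epsilon>' * \<epsilon>)) + 171\<^sup>2 * \<beta>\<^sup>2 * (\<epsilon>' + 2 * \<epsilon>) + 171\<^sup>2 * \<beta> ^ 3)
      \<le> 3 * (57 ^ 3 * M ^ 4 + 171 * 84 * 3 * 57\<^sup>2 * M ^ 4 + 171\<^sup>2 * 84\<^sup>2 * 171 * M ^ 4 + 171\<^sup>2 * 84 ^ 3 * M ^ 4)"
      by (intro mult_left_mono add_mono a1 a2 a3 a4) simp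
    also have "\<dots> \<le> 10 ^ 12 * M ^ 4" using M0 by simp
    finally show ?thesis .
  qed
  finally show ?thesis by (simp add: M_def u_def)
qed

lemma prob_no_tree:
  fixes p \<delta> :: real
  assumes B: "B \<subseteq> {1..n}" and D: "D \<subseteq> {1..n}" "D \<inter> B = {}"
    and p: "0 \<le> p" "p \<le> 1" and np: "1 \<le> n * p" and d: "0 < \<delta>" and n: "50 \<le> \<delta> * n"
    and tD: "\<delta> * (real n)\<^sup>2 \<le> tri D" and cD: "\<And>v. v \<in> D \<Longrightarrow> \<delta> * n \<le> card (cmp B v)"
  shows "probR n p {R. \<forall>j\<in>trees B D. \<not> tree_set j \<subseteq> R}
    \<le> exp (- (\<delta> ^ 4 * real n ^ 5 * p ^ 9 / (64 * 10 ^ 12 * max 1 (n * p\<^sup>2) ^ 4)))"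
proof -
  let ?M = "max 1 (n * p\<^sup>2) ^ 4"
  note T = card_trees_ge[OF B D(1) d n tD cD]
  have M: "1 \<le> ?M" by (intro one_le_power) auto
  have c9: "card (tree_set j) = 9" if "j \<in> trees B D" for j
    using that tree_weight(1)[OF B D] by (metis surj_pair)
  have finS: "finite (tree_set j)" for j by (auto simp: tree_set_def split: prod.splits)
  have "probR n p {R. \<forall>j\<in>trees B D. \<not> tree_set j \<subseteq> R}
      \<le> exp (- (\<Sum>j\<in>trees B D. p ^ card (tree_set j)) / (4 * (10 ^ 12 * ?M)))"
  proof (rule janson[OF T(1) _ p])
    show "tree_set j \<subseteq> {1..n}" if "j \<in> trees B D" for j
      using tree_set_subset[OF that] B D by blast
    show "1 \<le> 10 ^ 12 * ?M" by (rule order_trans[OF M]) (use M in simp)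
    show "(\<Sum>j | j \<in> trees B D \<and> tree_set j \<inter> tree_set i \<noteq> {}. p ^ card (tree_set j - tree_set i)) \<le> 10 ^ 12 * ?M"
      if "i \<in> trees B D" for i
      by (rule tree_overlap[OF B D p np finS _ T(1)]) (simp add: c9[OF that])
  qed
  also have "(\<Sum>j\<in>trees B D. p ^ card (tree_set j)) = card (trees B D) * p ^ 9" using c9 by simp
  also have "exp (- (card (trees B D) * p ^ 9) / (4 * (10 ^ 12 * ?M)))
      \<le> exp (- (\<delta> ^ 4 * real n ^ 5 / 16 * p ^ 9) / (4 * (10 ^ 12 * ?M)))"
  proof -
    have "\<delta> ^ 4 * real n ^ 5 / 16 * p ^ 9 / (4 * (10 ^ 12 * ?M)) \<le> card (trees B D) * p ^ 9 / (4 * (10 ^ 12 * ?M))"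
      using p M by (intro divide_right_mono mult_right_mono T(2)) auto
    then show ?thesis by simp
  qed
  also have "- (\<delta> ^ 4 * real n ^ 5 / 16 * p ^ 9) / (4 * (10 ^ 12 * ?M))
      = - (\<delta> ^ 4 * real n ^ 5 * p ^ 9 / (64 * 10 ^ 12 * ?M))" by simp
  finally show ?thesis .
qed

section \<open>The union bound over containers\<close>

lemma card_small_subsets_le: "card {T. T \<subseteq> {1..n} \<and> card T \<le> m} \<le> (n + 1) ^ m"
proof -
  let ?L = "{xs. set xs \<subseteq> {0..n} \<and> length xs = m}"
  \<comment> \<open>Sets are padded to lists of length \<open>m\<close> with the entry 0, which lies
    outside \<open>{1..n}\<close>.\<close>
  have "{T. T \<subseteq> {1..n} \<and> card T \<le> m} \<subseteq> (\<lambda>xs. set xs - {0}) ` ?L"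
  proof
    fix T assume "T \<in> {T. T \<subseteq> {1..n} \<and> card T \<le> m}"
    then have T: "T \<subseteq> {1..n}" "card T \<le> m" by auto
    then have fT: "finite T" by (auto intro: finite_subset)
    define xs where "xs = sorted_list_of_set T @ replicate (m - card T) 0"
    have "T \<subseteq> {0..n}" "0 \<notin> T" using T by auto
    then have "xs \<in> ?L" "T = set xs - {0}" using fT T by (auto simp: xs_def)
    then show "T \<in> (\<lambda>xs. set xs - {0}) ` ?L" by blast
  qed
  then have "card {T. T \<subseteq> {1..n} \<and> card T \<le> m} \<le> card ?L"
    by (intro surj_card_le finite_lists_length_eq) auto
  then show ?thesis by (simp add: card_lists_length_eq)
qed

lemma avoids_trees:
  assumes mf: "mono_free V \<kappa>" and B: "\<And>x. x \<in> B \<inter> R \<Longrightarrow> \<kappa> x = c" and R: "R \<subseteq> V"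
    and B0: "0 \<notin> B" and t: "j \<in> trees B D" and D0: "0 \<notin> D"
  shows "\<not> tree_set j \<subseteq> R"
proof
  assume sub: "tree_set j \<subseteq> R"
  obtain x y q1 q2 q3 where j: "j = ((x, y), q1, q2, q3)" by (metis surj_pair)
  note t = treesD[OF t[unfolded j]]
  have mem: "x \<in> R" "y \<in> R" "x + y \<in> R" "fst q1 \<in> R" "snd q1 \<in> R" "fst q2 \<in> R" "snd q2 \<in> R"
    "fst q3 \<in> R" "snd q3 \<in> R" using sub by (auto simp: tree_set_def j)
  have forced: "\<kappa> v = (\<not> c)" if qv: "q \<in> cmp B v" and "v \<in> R" "fst q \<in> R" "snd q \<in> R" for v q
  proof -
    have q: "fst q \<in> B" "snd q \<in> B" using cmpD[OF qv] by auto
    have cc: "\<kappa> (fst q) = c" "\<kappa> (snd q) = c" using B q that by auto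
    have V: "v \<in> V" "fst q \<in> V" "snd q \<in> V" using that R by auto
    consider "fst q + snd q = v" | "v + fst q = snd q" | "v + snd q = fst q"
      using qv by (auto simp: cmp_def)
    then show ?thesis
      using mf V cc unfolding mono_free_def schur_triple_def by cases metis+
  qed
  have "\<kappa> x = (\<not> c)" "\<kappa> y = (\<not> c)" "\<kappa> (x + y) = (\<not> c)"
    using forced t mem by auto
  then show False
    using mf mem R unfolding mono_free_def schur_triple_def by (metis subsetD)
qed

text \<open>With \<open>u = n * p\<^sup>2\<close> the Janson exponents are, up to constants,
  \<open>n\<^sup>2 * p ^ 3 / max 1 u\<close> for triples and
  \<open>n ^ 5 * p ^ 9 / max 1 u ^ 4\<close> for trees. For \<open>u > 1\<close> both equal
  \<open>n * p\<close>; for \<open>u \<le> 1\<close> the second is the first times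
  \<open>u ^ 3\<close> and hence the smaller one. This is the origin of the minimum.\<close>

lemma prob_avoid_le:
  fixes \<delta> p :: real
  assumes a: "a \<in> {1..n}" and C: "C \<subseteq> {1..n}" and h: "real (hits C a) < \<delta> * n"
    and n: "n \<ge> 10 ^ 17" and d: "\<delta> = (1 / 6000) ^ 3 / 1000"
    and p: "0 \<le> p" "p \<le> 1" and np: "1 \<le> n * p"
  defines "B \<equiv> {1..n} - C"
  defines "D \<equiv> {v \<in> C. \<delta> * n \<le> card (cmp B v)}"
  shows "probR n p {R. \<not> (\<exists>x y. {x, y, x + y} \<subseteq> B \<inter> R) \<and> (\<forall>j\<in>trees B D. \<not> tree_set j \<subseteq> R)}
    \<le> exp (- (\<delta> ^ 4 / (64 * 10 ^ 12) * min (real n ^ 5 * p ^ 9) (n * p)))"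
proof -
  have n16: "n \<ge> 10 ^ 16" using n by simp
  have n': "real n \<ge> 10 ^ 17" using n by (metis of_nat_le_iff of_nat_numeral of_nat_power)
  have d0: "\<delta> > 0" "\<delta> \<le> 1" by (simp_all add: d power_divide)
  have dn: "50 \<le> \<delta> * n" using n' by (simp add: d power_divide)
  define u where "u = n * p\<^sup>2"
  define M where "M = max 1 u"
  have u0: "0 \<le> u" by (simp add: u_def)
  have p0: "0 < p" using np p by (metis less_eq_real_def mult_zero_right not_one_le_zero)
  define X where "X = min (real n ^ 5 * p ^ 9) (n * p)"
  have X0: "0 \<le> X" using p by (simp add: X_def)
  have C': "{1..n} - B = C" using C by (auto simp: B_def)
  have B: "B \<subseteq> {1..n}" by (auto simp: B_def)
  have D: "D \<subseteq> {1..n}" "D \<inter> B = {}" using C by (auto simp: B_def D_def)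
  let ?E = "{R. \<not> (\<exists>x y. {x, y, x + y} \<subseteq> B \<inter> R) \<and> (\<forall>j\<in>trees B D. \<not> tree_set j \<subseteq> R)}"
  have "\<delta> * (real n)\<^sup>2 \<le> tri B \<or> \<delta> * (real n)\<^sup>2 \<le> tri D"
    using many_triples[OF B a n16 d] h unfolding C' D_def by simp
  then show ?thesis unfolding X_def[symmetric]
  proof
    assume tB: "\<delta> * (real n)\<^sup>2 \<le> tri B"
    have "probR n p ?E \<le> probR n p {R. \<not> (\<exists>x y. {x, y, x + y} \<subseteq> B \<inter> R)}"
      by (intro measure_pmf.finite_measure_mono) auto
    also have "\<dots> \<le> exp (- (\<delta> * (real n)\<^sup>2 * p ^ 3 / (288 * max 1 (n * p\<^sup>2))))"
      by (rule prob_no_triple[OF B p d0(1) tB]) (use dn in simp)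
    also have "\<dots> \<le> exp (- (\<delta> ^ 4 / (64 * 10 ^ 12) * X))"
    proof -
      have "X \<le> (real n)\<^sup>2 * p ^ 3 / M"
      proof (cases "u \<le> 1")
        case True
        have "real n ^ 5 * p ^ 9 = (real n)\<^sup>2 * p ^ 3 * u ^ 3"
          by (simp add: u_def power2_eq_square eval_nat_numeral mult_ac)
        also have "\<dots> \<le> (real n)\<^sup>2 * p ^ 3 * 1"
          using True u0 p by (intro mult_left_mono) (auto simp: power_le_one)
        finally show ?thesis using True by (simp add: X_def M_def)
      next
        case False
        have "(real n)\<^sup>2 * p ^ 3 = n * p * u" by (simp add: u_def power2_eq_square eval_nat_numeral mult_ac)
        then show ?thesis using False by (simp add: X_def M_def)
      qed
      moreover have "\<delta> ^ 4 / (64 * 10 ^ 12) \<le> \<delta> / 288"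
      proof -
        have "\<delta> ^ 4 \<le> \<delta> ^ 1" using d0 by (intro power_decreasing) auto
        then show ?thesis using d0 by simp
      qed
      ultimately have "\<delta> ^ 4 / (64 * 10 ^ 12) * X \<le> \<delta> / 288 * ((real n)\<^sup>2 * p ^ 3 / M)"
        using d0 X0 by (intro mult_mono) auto
      then show ?thesis by (simp add: M_def u_def mult_ac)
    qed
    finally show "probR n p ?E \<le> exp (- (\<delta> ^ 4 / (64 * 10 ^ 12) * X))" .
  next
    assume tD: "\<delta> * (real n)\<^sup>2 \<le> tri D"
    have "probR n p ?E \<le> probR n p {R. \<forall>j\<in>trees B D. \<not> tree_set j \<subseteq> R}"
      by (intro measure_pmf.finite_measure_mono) auto
    also have "\<dots> \<le> exp (- (\<delta> ^ 4 * real n ^ 5 * p ^ 9 / (64 * 10 ^ 12 * max 1 (n * p\<^sup>2) ^ 4)))"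
      by (rule prob_no_tree[OF B D p np d0(1) dn tD]) (auto simp: D_def)
    also have "\<dots> \<le> exp (- (\<delta> ^ 4 / (64 * 10 ^ 12) * X))"
    proof -
      have "X \<le> real n ^ 5 * p ^ 9 / M ^ 4"
      proof (cases "u \<le> 1")
        case True
        then show ?thesis by (simp add: X_def M_def)
      next
        case False
        have "real n ^ 5 * p ^ 9 = n * p * u ^ 4" by (simp add: u_def power2_eq_square eval_nat_numeral mult_ac)
        then show ?thesis using False by (simp add: X_def M_def)
      qed
      then have "\<delta> ^ 4 / (64 * 10 ^ 12) * X \<le> \<delta> ^ 4 / (64 * 10 ^ 12) * (real n ^ 5 * p ^ 9 / M ^ 4)"
        using d0 by (intro mult_left_mono) auto
      then show ?thesis by (simp add: M_def u_def mult_ac)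
    qed
    finally show "probR n p ?E \<le> exp (- (\<delta> ^ 4 / (64 * 10 ^ 12) * X))" .
  qed
qed

lemma prob_UN_le:
  assumes "finite I"
  shows "measure_pmf.prob M (\<Union>i\<in>I. E i) \<le> (\<Sum>i\<in>I. measure_pmf.prob M (E i))"
  using measure_pmf.finite_measure_subadditive_finite[OF assms] by auto

lemma prob_mono_support:
  assumes "\<And>R. R \<subseteq> {1..n} \<Longrightarrow> R \<in> E \<Longrightarrow> R \<in> F"
  shows "probR n p E \<le> probR n p F"
proof -
  have "probR n p E = probR n p (E \<inter> set_pmf (random_subset n p))"
    by (simp add: measure_Int_set_pmf)
  also have "\<dots> \<le> probR n p F"
  proof (rule measure_pmf.finite_measure_mono)
    show "E \<inter> set_pmf (random_subset n p) \<subseteq> F"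
    proof
      fix R assume "R \<in> E \<inter> set_pmf (random_subset n p)"
      then show "R \<in> F" using assms[of R] subsetD[OF set_pmf_random_subset, of R n p] by simp
    qed
  qed simp
  finally show ?thesis .
qed

text \<open>Outside its red container all of \<open>R\<close> is blue, and outside its blue
  container all is red. So a sparse container \<open>C\<close> on either side gives an event
  \<open>Ev C\<close> that no longer mentions the colouring. The factor 2 allows for both sides of a
  pair.\<close>

lemma prob_not_schur_le:
  fixes \<delta> p :: real
  assumes A: "A \<subseteq> {1..n}" "card A > 0" and n: "n \<ge> 10 ^ 17" and d: "\<delta> = (1 / 6000) ^ 3 / 1000"
    and m: "m > 0" and k: "1024 < k * \<delta>\<^sup>2"
    and m1: "real m \<le> \<delta>\<^sup>2 * n / 512"
    and m2: "128 * (real n)\<^sup>2 \<le> real m ^ 3 * card A * \<delta>"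
    and m3: "128 * real n \<le> \<delta> * card A * m"
    and p: "0 \<le> p" "p \<le> 1" and np: "1 \<le> n * p"
  shows "probR n p {R. \<not> is_schur (A \<union> R)}
    \<le> 2 * (4 * ((n + 1) ^ m) ^ 3) ^ k * exp (- (\<delta> ^ 4 / (64 * 10 ^ 12) * min (real n ^ 5 * p ^ 9) (n * p)))"
proof -
  let ?P = "card {T. T \<subseteq> {1..n} \<and> card T \<le> m}"
  let ?e = "exp (- (\<delta> ^ 4 / (64 * 10 ^ 12) * min (real n ^ 5 * p ^ 9) (n * p)))"
  have n0: "n > 0" using n by simp
  have d0: "\<delta> > 0" "\<delta> \<le> 1" by (simp_all add: d power_divide)
  have finA: "finite A" using A by (auto intro: finite_subset)
  obtain \<C> where C1: "finite \<C>" and C2: "card \<C> \<le> (4 * ?P ^ 3) ^ k"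
    and C3: "\<forall>(Cr, Cb) \<in> \<C>. Cr \<subseteq> {1..n} \<and> Cb \<subseteq> {1..n} \<and>
       (sparse_at \<delta> n A Cr \<or> sparse_at \<delta> n A Cb \<or>
        real (card Cr + card Cb) + k * (\<delta>\<^sup>2 * n / 512) \<le> 2 * real n)"
    and C4: "\<forall>R \<kappa>. R \<subseteq> {1..n} \<longrightarrow> mono_free (A \<union> R) \<kappa> \<longrightarrow>
       (\<exists>(Cr, Cb) \<in> \<C>. {x\<in>R. \<kappa> x} \<subseteq> Cr \<and> {x\<in>R. \<not> \<kappa> x} \<subseteq> Cb)"
    using containers_iterate[OF finA A(2) n0 m d0 m1 m2 m3, of k] by (elim exE conjE) (rule that)
  \<comment> \<open>After \<open>k\<close> rounds the two sizes would have dropped by more than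
    their initial total, so every remaining pair has a sparse side.\<close>
  have big: "2 * real n < k * (\<delta>\<^sup>2 * n / 512)"
    using mult_strict_right_mono[OF k, of "real n"] n0 by simp
  define \<D> where "\<D> = {C \<in> fst ` \<C> \<union> snd ` \<C>. C \<subseteq> {1..n} \<and> sparse_at \<delta> n A C}"
  define Ev where "Ev = (\<lambda>C. {R. \<not> (\<exists>x y. {x, y, x + y} \<subseteq> ({1..n} - C) \<inter> R) \<and>
     (\<forall>j\<in>trees ({1..n} - C) {v \<in> C. \<delta> * n \<le> card (cmp ({1..n} - C) v)}. \<not> tree_set j \<subseteq> R)})"
  have finD: "finite \<D>" using C1 by (simp add: \<D>_def)
  have "card \<D> \<le> card (fst ` \<C> \<union> snd ` \<C>)" unfolding \<D>_def using C1 by (intro card_mono) auto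
  also have "\<dots> \<le> card \<C> + card \<C>"
    using C1 by (intro order_trans[OF card_Un_le] add_mono card_image_le)
  also have "\<dots> \<le> 2 * (4 * ((n + 1) ^ m) ^ 3) ^ k"
  proof -
    have "(4 * ?P ^ 3) ^ k \<le> (4 * ((n + 1) ^ m) ^ 3) ^ k"
      by (intro power_mono mult_left_mono card_small_subsets_le) auto
    then show ?thesis using C2 by linarith
  qed
  finally have cD: "card \<D> \<le> 2 * (4 * ((n + 1) ^ m) ^ 3) ^ k" .
  have inD: "R \<in> Ev C" if C: "C \<subseteq> {1..n}" and R: "R \<subseteq> {1..n}" and mf: "mono_free (A \<union> R) \<kappa>"
      and col: "\<And>x. x \<in> ({1..n} - C) \<inter> R \<Longrightarrow> \<kappa> x = c" for C R \<kappa> c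
  proof -
    have "\<not> (\<exists>x y. {x, y, x + y} \<subseteq> ({1..n} - C) \<inter> R)"
    proof
      assume "\<exists>x y. {x, y, x + y} \<subseteq> ({1..n} - C) \<inter> R"
      then obtain x y where xy: "x \<in> ({1..n} - C) \<inter> R" "y \<in> ({1..n} - C) \<inter> R" "x + y \<in> ({1..n} - C) \<inter> R"
        by auto
      then have "schur_triple (A \<union> R) x y (x + y)" by (auto simp: schur_triple_def)
      then show False using mf col[OF xy(1)] col[OF xy(2)] col[OF xy(3)] unfolding mono_free_def by metis
    qed
    moreover have "\<not> tree_set j \<subseteq> R"
      if "j \<in> trees ({1..n} - C) {v \<in> C. \<delta> * n \<le> card (cmp ({1..n} - C) v)}" for j
      by (rule avoids_trees[OF mf col _ _ that]) (use C in auto)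
    ultimately show ?thesis by (simp add: Ev_def)
  qed
  have "probR n p {R. \<not> is_schur (A \<union> R)} \<le> probR n p (\<Union>C\<in>\<D>. Ev C)"
  proof (rule prob_mono_support)
    fix R assume R: "R \<subseteq> {1..n}" "R \<in> {R. \<not> is_schur (A \<union> R)}"
    then obtain \<kappa> where mf: "mono_free (A \<union> R) \<kappa>" by (auto simp: is_schur_iff)
    obtain c where c: "c \<in> \<C>" and cov: "case c of (Cr, Cb) \<Rightarrow> {x\<in>R. \<kappa> x} \<subseteq> Cr \<and> {x\<in>R. \<not> \<kappa> x} \<subseteq> Cb"
      using C4[rule_format, OF R(1) mf] by (rule bexE)
    obtain Cr Cb where cc: "c = (Cr, Cb)" by (cases c)
    have cov: "{x\<in>R. \<kappa> x} \<subseteq> Cr" "{x\<in>R. \<not> \<kappa> x} \<subseteq> Cb" using cov by (simp_all add: cc)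
    have q: "Cr \<subseteq> {1..n}" "Cb \<subseteq> {1..n}" "sparse_at \<delta> n A Cr \<or> sparse_at \<delta> n A Cb"
      using bspec[OF C3 c] big by (auto simp: cc)
    from q(3) show "R \<in> (\<Union>C\<in>\<D>. Ev C)"
    proof
      assume "sparse_at \<delta> n A Cr"
      then have "Cr \<in> \<D>" using c q unfolding \<D>_def cc by force
      moreover have "R \<in> Ev Cr"
        by (rule inD[OF q(1) R(1) mf, of False]) (use cov in auto)
      ultimately show ?thesis by blast
    next
      assume "sparse_at \<delta> n A Cb"
      then have "Cb \<in> \<D>" using c q unfolding \<D>_def cc by force
      moreover have "R \<in> Ev Cb"
        by (rule inD[OF q(2) R(1) mf, of True]) (use cov in auto)
      ultimately show ?thesis by blast
    qed
  qed
  also have "\<dots> \<le> (\<Sum>C\<in>\<D>. probR n p (Ev C))" by (rule prob_UN_le[OF finD])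
  also have "\<dots> \<le> (\<Sum>C\<in>\<D>. ?e)"
  proof (rule sum_mono)
    fix C assume "C \<in> \<D>"
    then obtain a where a: "C \<subseteq> {1..n}" "a \<in> A" "real (hits C a) < \<delta> * n"
      by (auto simp: \<D>_def sparse_at_def)
    have "a \<in> {1..n}" using a A by auto
    from prob_avoid_le[OF this a(1,3) n d p np] show "probR n p (Ev C) \<le> ?e" unfolding Ev_def .
  qed
  also have "\<dots> = real (card \<D>) * ?e" by simp
  also have "\<dots> \<le> real (2 * (4 * ((n + 1) ^ m) ^ 3) ^ k) * ?e"
    using cD by (intro mult_right_mono) (simp_all only: of_nat_le_iff exp_ge_zero)
  finally show ?thesis by (simp add: add.commute)
qed

section \<open>The Schur case\<close>

lemma schur_part:
  fixes s :: "nat \<Rightarrow> nat" and A :: "nat \<Rightarrow> nat set" and p :: "nat \<Rightarrow> real"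
  assumes s_pos: "\<And>n. s n > 0"
    and s_lower: "(\<lambda>n. real (s n)) \<in> \<Omega>(\<lambda>n. real n powr (1/2))"
    and A: "eventually (\<lambda>n. A n \<subseteq> {1..n} \<and> card (A n) = s n) sequentially"
    and p: "\<And>n. 0 \<le> p n \<and> p n \<le> 1"
    and p_lower: "p \<in> \<omega>(\<lambda>n. (real n ^ 13 * real (s n)) powr (-1/27) * ln (real n))"
  shows "(\<lambda>n. probR n (p n) {R. is_schur (A n \<union> R)}) \<longlonglongrightarrow> 1"
proof -
  define \<delta> :: real where d: "\<delta> = (1 / 6000) ^ 3 / 1000"
  have d0: "0 < \<delta>" by (simp add: d)
  obtain c where c: "c > 0" and s_ge: "eventually (\<lambda>n. c * real n powr (1/2) \<le> s n) sequentially"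
    using landau_omega.bigE[OF s_lower] by (auto simp: abs_of_nonneg)
  \<comment> \<open>The three summands serve \<open>1 \<le> K\<close> and the hypotheses
    \<open>m2\<close> and \<open>m3\<close> on the fingerprint size. The last one compares
    \<open>s * m\<close> with \<open>n\<close> and uses the lower bound on \<open>s\<close>, hence
    the power \<open>c^(2/3)\<close>.\<close>
  define K where "K = 1 + 128 / \<delta> + 128 / (\<delta> * exp (2 * ln c / 3))"
  have K1: "1 \<le> K" "128 \<le> K * \<delta>" "128 \<le> K * (\<delta> * exp (2 * ln c / 3))"
    using d0 by (auto simp: K_def field_simps)
  obtain k :: nat where k: "1024 < k * \<delta>\<^sup>2"
    using reals_Archimedean3[of "\<delta>\<^sup>2"] d0 by (auto simp: zero_less_power)
  have k1: "k \<ge> 1" using k by (cases k) auto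
  define c1 where "c1 = \<delta> ^ 4 / (64 * 10 ^ 12)"
  have c1: "0 < c1" using d0 by (simp add: c1_def)
  \<comment> \<open>Makes \<open>c1 * L0\<close> exceed \<open>16 * K * k\<close>, the coefficient
    in the exponent of the number of containers, by exactly 1.\<close>
  define L0 where "L0 = (16 * K * k + 1) / c1"
  \<comment> \<open>\<open>n (n^13 s)^(-1/27)\<close> divided by \<open>n^(2/3) s^(-1/3)\<close> is
    \<open>(s / n^(1/2))^(8/27)\<close>, which is at least \<open>c^(8/27)\<close>. Here the
    condition \<open>s = Omega(n^(1/2))\<close> is used to full strength.\<close>
  define cc where "cc = min 1 (exp (8 * ln c / 27))"
  have cc: "0 < cc" "cc \<le> 1" "cc \<le> exp (8 * ln c / 27)" by (auto simp: cc_def)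
  define L where "L = max 1 (max (L0 / cc) (1 / cc))"
  have L: "1 \<le> L" "L0 \<le> L * cc" "1 \<le> L * cc"
    using cc by (auto simp: L_def max_def field_simps)
  have p_ge: "eventually (\<lambda>n. L * ((real n ^ 13 * real (s n)) powr (-1/27) * ln (real n)) \<le> p n) sequentially"
  proof -
    have "0 < L" using L by simp
    from landau_omega.smallD[OF p_lower this] eventually_ge_at_top[of 1]
    show ?thesis by eventually_elim (use p in \<open>auto simp: abs_mult abs_of_nonneg\<close>)
  qed
  \<comment> \<open>The fingerprint size is at most of order \<open>n^(1/2)\<close>; from this bound
    on, it is below the required fraction of \<open>n\<close>.\<close>
  define Z where "Z = max 1 (2 * ln (1024 * K * exp (- (ln c) / 3) / \<delta>\<^sup>2))"
  have ln_ge: "eventually (\<lambda>n. Z \<le> ln (real n)) sequentially"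
    using filterlim_compose[OF ln_at_top filterlim_real_sequentially] by (simp add: filterlim_at_top)
  have main: "eventually (\<lambda>n. probR n (p n) {R. \<not> is_schur (A n \<union> R)} \<le> 1 / n) sequentially"
    using A s_ge p_ge ln_ge eventually_ge_at_top[of "10 ^ 17"]
  proof eventually_elim
    case (elim n)
    have n0: "real n > 0" using elim by simp
    define a where "a = ln (real n)"
    define b where "b = ln (real (s n))"
    have na: "real n = exp a" and sb: "real (s n) = exp b" using n0 s_pos[of n] by (simp_all add: a_def b_def)
    have a1: "1 \<le> a" using elim(4) by (simp add: a_def Z_def)
    have "c * exp (a / 2) \<le> exp b"
      using elim(2) n0 by (simp add: sb[symmetric] a_def powr_def mult.commute)
    then have "ln (c * exp (a / 2)) \<le> ln (exp b)" using c by (intro ln_mono) auto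
    then have b: "ln c + a / 2 \<le> b" using c by (simp add: ln_mult)
    have "card (A n) \<le> n" using elim(1) card_mono[of "{1..n}" "A n"] by simp
    then have "real (s n) \<le> real n" using elim(1) by simp
    then have ba: "b \<le> a" unfolding a_def b_def using s_pos[of n] by (intro ln_mono) auto
    \<comment> \<open>This is \<open>n^(2/3) s^(-1/3)\<close>. Written through the logarithms
      \<open>a\<close> of \<open>n\<close> and \<open>b\<close> of \<open>s\<close>, all comparisons
      of powers become linear in \<open>a\<close> and \<open>b\<close>.\<close>
    define \<mu> where "\<mu> = exp ((2 * a - b) / 3)"
    have mu1: "1 \<le> \<mu>" using ba a1 by (simp add: \<mu>_def)
    define m where "m = nat \<lceil>K * \<mu>\<rceil>"
    have Kmu: "1 \<le> K * \<mu>" using mult_mono[of 1 K 1 \<mu>] K1 mu1 by simp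
    have m_lo: "K * \<mu> \<le> m" and m_hi: "m \<le> 2 * (K * \<mu>)" using Kmu unfolding m_def by linarith+
    have m0: "m > 0" using m_lo Kmu by (metis gr0I not_one_le_zero of_nat_0 order_trans)
    have mu3: "\<mu> ^ 3 = exp (2 * a - b)" by (simp add: \<mu>_def exp_of_nat_mult[symmetric])
    have An: "A n \<subseteq> {1..n}" "card (A n) = s n" "card (A n) > 0" using elim(1) s_pos[of n] by auto
    have m1: "real m \<le> \<delta>\<^sup>2 * n / 512"
    proof -
      have q: "0 < 1024 * K * exp (- (ln c) / 3) / \<delta>\<^sup>2" using K1 d0 by simp
      have "2 * ln (1024 * K * exp (- (ln c) / 3) / \<delta>\<^sup>2) \<le> a" using elim(4) by (simp add: a_def Z_def)
      then have "exp (ln (1024 * K * exp (- (ln c) / 3) / \<delta>\<^sup>2)) \<le> exp (a / 2)" by simp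
      then have "1024 * K * exp (- (ln c) / 3) / \<delta>\<^sup>2 \<le> exp (a / 2)" unfolding exp_ln[OF q] .
      then have q: "1024 * K * exp (- (ln c) / 3) \<le> exp (a / 2) * \<delta>\<^sup>2" using d0 by (simp add: field_simps)
      have "\<mu> \<le> exp (a / 2 - ln c / 3)" unfolding \<mu>_def using b by simp
      also have "\<dots> = exp (- (ln c) / 3) * exp (a / 2)" by (simp add: exp_add[symmetric] field_simps)
      finally have "1024 * K * \<mu> \<le> 1024 * K * (exp (- (ln c) / 3) * exp (a / 2))" using K1 by (intro mult_left_mono) auto
      also have "\<dots> \<le> exp (a / 2) * \<delta>\<^sup>2 * exp (a / 2)" using mult_right_mono[OF q, of "exp (a / 2)"] by (simp add: mult_ac)
      also have "\<dots> = \<delta>\<^sup>2 * n" unfolding na by (simp add: exp_add[symmetric])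
      finally show ?thesis using m_hi by linarith
    qed
    have m2: "128 * (real n)\<^sup>2 \<le> real m ^ 3 * card (A n) * \<delta>"
    proof -
      have "128 * (real n)\<^sup>2 \<le> (K * \<delta>) * (real n)\<^sup>2" using K1 by (intro mult_right_mono) auto
      also have "\<dots> \<le> (K ^ 3 * \<delta>) * (real n)\<^sup>2"
        using K1 d0 power_increasing[of 1 3 K] by (intro mult_right_mono) auto
      also have "\<dots> = (K * \<mu>) ^ 3 * exp b * \<delta>"
        unfolding power_mult_distrib mu3 na by (simp add: exp_add[symmetric] exp_of_nat_mult[symmetric] power2_eq_square)
      also have "\<dots> \<le> real m ^ 3 * exp b * \<delta>"
        using m_lo Kmu d0 by (intro mult_right_mono power_mono) auto
      finally show ?thesis by (simp add: An sb)
    qed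
    have m3: "128 * real n \<le> \<delta> * card (A n) * m"
    proof -
      have "128 * real n \<le> (K * (\<delta> * exp (2 * ln c / 3))) * real n" using K1 by (intro mult_right_mono) auto
      also have "\<dots> = K * \<delta> * exp (2 * ln c / 3 + a)" by (simp add: na exp_add)
      also have "\<dots> \<le> K * \<delta> * exp (b + (2 * a - b) / 3)"
      proof -
        have "2 * ln c / 3 + a \<le> b + (2 * a - b) / 3" using b by (simp add: field_simps)
        then show ?thesis using K1 d0 by (intro mult_left_mono) auto
      qed
      also have "\<dots> = \<delta> * exp b * (K * \<mu>)" by (simp add: \<mu>_def exp_add)
      also have "\<dots> \<le> \<delta> * exp b * m" using m_lo d0 by (intro mult_left_mono) auto
      finally show ?thesis by (simp add: An sb)
    qed
    have pn: "0 \<le> p n" "p n \<le> 1" using p by auto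
    have p_lo: "L * (exp (- (13 * a + b) / 27) * a) \<le> p n"
    proof -
      have "ln (real n ^ 13 * real (s n)) = 13 * a + b"
        using n0 s_pos[of n] by (simp add: ln_mult a_def b_def ln_realpow)
      then have "(real n ^ 13 * real (s n)) powr (-1/27) = exp (- (13 * a + b) / 27)"
        using n0 s_pos[of n] by (simp add: powr_def field_simps)
      then show ?thesis using elim(3) by (simp add: a_def)
    qed
    have np: "L * cc * (\<mu> * a) \<le> n * p n"
    proof -
      have "cc * \<mu> \<le> exp (8 * ln c / 27) * \<mu>" using cc by (intro mult_right_mono) (auto simp: \<mu>_def)
      also have "\<dots> = exp (8 * ln c / 27 + (2 * a - b) / 3)" by (simp add: \<mu>_def exp_add)
      also have "\<dots> \<le> exp (a - (13 * a + b) / 27)" using b by (simp add: field_simps)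
      also have "\<dots> = exp a * exp (- (13 * a + b) / 27)" by (simp add: exp_add[symmetric] field_simps)
      finally have "L * a * (cc * \<mu>) \<le> L * a * (exp a * exp (- (13 * a + b) / 27))"
        using L a1 by (intro mult_left_mono) auto
      also have "\<dots> = n * (L * (exp (- (13 * a + b) / 27) * a))" by (simp add: na)
      also have "\<dots> \<le> n * p n" using p_lo by (intro mult_left_mono) auto
      finally show ?thesis by (simp add: mult_ac)
    qed
    have mua: "1 \<le> \<mu> * a" using mult_mono[of 1 \<mu> 1 a] mu1 a1 by simp
    have np1: "1 \<le> n * p n" using np mult_mono[OF L(3) mua] L mua by simp
    have "L0 * (\<mu> * a) \<le> n * p n"
      using np mult_right_mono[OF L(2), of "\<mu> * a"] mua by simp
    moreover have "L0 * (\<mu> * a) \<le> real n ^ 5 * p n ^ 9"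
    proof -
      have "L0 \<le> L" using order_trans[OF L(2) mult_left_le[OF cc(2)]] L(1) by simp
      then have "L0 * (\<mu> * a) \<le> L * (\<mu> * a)" using mua by (intro mult_right_mono) auto
      \<comment> \<open>The exponent 1/27 is exact here: \<open>n^5 (n^13 s)^(-9/27)\<close> equals
        \<mu>. The ninth powers of \<open>L\<close> and of the logarithm exceed the first powers
        that are required.\<close>
      also have "\<dots> \<le> L ^ 9 * (\<mu> * a ^ 9)"
        using L a1 mu1 power_increasing[of 1 9 L] power_increasing[of 1 9 a] by (intro mult_mono) auto
      also have "\<dots> = exp (5 * a) * (L * (exp (- (13 * a + b) / 27) * a)) ^ 9"
      proof -
        have "exp (- (13 * a + b) / 27) ^ 9 = exp (- (13 * a + b) / 3)"
          by (simp add: exp_of_nat_mult[symmetric])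
        moreover have "\<mu> = exp (5 * a) * exp (- (13 * a + b) / 3)"
          by (simp add: \<mu>_def exp_add[symmetric] field_simps)
        ultimately show ?thesis by (simp add: power_mult_distrib)
      qed
      also have "\<dots> \<le> exp (5 * a) * p n ^ 9"
        using p_lo L a1 by (intro mult_left_mono power_mono) auto
      also have "exp (5 * a) = real n ^ 5" by (simp add: na exp_of_nat_mult[symmetric])
      finally show ?thesis .
    qed
    ultimately have X: "L0 * (\<mu> * a) \<le> min (real n ^ 5 * p n ^ 9) (n * p n)" by simp
    \<comment> \<open>By \<open>n + 1 \<le> n\<^sup>2\<close>, and with the constants 2 and 4
      replaced by \<open>n\<close>, the count is at most \<open>n ^ (8 * m * k)\<close>; then
      \<open>m \<le> 2 * (K * \<mu>)\<close> is inserted.\<close>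
    have cnt: "2 * (4 * ((real n + 1) ^ m) ^ 3) ^ k \<le> exp (16 * K * k * (\<mu> * a))"
    proof -
      have n4: "4 \<le> real n" using elim(5) by simp
      have "real n + 1 \<le> real n * real n" using n4 mult_right_mono[OF n4, of "real n"] by linarith
      then have "(real n + 1) ^ m \<le> (real n * real n) ^ m" by (rule power_mono) simp
      then have "((real n + 1) ^ m) ^ 3 \<le> ((real n * real n) ^ m) ^ 3" by (rule power_mono) simp
      also have "\<dots> = real n ^ (6 * m)"
        by (simp add: power_mult[symmetric] power_mult_distrib power_add[symmetric] flip: power2_eq_square)
      finally have "4 * ((real n + 1) ^ m) ^ 3 \<le> real n * real n ^ (6 * m)" using n4 by (intro mult_mono) auto
      then have "(4 * ((real n + 1) ^ m) ^ 3) ^ k \<le> (real n * real n ^ (6 * m)) ^ k" by (rule power_mono) simp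
      then have "2 * (4 * ((real n + 1) ^ m) ^ 3) ^ k \<le> real n * (real n * real n ^ (6 * m)) ^ k"
        using n4 by (intro mult_mono) auto
      also have "\<dots> = real n ^ (1 + (1 + 6 * m) * k)"
        by (simp only: power_add power_mult power_one_right)
      also have "\<dots> \<le> real n ^ (8 * m * k)"
      proof (rule power_increasing)
        have "1 * 1 \<le> m * k" "1 * k \<le> m * k" using m0 k1 by (intro mult_le_mono; simp)+
        moreover have "1 + (1 + 6 * m) * k = 1 + k + 6 * (m * k)" "8 * m * k = 8 * (m * k)"
          by (simp_all add: algebra_simps)
        ultimately show "1 + (1 + 6 * m) * k \<le> 8 * m * k" by linarith
      qed (use n4 in auto)
      also have "\<dots> = exp (real (8 * m * k) * a)" by (simp only: na exp_of_nat_mult)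
      also have "\<dots> \<le> exp (16 * K * k * (\<mu> * a))"
      proof -
        have "8 * k * a * real m \<le> 8 * k * a * (2 * (K * \<mu>))" using m_hi a1 by (intro mult_left_mono) auto
        then show ?thesis by (simp add: mult_ac)
      qed
      finally show ?thesis .
    qed
    have "probR n (p n) {R. \<not> is_schur (A n \<union> R)}
      \<le> 2 * (4 * ((real n + 1) ^ m) ^ 3) ^ k * exp (- (c1 * min (real n ^ 5 * p n ^ 9) (n * p n)))"
      using prob_not_schur_le[OF An(1,3) elim(5) d m0 k m1 m2 m3 pn np1] by (simp add: c1_def)
    also have "\<dots> \<le> exp (16 * K * k * (\<mu> * a)) * exp (- (c1 * (L0 * (\<mu> * a))))"
      using X c1 by (intro mult_mono cnt) auto
    also have "\<dots> = exp (- (\<mu> * a))"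
    proof -
      have "c1 * L0 = 16 * K * k + 1" using c1 by (simp add: L0_def)
      then have "c1 * (L0 * (\<mu> * a)) = (16 * K * k + 1) * (\<mu> * a)" by (simp add: mult.assoc[symmetric])
      then show ?thesis by (simp add: exp_add[symmetric] algebra_simps)
    qed
    also have "\<dots> \<le> exp (- a)" using mult_right_mono[OF mu1, of a] a1 by simp
    also have "\<dots> = 1 / n" by (simp add: na exp_minus field_simps)
    finally show ?case .
  qed
  have "(\<lambda>n. probR n (p n) {R. \<not> is_schur (A n \<union> R)}) \<longlonglongrightarrow> 0"
    by (rule tendsto_sandwich[OF _ main tendsto_const lim_1_over_n]) (auto simp: always_eventually)
  then have "(\<lambda>n. 1 - probR n (p n) {R. \<not> is_schur (A n \<union> R)}) \<longlonglongrightarrow> 1 - 0"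
    by (intro tendsto_diff tendsto_const)
  moreover have "1 - probR n (p n) {R. \<not> is_schur (A n \<union> R)} = probR n (p n) {R. is_schur (A n \<union> R)}" for n
  proof -
    have "{R. is_schur (A n \<union> R)} = UNIV - {R. \<not> is_schur (A n \<union> R)}" by auto
    then show ?thesis using measure_pmf.prob_compl[of "{R. \<not> is_schur (A n \<union> R)}"] by simp
  qed
  ultimately show ?thesis by simp
qed

section \<open>Colourings along acyclic systems of triples\<close>

text \<open>Set aside a triple \<open>T\<close> with a vertex \<open>v\<close> that neither lies in
  nor is adjacent to the other triples, and treat those first. Then \<open>v\<close> is free, and it
  is added exactly when \<open>T\<close> has no chosen vertex. Left out, it keeps \<open>T\<close>
  from lying inside \<open>X\<close>; added, it is the only chosen vertex of the three in
  \<open>T\<close>.\<close>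

lemma peel_colouring:
  fixes H :: "'a set set"
  assumes "finite H" and card3: "\<And>T. T \<in> H \<Longrightarrow> card T = 3"
    and irr: "\<And>v. \<not> G v v" and sym: "\<And>v w. G v w \<Longrightarrow> G w v"
    and peel: "\<And>H'. H' \<subseteq> H \<Longrightarrow> H' \<noteq> {} \<Longrightarrow>
      \<exists>T\<in>H'. \<exists>v\<in>T. \<forall>T'\<in>H' - {T}. v \<notin> T' \<and> (\<forall>w\<in>T'. \<not> G v w)"
  shows "\<exists>X\<subseteq>\<Union>H. (\<forall>u\<in>X. \<forall>v\<in>X. \<not> G u v) \<and> (\<forall>T\<in>H. T \<inter> X \<noteq> {} \<and> \<not> T \<subseteq> X)"
  using assms(1) card3 peel
proof (induction H rule: finite_psubset_induct)
  case (psubset H)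
  show ?case
  proof (cases "H = {}")
    case False
    obtain T v where T: "T \<in> H" "v \<in> T"
      and free0: "\<forall>T'\<in>H - {T}. v \<notin> T' \<and> (\<forall>w\<in>T'. \<not> G v w)"
      using psubset.prems(2)[OF order_refl False] by (elim bexE)
    have free: "\<And>T'. T' \<in> H - {T} \<Longrightarrow> v \<notin> T'" "\<And>T' w. T' \<in> H - {T} \<Longrightarrow> w \<in> T' \<Longrightarrow> \<not> G v w"
      using free0 by auto
    have ss: "H - {T} \<subset> H" using T by blast
    have "\<exists>X\<subseteq>\<Union>(H - {T}). (\<forall>u\<in>X. \<forall>v\<in>X. \<not> G u v) \<and> (\<forall>T\<in>H - {T}. T \<inter> X \<noteq> {} \<and> \<not> T \<subseteq> X)"
    proof (rule psubset.IH[OF ss])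
      show "card T' = 3" if "T' \<in> H - {T}" for T' using psubset.prems(1)[of T'] that by simp
      fix H' assume "H' \<subseteq> H - {T}" "H' \<noteq> {}"
      then show "\<exists>T\<in>H'. \<exists>v\<in>T. \<forall>T'\<in>H' - {T}. v \<notin> T' \<and> (\<forall>w\<in>T'. \<not> G v w)"
        by (intro psubset.prems(2)) (erule subset_trans, rule Diff_subset)
    qed
    then obtain X where X: "X \<subseteq> \<Union>(H - {T})" and ind0: "\<forall>u\<in>X. \<forall>v\<in>X. \<not> G u v"
      and col0: "\<forall>T\<in>H - {T}. T \<inter> X \<noteq> {} \<and> \<not> T \<subseteq> X" by (elim exE conjE)
    note ind = ind0[rule_format] and col = bspec[OF col0]
    have vX: "v \<notin> X" using X free(1) by blast
    show ?thesis
    proof (cases "T \<inter> X = {}")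
      case False
      show ?thesis
      proof (intro exI[of _ X] conjI ballI)
        show "X \<subseteq> \<Union>H" using X by blast
        show "\<not> G u w" if "u \<in> X" "w \<in> X" for u w by (rule ind[OF that])
        fix T' assume "T' \<in> H"
        show "T' \<inter> X \<noteq> {}" using col[of T'] False \<open>T' \<in> H\<close> by (cases "T' = T") auto
        show "\<not> T' \<subseteq> X" using col[of T'] vX T(2) \<open>T' \<in> H\<close> by (cases "T' = T") auto
      qed
    next
      case True
      have "card T = 3" by (rule psubset.prems(1)[OF T(1)])
      then have "T \<noteq> {v}" by auto
      then have "\<not> T \<subseteq> insert v X" using True T(2) by blast
      moreover have "\<not> G v w \<and> \<not> G w v" if "w \<in> X" for w
        using X free(2) that sym by blast
      moreover have "T' \<inter> insert v X \<noteq> {} \<and> \<not> T' \<subseteq> insert v X" if "T' \<in> H - {T}" for T'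
        using col[OF that] free(1)[OF that] by blast
      ultimately have new: "T \<inter> insert v X \<noteq> {}" "\<not> T \<subseteq> insert v X"
        "\<And>w. w \<in> X \<Longrightarrow> \<not> G v w \<and> \<not> G w v"
        "\<And>T'. T' \<in> H - {T} \<Longrightarrow> T' \<inter> insert v X \<noteq> {} \<and> \<not> T' \<subseteq> insert v X"
        using T(2) by auto
      show ?thesis
      proof (intro exI[of _ "insert v X"] conjI ballI)
        show "insert v X \<subseteq> \<Union>H" using X T by blast
        show "\<not> G u w" if "u \<in> insert v X" "w \<in> insert v X" for u w
          using that new(3) ind irr by auto
        fix T' assume "T' \<in> H"
        show "T' \<inter> insert v X \<noteq> {}" using new(1) new(4)[of T'] \<open>T' \<in> H\<close> by (cases "T' = T") auto
        show "\<not> T' \<subseteq> insert v X" using new(2) new(4)[of T'] \<open>T' \<in> H\<close> by (cases "T' = T") auto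
      qed
    qed
  qed simp
qed

text \<open>A path is the list of its vertices in order of appearance, so that both its probability
  and the number of its continuations can be read off step by step. It is left only through its last
  entry; the second argument is its last triple.\<close>

inductive pth :: "'a set set \<Rightarrow> ('a \<Rightarrow> 'a \<Rightarrow> bool) \<Rightarrow> 'a list \<Rightarrow> 'a set \<Rightarrow> bool" for H G where
  pth_base: "{x, y, z} \<in> H \<Longrightarrow> distinct [x, y, z] \<Longrightarrow> pth H G [x, y, z] {x, y, z}"
| pth_share: "pth H G l T \<Longrightarrow> {last l, c, d} \<in> H \<Longrightarrow> distinct [c, d] \<Longrightarrow> c \<notin> set l \<Longrightarrow> d \<notin> set l \<Longrightarrow>
    pth H G (l @ [c, d]) {last l, c, d}"
| pth_link: "pth H G l T \<Longrightarrow> G (last l) w \<Longrightarrow> {w, c, d} \<in> H \<Longrightarrow> distinct [w, c, d] \<Longrightarrow>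
    w \<notin> set l \<Longrightarrow> c \<notin> set l \<Longrightarrow> d \<notin> set l \<Longrightarrow> pth H G (l @ [w, c, d]) {w, c, d}"

lemma pth_props:
  assumes "pth H G l T"
  shows "T \<in> H" "T \<subseteq> set l" "last l \<in> T" "distinct l" "3 \<le> length l" "set l \<subseteq> \<Union>H" "l \<noteq> []"
proof -
  show "T \<in> H" "T \<subseteq> set l" "last l \<in> T" "distinct l" "3 \<le> length l" "l \<noteq> []"
    using assms by (induction) auto
  show "set l \<subseteq> \<Union>H"
    using assms by (induction) (auto simp del: Union_iff dest!: Union_upper)
qed

text \<open>The beginning of the path is cut off until \<open>u\<close> belongs to the first triple.
  A return to \<open>u\<close> then becomes a return to the first three entries, which leaves
  boundedly many choices for \<open>u\<close> instead of one for each entry.\<close>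

lemma pth_suffix:
  assumes "pth H G l T" "u \<in> set l"
  shows "\<exists>l'. pth H G l' T \<and> set l' \<subseteq> set l \<and> last l' = last l \<and> u \<in> set (take 3 l')"
  using assms
proof (induction)
  case (pth_base x y z)
  then show ?case using pth.pth_base[of x y z H G] by (intro exI[of _ "[x, y, z]"]) auto
next
  case (pth_share l T c d)
  note p = pth_props[OF pth_share.hyps(1)]
  show ?case
  proof (cases "u \<in> set l")
    case True
    then obtain l' where l': "pth H G l' T" "set l' \<subseteq> set l" "last l' = last l" "u \<in> set (take 3 l')"
      using pth_share.IH by blast
    have "pth H G (l' @ [c, d]) {last l', c, d}"
      using l' pth_share.hyps by (intro pth.pth_share[OF l'(1)]) auto
    then show ?thesis using l' pth_props(5)[OF l'(1)] by (intro exI[of _ "l' @ [c, d]"]) auto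
  next
    case False
    have "last l \<in> set l" using p by simp
    then have "pth H G [last l, c, d] {last l, c, d}"
      using pth_share.hyps by (intro pth.pth_base) auto
    then show ?thesis using False pth_share.prems p by (intro exI[of _ "[last l, c, d]"]) auto
  qed
next
  case (pth_link l T w c d)
  note p = pth_props[OF pth_link.hyps(1)]
  show ?case
  proof (cases "u \<in> set l")
    case True
    then obtain l' where l': "pth H G l' T" "set l' \<subseteq> set l" "last l' = last l" "u \<in> set (take 3 l')"
      using pth_link.IH by blast
    have "pth H G (l' @ [w, c, d]) {w, c, d}"
      using l' pth_link.hyps by (intro pth.pth_link[OF l'(1)]) auto
    then show ?thesis using l' pth_props(5)[OF l'(1)] by (intro exI[of _ "l' @ [w, c, d]"]) auto
  next
    case False
    then show ?thesis using pth_link.prems pth_link.hyps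
      by (intro exI[of _ "[w, c, d]"]) (auto intro!: pth.pth_base)
  qed
qed

text \<open>
  The ways in which a path of triples, left through \<open>last l\<close>, can run back into itself.
\<close>

definition closes :: "'a set set \<Rightarrow> ('a \<Rightarrow> 'a \<Rightarrow> bool) \<Rightarrow> 'a list \<Rightarrow> 'a set \<Rightarrow> bool" where
  "closes H G l T \<longleftrightarrow>
     (\<exists>u\<in>set (take 3 l). \<exists>t. t \<notin> set l \<and> last l \<noteq> u \<and> {last l, u, t} \<in> H) \<or>
     (\<exists>u t. u \<in> set l - T \<and> t \<in> set l - T \<and> u \<noteq> t \<and> {last l, u, t} \<in> H) \<or>
     (\<exists>w\<in>set (take 3 l). G (last l) w) \<or>
     (\<exists>w t. \<exists>u\<in>set (take 3 l). G (last l) w \<and> w \<notin> set l \<and> t \<notin> set l \<and> w \<noteq> t \<and> {w, u, t} \<in> H) \<or>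
     (\<exists>w u t. w \<notin> set l \<and> u \<in> set l \<and> t \<in> set l \<and> u \<noteq> t \<and> {w, u, t} \<in> H)"

lemma closesI:
  shows "u \<in> set (take 3 l) \<Longrightarrow> t \<notin> set l \<Longrightarrow> last l \<noteq> u \<Longrightarrow> {last l, u, t} \<in> H \<Longrightarrow> closes H G l T"
    and "u \<in> set l - T \<Longrightarrow> t \<in> set l - T \<Longrightarrow> u \<noteq> t \<Longrightarrow> {last l, u, t} \<in> H \<Longrightarrow> closes H G l T"
    and "w \<in> set (take 3 l) \<Longrightarrow> G (last l) w \<Longrightarrow> closes H G l T"
    and "u \<in> set (take 3 l) \<Longrightarrow> G (last l) w \<Longrightarrow> w \<notin> set l \<Longrightarrow> t \<notin> set l \<Longrightarrow> w \<noteq> t \<Longrightarrow> {w, u, t} \<in> H \<Longrightarrow>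
      closes H G l T"
    and "w \<notin> set l \<Longrightarrow> u \<in> set l \<Longrightarrow> t \<in> set l \<Longrightarrow> u \<noteq> t \<Longrightarrow> {w, u, t} \<in> H \<Longrightarrow> closes H G l T"
  unfolding closes_def by metis+

text \<open>A longest path cannot be prolonged, although \<open>link\<close> offers another triple
  at its last vertex. So this triple, or the link leading to it, runs back into the path, and
  \<open>pth_suffix\<close> normalises the place.\<close>

lemma closed_path_exists:
  assumes fin: "finite H" and card3: "\<And>T. T \<in> H \<Longrightarrow> card T = 3"
    and lin: "\<And>T T' u v. T \<in> H \<Longrightarrow> T' \<in> H \<Longrightarrow> {u, v} \<subseteq> T \<inter> T' \<Longrightarrow> u \<noteq> v \<Longrightarrow> T = T'"
    and ne: "H \<noteq> {}"
    and link: "\<And>T v. T \<in> H \<Longrightarrow> v \<in> T \<Longrightarrow> \<exists>T'\<in>H - {T}. v \<in> T' \<or> (\<exists>w\<in>T'. G v w)"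
  shows "\<exists>l T. pth H G l T \<and> closes H G l T"
proof -
  have finU: "finite (\<Union>H)" 
  proof (rule finite_Union[OF fin])
    show "finite T" if "T \<in> H" for T using card3[OF that] by (intro card_ge_0_finite) simp
  qed
  define Ps where "Ps = {l. \<exists>T. pth H G l T}"
  obtain T0 where T0: "T0 \<in> H" using ne by auto
  obtain x y z where "T0 = {x, y, z}" "x \<noteq> y" "y \<noteq> z" "x \<noteq> z"
    using card3[OF T0] by (meson card_3_iff)
  then have "{x, y, z} \<in> H" "distinct [x, y, z]" using T0 by auto
  then have base: "[x, y, z] \<in> Ps" unfolding Ps_def using pth_base[of x y z H G] by blast
  have bd: "length l \<le> card (\<Union>H)" if lP: "l \<in> Ps" for l
  proof -
    obtain T where "pth H G l T" using lP unfolding Ps_def by auto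
    note p = pth_props(4,6)[OF this]
    show ?thesis using card_mono[OF finU p(2)] distinct_card[OF p(1)] by simp
  qed
  have "\<exists>l. l \<in> Ps \<and> (\<forall>l'. l' \<in> Ps \<longrightarrow> length l' \<le> length l)"
  proof (rule ex_has_greatest_nat[of "\<lambda>l. l \<in> Ps" "[x, y, z]" length "Suc (card (\<Union>H))"])
    show "\<forall>l. l \<in> Ps \<longrightarrow> length l < Suc (card (\<Union>H))" by (intro allI impI le_imp_less_Suc bd)
  qed (rule base)
  then obtain l where l: "l \<in> Ps" and mx0: "\<forall>l'. l' \<in> Ps \<longrightarrow> length l' \<le> length l"
    by (elim exE conjE)
  note mx = mx0[rule_format]
  obtain T where P: "pth H G l T" using l unfolding Ps_def by auto
  note pp = pth_props[OF P]
  define d where "d = last l"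
  obtain T' where T': "T' \<in> H" "T' \<noteq> T" and lk: "d \<in> T' \<or> (\<exists>w\<in>T'. G d w)"
    using link[OF pp(1,3)] unfolding d_def by blast
  have dl: "d \<in> set l" using pp by (simp add: d_def)
  have suf: "\<exists>l'. pth H G l' T \<and> set l' \<subseteq> set l \<and> last l' = d \<and> u \<in> set (take 3 l')" if "u \<in> set l" for u
    using pth_suffix[OF P that] by (simp add: d_def)
  have three: "\<exists>u t. T' = {v, u, t} \<and> distinct [v, u, t]" if "v \<in> T'" for v
  proof -
    obtain a b c where "T' = {a, b, c}" "a \<noteq> b" "b \<noteq> c" "a \<noteq> c"
      using card3[OF T'(1)] by (meson card_3_iff)
    then show ?thesis using that by (auto simp: insert_commute)
  qed
  from lk show ?thesis
  proof
    assume "d \<in> T'"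
    then obtain u t where ut: "T' = {d, u, t}" "distinct [d, u, t]" using three by blast
    have c1: "\<exists>l T. pth H G l T \<and> closes H G l T"
      if cu: "u' \<in> set l" and ct: "t' \<notin> set l" and cd: "d \<noteq> u'" "{d, u', t'} \<in> H" for u' t'
    proof -
      obtain l' where l': "pth H G l' T" "set l' \<subseteq> set l" "last l' = d" "u' \<in> set (take 3 l')"
        using suf[OF cu] by blast
      have "closes H G l' T" by (rule closesI(1)[OF l'(4)]) (use l' ct cd in auto)
      then show ?thesis using l'(1) by (intro exI conjI)
    qed
    consider "u \<notin> set l" "t \<notin> set l" | "u \<in> set l" "t \<notin> set l" | "u \<notin> set l" "t \<in> set l" | "u \<in> set l" "t \<in> set l"
      by blast
    then show ?thesis
    proof cases
      case 1
      have "pth H G (l @ [u, t]) {last l, u, t}"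
        using ut T' 1 unfolding d_def by (intro pth_share[OF P]) auto
      then have "l @ [u, t] \<in> Ps" unfolding Ps_def by blast
      from mx[OF this] show ?thesis by simp
    next
      case 2
      then show ?thesis using c1[of u t] ut T' by auto
    next
      case 3
      then show ?thesis using c1[of t u] ut T' by (auto simp: insert_commute)
    next
      case 4
      \<comment> \<open>By \<open>lin\<close>, the triples \<open>T\<close> and \<open>T'\<close>
        have only \<open>d\<close> in common, so \<open>u\<close> and \<open>t\<close> belong to
        earlier parts of the path.\<close>
      have "u \<notin> T" using lin[OF pp(1) T'(1), of d u] ut T'(2) pp(3) by (auto simp: d_def)
      moreover have "t \<notin> T" using lin[OF pp(1) T'(1), of d t] ut T'(2) pp(3) by (auto simp: d_def)
      ultimately have "closes H G l T" using 4 ut T' by (intro closesI(2)[of u]) (auto simp: d_def)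
      then show ?thesis using P by (intro exI conjI)
    qed
  next
    assume "\<exists>w\<in>T'. G d w"
    then obtain w where w: "w \<in> T'" "G d w" by blast
    then obtain u t where ut: "T' = {w, u, t}" "distinct [w, u, t]" using three by blast
    show ?thesis
    proof (cases "w \<in> set l")
      case True
      obtain l' where l': "pth H G l' T" "last l' = d" "w \<in> set (take 3 l')" using suf[OF True] by blast
      have "closes H G l' T" by (rule closesI(3)[OF l'(3)]) (use l' w in simp)
      then show ?thesis using l'(1) by (intro exI conjI)
    next
      case False
      have c4: "\<exists>l T. pth H G l T \<and> closes H G l T"
        if cu: "u' \<in> set l" and ct: "t' \<notin> set l" and cd: "w \<noteq> t'" "{w, u', t'} \<in> H" for u' t'
      proof -
        obtain l' where l': "pth H G l' T" "set l' \<subseteq> set l" "last l' = d" "u' \<in> set (take 3 l')"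
          using suf[OF cu] by blast
        have "closes H G l' T" by (rule closesI(4)[OF l'(4)]) (use l' ct cd False w in auto)
        then show ?thesis using l'(1) by (intro exI conjI)
      qed
      consider "u \<notin> set l" "t \<notin> set l" | "u \<in> set l" "t \<notin> set l" | "u \<notin> set l" "t \<in> set l" | "u \<in> set l" "t \<in> set l"
        by blast
      then show ?thesis
      proof cases
        case 1
        have "pth H G (l @ [w, u, t]) {w, u, t}"
          using ut T' 1 False w unfolding d_def by (intro pth_link[OF P]) auto
        then have "l @ [w, u, t] \<in> Ps" unfolding Ps_def by blast
        from mx[OF this] show ?thesis by simp
      next
        case 2
        then show ?thesis using c4[of u t] ut T' by auto
      next
        case 3
        then show ?thesis using c4[of t u] ut T' by (auto simp: insert_commute)
      next
        case 4
        have "closes H G l T" using 4 ut T' False by (intro closesI(5)[of w]) auto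
        then show ?thesis using P by (intro exI conjI)
      qed
    qed
  qed
qed

lemma pth_mono: "pth H' G l T \<Longrightarrow> H' \<subseteq> H \<Longrightarrow> pth H G l T"
  by (induction rule: pth.induct) (auto intro: pth.intros)

lemma closes_mono: "closes H' G l T \<Longrightarrow> H' \<subseteq> H \<Longrightarrow> closes H G l T"
  unfolding closes_def by blast

text \<open>A nonempty subsystem from which nothing can be peeled is what
  \<open>closed_path_exists\<close> needs, and its closed path is also one of the whole
  system.\<close>

lemma red_set_exists:
  assumes fin: "finite H" and card3: "\<And>T. T \<in> H \<Longrightarrow> card T = 3"
    and irr: "\<And>v. \<not> G v v" and sym: "\<And>v w. G v w \<Longrightarrow> G w v"
    and lin: "\<And>T T' u v. T \<in> H \<Longrightarrow> T' \<in> H \<Longrightarrow> {u, v} \<subseteq> T \<inter> T' \<Longrightarrow> u \<noteq> v \<Longrightarrow> T = T'"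
    and noclose: "\<And>l T. pth H G l T \<Longrightarrow> \<not> closes H G l T"
  shows "\<exists>X\<subseteq>\<Union>H. (\<forall>u\<in>X. \<forall>v\<in>X. \<not> G u v) \<and> (\<forall>T\<in>H. T \<inter> X \<noteq> {} \<and> \<not> T \<subseteq> X)"
proof (rule peel_colouring[where G = G and H = H])
  show "finite H" by (rule fin)
  show "card T = 3" if "T \<in> H" for T by (rule card3[OF that])
  show "\<not> G v v" for v by (rule irr)
  show "G w v" if "G v w" for v w by (rule sym[OF that])
  fix H' assume H': "H' \<subseteq> H" "H' \<noteq> {}"
  show "\<exists>T\<in>H'. \<exists>v\<in>T. \<forall>T'\<in>H' - {T}. v \<notin> T' \<and> (\<forall>w\<in>T'. \<not> G v w)"
  proof (rule ccontr)
    assume stuck: "\<not> (\<exists>T\<in>H'. \<exists>v\<in>T. \<forall>T'\<in>H' - {T}. v \<notin> T' \<and> (\<forall>w\<in>T'. \<not> G v w))"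
    have link: "\<exists>T'\<in>H' - {T}. v \<in> T' \<or> (\<exists>w\<in>T'. G v w)" if Tv: "T \<in> H'" "v \<in> T" for T v
    proof (rule ccontr)
      assume "\<not> (\<exists>T'\<in>H' - {T}. v \<in> T' \<or> (\<exists>w\<in>T'. G v w))"
      then have "\<forall>T'\<in>H' - {T}. v \<notin> T' \<and> (\<forall>w\<in>T'. \<not> G v w)" by auto
      then have "\<exists>v\<in>T. \<forall>T'\<in>H' - {T}. v \<notin> T' \<and> (\<forall>w\<in>T'. \<not> G v w)" using Tv(2) by (rule bexI)
      then have "\<exists>T\<in>H'. \<exists>v\<in>T. \<forall>T'\<in>H' - {T}. v \<notin> T' \<and> (\<forall>w\<in>T'. \<not> G v w)" using Tv(1) by (rule bexI)
      with stuck show False by (rule notE)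
    qed
    have "\<exists>l T. pth H' G l T \<and> closes H' G l T"
    proof (rule closed_path_exists[where G = G and H = H'])
      show "H' \<noteq> {}" by (rule H'(2))
      show "\<exists>T'\<in>H' - {T}. v \<in> T' \<or> (\<exists>w\<in>T'. G v w)" if "T \<in> H'" "v \<in> T" for T v
        by (rule link[OF that])
      show "finite H'" using H'(1) fin by (rule finite_subset)
      show "card T = 3" if "T \<in> H'" for T by (rule card3) (use H'(1) that in auto)
      show "T = T'" if "T \<in> H'" "T' \<in> H'" "{u, v} \<subseteq> T \<inter> T'" "u \<noteq> v" for T T' u v
        by (rule lin[OF _ _ that(3,4)]) (use that(1,2) H'(1) in auto)
    qed
    then obtain l T where P: "pth H' G l T" "closes H' G l T" by (elim exE conjE)
    show False using noclose[OF pth_mono[OF P(1) H'(1)]] closes_mono[OF P(2) H'(1)] by (rule notE)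
  qed
qed

section \<open>First moment of closed paths\<close>

definition tset :: "nat \<Rightarrow> nat set \<Rightarrow> bool" where
  "tset N S \<longleftrightarrow> S \<subseteq> {1..N} \<and> card S = 3 \<and> (\<exists>x\<in>S. \<exists>y\<in>S. x \<noteq> y \<and> x + y \<in> S)"

text \<open>Two such elements cannot both be red when \<open>{N + 1..n}\<close> is red, because
  their sum lies there. The case \<open>x = y\<close> is left to \<open>forced\<close>.\<close>

definition gadj :: "nat \<Rightarrow> nat \<Rightarrow> nat \<Rightarrow> nat \<Rightarrow> bool" where
  "gadj n N x y \<longleftrightarrow> x \<noteq> y \<and> N < x + y \<and> x + y \<le> n"

lemma tset_third:
  assumes "tset N {a, b, c}"
  shows "c \<in> {a + b, dst a b}"
proof -
  have "card {a, b, c} = 3" using assms by (simp add: tset_def)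
  then have d: "a \<noteq> b" "a \<noteq> c" "b \<noteq> c" by (auto simp: card_insert_if split: if_splits)
  obtain x y where "x \<in> {a, b, c}" "y \<in> {a, b, c}" "x \<noteq> y" "x + y \<in> {a, b, c}" "0 < x" "0 < y"
    using assms unfolding tset_def by force
  then show ?thesis using d by (auto simp: dst_def)
qed

lemma tset_mem: "tset N S \<Longrightarrow> x \<in> S \<Longrightarrow> x \<in> {1..N}"
  by (auto simp: tset_def)

lemma tset_subset: "tset N S \<Longrightarrow> S \<subseteq> {1..N}"
  by (simp add: tset_def)

lemma finite_gadj: "finite {w. gadj n N v w}"
  by (rule finite_subset[of _ "{..n}"]) (auto simp: gadj_def)

lemma card_gadj_le: "card {w. gadj n N v w} \<le> n - N"
proof -
  have "card {w. gadj n N v w} \<le> card {N<..n}"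
    by (rule card_inj_on_le[of "\<lambda>w. v + w"]) (auto simp: gadj_def inj_on_def)
  then show ?thesis by simp
qed

lemma gadj_sym: "gadj n N x y \<Longrightarrow> gadj n N y x"
  by (auto simp: gadj_def add.commute)

section \<open>Expected numbers of lists\<close>

definition extend :: "'a list set \<Rightarrow> ('a list \<Rightarrow> 'a list set) \<Rightarrow> 'a list set" where
  "extend L X = {l @ e | l e. l \<in> L \<and> e \<in> X l \<and> distinct (l @ e)}"

text \<open>For lists of distinct elements of \<open>{1..n}\<close>, the expected number of those in
  \<open>L\<close> that are contained in the random set.\<close>

definition wsum :: "real \<Rightarrow> 'a list set \<Rightarrow> real" where
  "wsum p L = (\<Sum>l\<in>L. p ^ length l)"

lemma wsum_extend:
  assumes L: "finite L" and X: "\<And>l. l \<in> L \<Longrightarrow> finite (X l) \<and> card (X l) \<le> M"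
    and len: "\<And>l e. l \<in> L \<Longrightarrow> e \<in> X l \<Longrightarrow> length e = j" and p: "0 \<le> p"
  shows "finite (extend L X)" "wsum p (extend L X) \<le> real M * p ^ j * wsum p L"
proof -
  have sub: "extend L X \<subseteq> (\<lambda>(l, e). l @ e) ` (SIGMA l:L. X l)" by (auto simp: extend_def)
  have fin: "finite (SIGMA l:L. X l)" using L X by auto
  show "finite (extend L X)" using sub fin by (rule finite_subset[OF _ finite_imageI])
  have "wsum p (extend L X) \<le> (\<Sum>l\<in>(\<lambda>(l, e). l @ e) ` (SIGMA l:L. X l). p ^ length l)"
    unfolding wsum_def using fin p by (intro sum_mono2[OF _ sub]) auto
  also have "\<dots> \<le> (\<Sum>x\<in>(SIGMA l:L. X l). p ^ length (case x of (l, e) \<Rightarrow> l @ e))"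
    by (rule sum_image_le[OF fin, unfolded comp_def]) (use p in auto)
  also have "\<dots> = (\<Sum>l\<in>L. \<Sum>e\<in>X l. p ^ length (l @ e))"
    using L X by (subst sum.Sigma) (auto simp: split_beta)
  also have "\<dots> = (\<Sum>l\<in>L. real (card (X l)) * (p ^ j * p ^ length l))"
    by (intro sum.cong refl) (simp add: len power_add mult_ac)
  also have "\<dots> \<le> (\<Sum>l\<in>L. real M * (p ^ j * p ^ length l))"
    using X p by (intro sum_mono mult_right_mono) auto
  finally show "wsum p (extend L X) \<le> real M * p ^ j * wsum p L"
    by (simp add: wsum_def sum_distrib_left mult_ac)
qed

lemma wsum_Un_le: "finite L \<Longrightarrow> finite L' \<Longrightarrow> 0 \<le> p \<Longrightarrow> wsum p (L \<union> L') \<le> wsum p L + wsum p L'"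
  unfolding wsum_def by (simp add: sum_Un sum_nonneg)

lemma prob_lists_le:
  assumes L: "finite L" "\<And>l. l \<in> L \<Longrightarrow> distinct l \<and> set l \<subseteq> {1..n}" and p: "0 \<le> p" "p \<le> 1"
  shows "probR n p {R. \<exists>l\<in>L. set l \<subseteq> R} \<le> wsum p L"
proof -
  have "{R. \<exists>l\<in>L. set l \<subseteq> R} = (\<Union>l\<in>L. {R. set l \<subseteq> R})" by auto
  then have "probR n p {R. \<exists>l\<in>L. set l \<subseteq> R} \<le> (\<Sum>l\<in>L. probR n p {R. set l \<subseteq> R})"
    using measure_pmf.finite_measure_subadditive_finite[OF L(1), of "\<lambda>l. {R. set l \<subseteq> R}" "random_subset n p"] by auto
  also have "\<dots> = (\<Sum>l\<in>L. p ^ length l)"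
    using L(2) p by (intro sum.cong refl) (simp add: prob_subset distinct_card)
  finally show ?thesis by (simp add: wsum_def)
qed

text \<open>The Boolean says whether the third element of a triple is the sum or the distance of the
  two given ones. Families of triples thus become images of products with \<open>bool\<close>, at
  the cost of a factor 2.\<close>

abbreviation third :: "bool \<Rightarrow> nat \<Rightarrow> nat \<Rightarrow> nat" where
  "third b u v \<equiv> if b then u + v else dst u v"

lemma tset_third_ex: "tset N {a, b, c} \<Longrightarrow> \<exists>e. c = third e a b"
  using tset_third[of N a b c] by (metis insertE singletonD)

definition share_ext :: "nat \<Rightarrow> nat list \<Rightarrow> nat list set" where
  "share_ext N l = {[c, d] | c d. tset N {last l, c, d}}"

definition link_ext :: "nat \<Rightarrow> nat \<Rightarrow> nat list \<Rightarrow> nat list set" where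
  "link_ext n N l = {[w, c, d] | w c d. gadj n N (last l) w \<and> tset N {w, c, d}}"

definition base_paths :: "nat \<Rightarrow> nat list set" where
  "base_paths N = {[x, y, z] | x y z. tset N {x, y, z} \<and> distinct [x, y, z]}"

fun paths :: "nat \<Rightarrow> nat \<Rightarrow> nat \<Rightarrow> nat list set" where
  "paths n N 0 = base_paths N"
| "paths n N (Suc k) = extend (paths n N k) (share_ext N) \<union> extend (paths n N k) (link_ext n N)"

lemma finite_card_image_le:
  assumes "X \<subseteq> f ` Y" "finite Y" "card Y \<le> M"
  shows "finite X \<and> card X \<le> M"
  using assms by (meson card_image_le card_mono finite_imageI finite_subset order_trans)

lemma card_base_paths: "finite (base_paths N) \<and> card (base_paths N) \<le> 2 * N\<^sup>2"
proof (rule finite_card_image_le)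
  show "base_paths N \<subseteq> (\<lambda>(x, y, e). [x, y, third e x y]) ` ({1..N} \<times> {1..N} \<times> (UNIV :: bool set))"
  proof
    fix l assume "l \<in> base_paths N"
    then obtain x y z where l: "l = [x, y, z]" "tset N {x, y, z}" by (auto simp: base_paths_def)
    obtain e where "z = third e x y" using tset_third_ex[OF l(2)] by blast
    then show "l \<in> (\<lambda>(x, y, e). [x, y, third e x y]) ` ({1..N} \<times> {1..N} \<times> (UNIV :: bool set))"
      using l tset_mem[OF l(2)] by (intro image_eqI[of _ _ "(x, y, e)"]) auto
  qed
qed (auto simp: card_cartesian_product power2_eq_square)

lemma card_share_ext: "finite (share_ext N l) \<and> card (share_ext N l) \<le> 2 * N"
proof (rule finite_card_image_le)
  show "share_ext N l \<subseteq> (\<lambda>(c, e). [c, third e (last l) c]) ` ({1..N} \<times> (UNIV :: bool set))"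
  proof
    fix x assume "x \<in> share_ext N l"
    then obtain c d where x: "x = [c, d]" "tset N {last l, c, d}" by (auto simp: share_ext_def)
    obtain e where "d = third e (last l) c" using tset_third_ex[OF x(2)] by blast
    then show "x \<in> (\<lambda>(c, e). [c, third e (last l) c]) ` ({1..N} \<times> (UNIV :: bool set))"
      using x tset_mem[OF x(2)] by (intro image_eqI[of _ _ "(c, e)"]) auto
  qed
qed (auto simp: card_cartesian_product)

lemma card_link_ext: "finite (link_ext n N l) \<and> card (link_ext n N l) \<le> 2 * N * (n - N)"
proof (rule finite_card_image_le)
  let ?W = "{w. gadj n N (last l) w}"
  show "link_ext n N l \<subseteq> (\<lambda>(w, c, e). [w, c, third e w c]) ` (?W \<times> {1..N} \<times> (UNIV :: bool set))"
  proof
    fix x assume "x \<in> link_ext n N l"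
    then obtain w c d where x: "x = [w, c, d]" "gadj n N (last l) w" "tset N {w, c, d}" by (auto simp: link_ext_def)
    obtain e where "d = third e w c" using tset_third_ex[OF x(3)] by blast
    then show "x \<in> (\<lambda>(w, c, e). [w, c, third e w c]) ` (?W \<times> {1..N} \<times> (UNIV :: bool set))"
      using x tset_mem[OF x(3)] by (intro image_eqI[of _ _ "(w, c, e)"]) auto
  qed
  show "finite (?W \<times> {1..N} \<times> (UNIV :: bool set))" using finite_gadj by auto
  show "card (?W \<times> {1..N} \<times> (UNIV :: bool set)) \<le> 2 * N * (n - N)"
    using card_gadj_le[of n N "last l"] by (simp add: card_cartesian_product)
qed

lemma length_ext: "e \<in> share_ext N l \<Longrightarrow> length e = 2" "e \<in> link_ext n N l \<Longrightarrow> length e = 3"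
  by (auto simp: share_ext_def link_ext_def)

lemma paths_props:
  "finite (paths n N k)"
  "l \<in> paths n N k \<Longrightarrow> distinct l \<and> set l \<subseteq> {1..N} \<and> 2 * k + 3 \<le> length l \<and> length l \<le> 3 * Suc k"
proof (induction k arbitrary: l)
  case 0
  { case 1 show ?case using card_base_paths by simp }
  { case 2 then show ?case by (auto simp: base_paths_def tset_def) }
next
  case (Suc k)
  { case 1
    have "finite (extend (paths n N k) (share_ext N))"
      by (rule wsum_extend(1)[where p = 0, OF Suc.IH(1) card_share_ext length_ext(1)]) simp_all
    moreover have "finite (extend (paths n N k) (link_ext n N))"
      by (rule wsum_extend(1)[where p = 0, OF Suc.IH(1) card_link_ext length_ext(2)]) simp_all
    ultimately show ?case by simp }
  { case 2
    then obtain l' e where l: "l = l' @ e" "l' \<in> paths n N k" "distinct (l' @ e)"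
      "e \<in> share_ext N l' \<or> e \<in> link_ext n N l'" by (auto simp: extend_def)
    have "set e \<subseteq> {1..N} \<and> 2 \<le> length e \<and> length e \<le> 3"
      using l(4) by (auto simp: share_ext_def link_ext_def dest!: tset_subset)
    then show ?case using Suc.IH(2)[OF l(2)] l(1,3) by auto }
qed

lemma paths_weight:
  assumes p: "0 \<le> p"
  shows "wsum p (paths n N k) \<le> 2 * real N ^ 2 * p ^ 3 * (2 * real N * p\<^sup>2 + 2 * real N * real (n - N) * p ^ 3) ^ k"
proof (induction k)
  case 0
  have "length l = 3" if "l \<in> base_paths N" for l using that by (auto simp: base_paths_def)
  then have "wsum p (base_paths N) = card (base_paths N) * p ^ 3" by (simp add: wsum_def)
  also have "\<dots> \<le> real (2 * N\<^sup>2) * p ^ 3"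
    using card_base_paths[of N] p by (intro mult_right_mono) (simp_all only: of_nat_le_iff zero_le_power)
  finally show ?case by simp
next
  case (Suc k)
  let ?\<epsilon> = "2 * real N * p\<^sup>2 + 2 * real N * real (n - N) * p ^ 3"
  note f = paths_props(1)[of n N k]
  note s = wsum_extend[OF f card_share_ext length_ext(1) p]
  note l = wsum_extend[OF f card_link_ext length_ext(2) p]
  have "wsum p (paths n N (Suc k)) \<le> real (2 * N) * p\<^sup>2 * wsum p (paths n N k) + real (2 * N * (n - N)) * p ^ 3 * wsum p (paths n N k)"
    unfolding paths.simps by (rule order_trans[OF wsum_Un_le[OF s(1) l(1) p] add_mono[OF s(2) l(2)]])
  also have "\<dots> = ?\<epsilon> * wsum p (paths n N k)"
    by (simp only: of_nat_mult of_nat_numeral) (simp add: algebra_simps)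
  also have "\<dots> \<le> ?\<epsilon> * (2 * real N ^ 2 * p ^ 3 * ?\<epsilon> ^ k)" using p by (intro mult_left_mono Suc.IH) auto
  finally show ?case by (simp add: mult_ac)
qed

text \<open>The closings \<open>run1\<close>, \<open>run2\<close> and \<open>run3\<close> append new
  elements to a path. In \<open>back1\<close> and \<open>back2\<close> the last entry is itself tied
  to earlier ones and nothing is appended, so the saving has to come from the last continuation,
  whose final element is confined to a small set. This is why \<open>closing\<close> filters
  continuations there, and why a single triple, which has none, is treated by
  \<open>base_closed\<close>.\<close>

definition run1 :: "nat \<Rightarrow> nat list \<Rightarrow> nat list set" where
  "run1 N l = {[t] | t. \<exists>u\<in>set (take 3 l). tset N {last l, u, t}}"

definition run2 :: "nat \<Rightarrow> nat \<Rightarrow> nat list \<Rightarrow> nat list set" where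
  "run2 n N l = {[w, t] | w t. gadj n N (last l) w \<and> (\<exists>u\<in>set (take 3 l). tset N {w, u, t})}"

definition run3 :: "nat \<Rightarrow> nat list \<Rightarrow> nat list set" where
  "run3 N l = {[w] | w. \<exists>u\<in>set l. \<exists>t\<in>set l. tset N {u, t, w}}"

definition back1 :: "nat \<Rightarrow> nat \<Rightarrow> nat list \<Rightarrow> nat \<Rightarrow> bool" where
  "back1 n N l d \<longleftrightarrow> (\<exists>w\<in>set (take 3 l). gadj n N d w)"

definition back2 :: "nat \<Rightarrow> nat list \<Rightarrow> nat \<Rightarrow> bool" where
  "back2 N l d \<longleftrightarrow> (\<exists>u\<in>set l. \<exists>t\<in>set l. tset N {u, t, d})"

definition base_closed :: "nat \<Rightarrow> nat \<Rightarrow> nat list set" where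
  "base_closed n N = {l \<in> base_paths N. \<exists>w\<in>set l. gadj n N (last l) w}"

definition closing :: "nat \<Rightarrow> nat \<Rightarrow> nat \<Rightarrow> nat list set" where
  "closing n N k =
     (extend (paths n N k) (run1 N) \<union> extend (paths n N k) (run2 n N) \<union> extend (paths n N k) (run3 N)) \<union>
     ((extend (paths n N k) (\<lambda>l. {e \<in> share_ext N l. back1 n N l (last e)}) \<union>
       extend (paths n N k) (\<lambda>l. {e \<in> link_ext n N l. back1 n N l (last e)})) \<union>
      (extend (paths n N k) (\<lambda>l. {e \<in> share_ext N l. back2 N l (last e)}) \<union>
       extend (paths n N k) (\<lambda>l. {e \<in> link_ext n N l. back2 N l (last e)})))"

definition triples_in :: "nat \<Rightarrow> nat set \<Rightarrow> nat set set" where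
  "triples_in N R = {S. tset N S \<and> S \<subseteq> R}"

lemma extendI: "l \<in> L \<Longrightarrow> e \<in> X l \<Longrightarrow> distinct (l @ e) \<Longrightarrow> l @ e \<in> extend L X"
  by (auto simp: extend_def)

text \<open>The last step is recorded because the \<open>back\<close> closings refer to the path
  before it. If no step was made, the last triple is the whole path.\<close>

lemma pth_paths:
  assumes "pth (triples_in N R) (gadj n N) l T"
  shows "\<exists>k. l \<in> paths n N k \<and> (k = 0 \<and> T = set l \<or>
    (\<exists>k' l' e. l' \<in> paths n N k' \<and> (e \<in> share_ext N l' \<or> e \<in> link_ext n N l') \<and> l = l' @ e \<and> e \<noteq> [] \<and>
       set l - T \<subseteq> set l' \<and> 3 \<le> length l'))"
  using assms
proof (induction)
  case (pth_base x y z)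
  then have "[x, y, z] \<in> paths n N 0" by (auto simp: triples_in_def base_paths_def)
  then show ?case by (intro exI[of _ 0]) auto
next
  case (pth_share l T c d)
  then obtain k where k: "l \<in> paths n N k" by blast
  have e: "[c, d] \<in> share_ext N l" using pth_share.hyps by (auto simp: share_ext_def triples_in_def)
  have "l @ [c, d] \<in> paths n N (Suc k)"
    unfolding paths.simps using pth_share.hyps pth_props(4)[OF pth_share.hyps(1)]
    by (intro UnI1 extendI[where X = "share_ext N", OF k e]) auto
  then show ?case
    by (rule exI[where x = "Suc k", OF conjI], intro disjI2)
      (rule exI[of _ k], rule exI[of _ l], rule exI[of _ "[c, d]"], use k e paths_props(2)[OF k] in auto)
next
  case (pth_link l T w c d)
  then obtain k where k: "l \<in> paths n N k" by blast
  have e: "[w, c, d] \<in> link_ext n N l" using pth_link.hyps by (auto simp: link_ext_def triples_in_def)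
  have "l @ [w, c, d] \<in> paths n N (Suc k)"
    unfolding paths.simps using pth_link.hyps pth_props(4)[OF pth_link.hyps(1)]
    by (intro UnI2 extendI[where X = "link_ext n N", OF k e]) auto
  then show ?case
    by (rule exI[where x = "Suc k", OF conjI], intro disjI2)
      (rule exI[of _ k], rule exI[of _ l], rule exI[of _ "[w, c, d]"], use k e paths_props(2)[OF k] in auto)
qed

lemma closing_list_exists:
  assumes P: "pth (triples_in N R) (gadj n N) l T" and cl: "closes (triples_in N R) (gadj n N) l T"
  shows "\<exists>l'. (l' \<in> base_closed n N \<or> (\<exists>k. l' \<in> closing n N k)) \<and> set l' \<subseteq> R"
proof -
  note pp = pth_props[OF P]
  have lR: "set l \<subseteq> R" using pp(6) by (auto simp: triples_in_def)
  obtain k where k: "l \<in> paths n N k" and hist: "k = 0 \<and> T = set l \<or>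
    (\<exists>k' l' e. l' \<in> paths n N k' \<and> (e \<in> share_ext N l' \<or> e \<in> link_ext n N l') \<and> l = l' @ e \<and> e \<noteq> [] \<and>
       set l - T \<subseteq> set l' \<and> 3 \<le> length l')"
    using pth_paths[OF P] by blast
  have tR: "tset N S" "S \<subseteq> R" if "S \<in> triples_in N R" for S using that by (auto simp: triples_in_def)
  consider (1) u t where "u \<in> set (take 3 l)" "t \<notin> set l" "last l \<noteq> u" "{last l, u, t} \<in> triples_in N R"
    | (2) u t where "u \<in> set l - T" "t \<in> set l - T" "{last l, u, t} \<in> triples_in N R"
    | (3) w where "w \<in> set (take 3 l)" "gadj n N (last l) w"
    | (4) w u t where "u \<in> set (take 3 l)" "gadj n N (last l) w" "w \<notin> set l" "t \<notin> set l" "w \<noteq> t" "{w, u, t} \<in> triples_in N R"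
    | (5) w u t where "w \<notin> set l" "u \<in> set l" "t \<in> set l" "{w, u, t} \<in> triples_in N R"
    using cl unfolding closes_def by (elim disjE exE bexE conjE) metis+
  then show ?thesis
  proof cases
    case 1
    have "[t] \<in> run1 N l" using 1 tR by (auto simp: run1_def)
    then have "l @ [t] \<in> closing n N k"
      unfolding closing_def using k pp(4) 1 by (intro UnI1 extendI) auto
    moreover have "set (l @ [t]) \<subseteq> R" using lR tR(2)[OF 1(4)] by auto
    ultimately show ?thesis by blast
  next
    case 2
    \<comment> \<open>Since \<open>u\<close> and \<open>t\<close> avoid the last triple, they belong
      to the path before the last step; for a single triple this case is void.\<close>
    then obtain k' l' e where h: "l' \<in> paths n N k'" "e \<in> share_ext N l' \<or> e \<in> link_ext n N l'" "l = l' @ e" "e \<noteq> []"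
       "set l - T \<subseteq> set l'" using hist by blast
    have "{last l, u, t} = {u, t, last e}" using h(3,4) by auto
    then have "back2 N l' (last e)" unfolding back2_def using 2 h(5) tR(1) by (metis subsetD)
    then have "l \<in> closing n N k'"
      unfolding closing_def h(3) using h(1,2) pp(4)[unfolded h(3)] by (auto intro: extendI)
    then show ?thesis using lR by blast
  next
    case 3
    \<comment> \<open>If a step was made, the path before it has at least three entries, so the
      first three entries are the same before and after the step.\<close>
    from hist show ?thesis
    proof
      assume "k = 0 \<and> T = set l"
      then have "l \<in> base_closed n N" using k 3 by (auto simp: base_closed_def dest: in_set_takeD)
      then show ?thesis using lR by blast
    next
      assume "\<exists>k' l' e. l' \<in> paths n N k' \<and> (e \<in> share_ext N l' \<or> e \<in> link_ext n N l') \<and> l = l' @ e \<and> e \<noteq> [] \<and>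
       set l - T \<subseteq> set l' \<and> 3 \<le> length l'"
      then obtain k' l' e where h: "l' \<in> paths n N k'" "e \<in> share_ext N l' \<or> e \<in> link_ext n N l'" "l = l' @ e" "e \<noteq> []"
       "3 \<le> length l'" by blast
      have "back1 n N l' (last e)" unfolding back1_def using 3 h by auto
      then have "l \<in> closing n N k'"
        unfolding closing_def h(3) using h(1,2) pp(4)[unfolded h(3)] by (auto intro: extendI)
      then show ?thesis using lR by blast
    qed
  next
    case 4
    have "[w, t] \<in> run2 n N l" using 4 tR by (auto simp: run2_def)
    then have "l @ [w, t] \<in> closing n N k"
      unfolding closing_def using k pp(4) 4 by (intro UnI1 UnI2 extendI) auto
    moreover have "set (l @ [w, t]) \<subseteq> R" using lR tR(2)[OF 4(6)] by auto
    ultimately show ?thesis by blast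
  next
    case 5
    have "{w, u, t} = {u, t, w}" by auto
    then have "[w] \<in> run3 N l" using 5 tR(1)[OF 5(4)] by (auto simp: run3_def)
    then have "l @ [w] \<in> closing n N k"
      unfolding closing_def using k pp(4) 5 by (intro UnI1 UnI2 extendI) auto
    moreover have "set (l @ [w]) \<subseteq> R" using lR tR(2)[OF 5(4)] by auto
    ultimately show ?thesis by blast
  qed
qed

text \<open>Elements that \<open>A = {N + 1..n}\<close> alone may prevent from being red:
  differences of two elements of \<open>A\<close> are below \<open>n - N\<close>, and in the second
  set \<open>2 * x\<close> lies in \<open>A\<close>.\<close>

definition forced :: "nat \<Rightarrow> nat \<Rightarrow> nat set" where
  "forced n N = {1..n - N} \<union> {x. N < 2 * x \<and> 2 * x \<le> n}"

definition doubles :: "nat \<Rightarrow> nat list set" where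
  "doubles N = {[x, 2 * x] | x. x \<in> {1..N} \<and> 2 * x \<in> {1..N}}"

definition forced_triples :: "nat \<Rightarrow> nat \<Rightarrow> nat list set" where
  "forced_triples n N = {[x, c, d] | x c d. x \<in> forced n N \<and> tset N {x, c, d}}"

definition crossing_triples :: "nat \<Rightarrow> nat list set" where
  "crossing_triples N = {[u, v, t, t'] | u v t t'. tset N {u, v, t} \<and> tset N {u, v, t'} \<and> t \<noteq> t'}"

text \<open>Colour \<open>{N + 1..n}\<close> and the set \<open>X\<close> from
  \<open>red_set_exists\<close> red, the rest blue. A blue triple would miss \<open>X\<close>. In a
  red triple, two summands above \<open>N\<close> have a sum above \<open>n\<close>; one above
  \<open>N\<close> and one in \<open>X\<close> make the latter \<open>forced\<close>, but
  \<open>X\<close> consists of members of triples and so contains no forced element. Two summands in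
  \<open>X\<close> with sum above \<open>N\<close> are adjacent, or equal and hence forced;
  otherwise the triple lies inside \<open>X\<close> or is a double.\<close>

lemma not_schur_if_avoids:
  assumes N: "N < n" "n \<le> 2 * N" and R: "R \<subseteq> {1..n}"
    and a1: "\<And>l. l \<in> doubles N \<Longrightarrow> \<not> set l \<subseteq> R" and a2: "\<And>l. l \<in> forced_triples n N \<Longrightarrow> \<not> set l \<subseteq> R"
    and a3: "\<And>l. l \<in> crossing_triples N \<Longrightarrow> \<not> set l \<subseteq> R" and a4: "\<And>l. l \<in> base_closed n N \<Longrightarrow> \<not> set l \<subseteq> R"
    and a5: "\<And>k l. l \<in> closing n N k \<Longrightarrow> \<not> set l \<subseteq> R"
  shows "\<not> is_schur ({N + 1..n} \<union> R)"
proof -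
  let ?H = "triples_in N R" and ?A = "{N + 1..n}"
  have finH: "finite ?H" by (rule finite_subset[of _ "Pow {1..N}"]) (auto simp: triples_in_def tset_def)
  have "\<exists>X\<subseteq>\<Union>?H. (\<forall>u\<in>X. \<forall>v\<in>X. \<not> gadj n N u v) \<and> (\<forall>T\<in>?H. T \<inter> X \<noteq> {} \<and> \<not> T \<subseteq> X)"
  proof (rule red_set_exists[where G = "gadj n N" and H = ?H])
    show "finite ?H" by (rule finH)
    show "card T = 3" if "T \<in> ?H" for T using that by (simp add: triples_in_def tset_def)
    show "\<not> gadj n N v v" for v by (simp add: gadj_def)
    show "gadj n N w v" if "gadj n N v w" for v w by (rule gadj_sym[OF that])
    show "T = T'" if TT: "T \<in> ?H" "T' \<in> ?H" "{u, v} \<subseteq> T \<inter> T'" "u \<noteq> v" for T T' u v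
    proof (rule ccontr)
      assume ne: "T \<noteq> T'"
      have ex: "\<exists>t. S = {u, v, t}" if "S \<in> ?H" "{u, v} \<subseteq> S" for S
      proof -
        have "card (S - {u, v}) = 1" using that \<open>u \<noteq> v\<close>
          by (subst card_Diff_subset) (auto simp: triples_in_def tset_def)
        then obtain t where "S - {u, v} = {t}" by (auto simp: card_1_singleton_iff)
        then show ?thesis using that(2) by (intro exI[of _ t]) auto
      qed
      obtain t where t: "T = {u, v, t}" using ex[of T] TT by auto
      obtain t' where t': "T' = {u, v, t'}" using ex[of T'] TT by auto
      have "t \<noteq> t'" using ne t t' by auto
      then have "[u, v, t, t'] \<in> crossing_triples N"
        using TT(1,2) unfolding t t' by (auto simp: crossing_triples_def triples_in_def)
      from a3[OF this] show False using TT(1,2) unfolding t t' by (auto simp: triples_in_def)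
    qed
    show "\<not> closes ?H (gadj n N) l T" if "pth ?H (gadj n N) l T" for l T
      using closing_list_exists[OF that] a4 a5 by blast
  qed
  then obtain X where X: "X \<subseteq> \<Union>?H" and ind: "\<forall>u\<in>X. \<forall>v\<in>X. \<not> gadj n N u v"
    and col: "\<forall>T\<in>?H. T \<inter> X \<noteq> {} \<and> \<not> T \<subseteq> X" by (elim exE conjE)
  have Xf: "x \<notin> forced n N" "x \<in> {1..N}" "x \<in> R" if x: "x \<in> X" for x
  proof -
    obtain S where S: "S \<in> ?H" "x \<in> S" using X x by blast
    then show "x \<in> {1..N}" "x \<in> R" by (auto simp: triples_in_def tset_def)
    have "card S = 3" using S by (simp add: triples_in_def tset_def)
    then have "card (S - {x}) = 2" using S(2) by (subst card_Diff_subset) auto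
    then obtain c d where "S - {x} = {c, d}" by (auto simp: card_2_iff)
    then have Sx: "S = {x, c, d}" using S(2) by auto
    show "x \<notin> forced n N"
    proof
      assume "x \<in> forced n N"
      then have "[x, c, d] \<in> forced_triples n N"
        using S(1) unfolding Sx by (auto simp: forced_triples_def triples_in_def)
      from a2[OF this] show False using S(1) unfolding Sx by (auto simp: triples_in_def)
    qed
  qed
  have trip: "{x, y, x + y} \<in> ?H" if "x \<noteq> y" "x \<in> R" "y \<in> R" "x + y \<in> R" "x \<in> {1..N}" "y \<in> {1..N}" "x + y \<in> {1..N}" for x y
    using that by (auto simp: triples_in_def tset_def card_insert_if)
  define \<kappa> where "\<kappa> = (\<lambda>x. x \<in> ?A \<union> X)"
  have "mono_free (?A \<union> R) \<kappa>"
    unfolding mono_free_def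
  proof (intro allI impI notI)
    fix x y z assume st: "schur_triple (?A \<union> R) x y z" and mono: "\<kappa> x = \<kappa> y \<and> \<kappa> y = \<kappa> z"
    have z: "z = x + y" and mem: "x \<in> ?A \<union> R" "y \<in> ?A \<union> R" "z \<in> ?A \<union> R"
      using st by (auto simp: schur_triple_def)
    have pos: "0 < x" "0 < y" "z \<le> n" using mem R by auto
    show False
    proof (cases "\<kappa> z")
      case False
      then have n: "x \<notin> ?A" "y \<notin> ?A" "z \<notin> ?A" "x \<notin> X" "y \<notin> X" "z \<notin> X" using mono by (auto simp: \<kappa>_def)
      then have r: "x \<in> R" "y \<in> R" "z \<in> R" "x \<in> {1..N}" "y \<in> {1..N}" "z \<in> {1..N}"
        using mem R by force+
      show False
      proof (cases "x = y")
        case True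
        then have "[x, 2 * x] \<in> doubles N" "z = 2 * x" using r z by (auto simp: doubles_def)
        with a1[of "[x, 2 * x]"] r show False by auto
      next
        case False
        then have "{x, y, z} \<in> ?H" using trip r z by auto
        then have "{x, y, z} \<inter> X \<noteq> {}" using col by blast
        then show False using n by auto
      qed
    next
      case True
      then have rd: "x \<in> ?A \<or> x \<in> X" "y \<in> ?A \<or> y \<in> X" "z \<in> ?A \<or> z \<in> X" using mono by (auto simp: \<kappa>_def)
      have "\<not> (x \<in> ?A \<and> y \<in> ?A)" using N pos z by auto
      moreover have "\<not> (x \<in> ?A \<and> y \<in> X)"
      proof
        assume h: "x \<in> ?A \<and> y \<in> X"
        then have "y \<in> forced n N" using pos z by (auto simp: forced_def)
        then show False using Xf h by blast
      qed
      moreover have "\<not> (y \<in> ?A \<and> x \<in> X)"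
      proof
        assume h: "y \<in> ?A \<and> x \<in> X"
        then have "x \<in> forced n N" using pos z by (auto simp: forced_def)
        then show False using Xf h by blast
      qed
      ultimately have xy: "x \<in> X" "y \<in> X" using rd by blast+
      have r: "x \<in> R" "y \<in> R" "x \<in> {1..N}" "y \<in> {1..N}" using Xf xy by blast+
      show False
      proof (cases "z \<in> ?A")
        case True
        show False
        proof (cases "x = y")
          case True
          then have "x \<in> forced n N" using z \<open>z \<in> ?A\<close> by (auto simp: forced_def)
          then show False using Xf(1)[OF xy(1)] by blast
        next
          case False
          then have "gadj n N x y" using z True by (auto simp: gadj_def)
          then show False using ind xy by blast
        qed
      next
        case False
        then have zX: "z \<in> X" using rd by blast
        note rz = Xf(2,3)[OF zX]
        show False
        proof (cases "x = y")
          case True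
          then have "[x, 2 * x] \<in> doubles N" "z = 2 * x" using r rz z by (auto simp: doubles_def)
          with a1[of "[x, 2 * x]"] r rz show False by auto
        next
          case False
          then have "{x, y, z} \<in> ?H" using trip r rz z by auto
          then have "\<not> {x, y, z} \<subseteq> X" using col by blast
          then show False using xy zX by auto
        qed
      qed
    qed
  qed
  then show ?thesis unfolding is_schur_iff by blast
qed

section \<open>Counting the closings\<close>

lemma card_take3: "card (set (take 3 l)) \<le> 3"
  using card_length[of "take 3 l"] by simp

lemma card_run1: "finite (run1 N l) \<and> card (run1 N l) \<le> 6"
proof (rule finite_card_image_le)
  show "run1 N l \<subseteq> (\<lambda>(u, e). [third e (last l) u]) ` (set (take 3 l) \<times> (UNIV :: bool set))"
  proof
    fix x assume "x \<in> run1 N l"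
    then obtain t u where x: "x = [t]" "u \<in> set (take 3 l)" "tset N {last l, u, t}" by (auto simp: run1_def)
    obtain e where "t = third e (last l) u" using tset_third_ex[OF x(3)] by blast
    then show "x \<in> (\<lambda>(u, e). [third e (last l) u]) ` (set (take 3 l) \<times> (UNIV :: bool set))"
      using x by (intro image_eqI[of _ _ "(u, e)"]) auto
  qed
qed (use card_take3[of l] in \<open>auto simp: card_cartesian_product\<close>)

lemma card_run2: "finite (run2 n N l) \<and> card (run2 n N l) \<le> 6 * (n - N)"
proof (rule finite_card_image_le)
  let ?W = "{w. gadj n N (last l) w}"
  show "run2 n N l \<subseteq> (\<lambda>(w, u, e). [w, third e w u]) ` (?W \<times> set (take 3 l) \<times> (UNIV :: bool set))"
  proof
    fix x assume "x \<in> run2 n N l"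
    then obtain w t u where x: "x = [w, t]" "gadj n N (last l) w" "u \<in> set (take 3 l)" "tset N {w, u, t}"
      by (auto simp: run2_def)
    obtain e where "t = third e w u" using tset_third_ex[OF x(4)] by blast
    then show "x \<in> (\<lambda>(w, u, e). [w, third e w u]) ` (?W \<times> set (take 3 l) \<times> (UNIV :: bool set))"
      using x by (intro image_eqI[of _ _ "(w, u, e)"]) auto
  qed
  show "finite (?W \<times> set (take 3 l) \<times> (UNIV :: bool set))" using finite_gadj by auto
  have "card ?W * card (set (take 3 l)) \<le> (n - N) * 3" by (intro mult_le_mono card_gadj_le card_take3)
  moreover have "card (?W \<times> set (take 3 l) \<times> (UNIV :: bool set)) = 2 * (card ?W * card (set (take 3 l)))"
    by (simp add: card_cartesian_product)
  ultimately show "card (?W \<times> set (take 3 l) \<times> (UNIV :: bool set)) \<le> 6 * (n - N)" by linarith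
qed

definition third_set :: "nat list \<Rightarrow> nat set" where
  "third_set l = (\<lambda>(u, t, e). third e u t) ` (set l \<times> set l \<times> (UNIV :: bool set))"

lemma card_third_set: "finite (third_set l) \<and> card (third_set l) \<le> 2 * (length l)\<^sup>2"
  unfolding third_set_def
proof (rule finite_card_image_le[OF order_refl])
  have "card (set l) * card (set l) \<le> length l * length l" by (intro mult_le_mono card_length)
  then show "card (set l \<times> set l \<times> (UNIV :: bool set)) \<le> 2 * (length l)\<^sup>2"
    by (simp add: card_cartesian_product power2_eq_square)
qed auto

lemma back2_third_set:
  assumes "u \<in> set l" "t \<in> set l" "tset N {u, t, d}"
  shows "d \<in> third_set l"
proof -
  obtain e where "d = third e u t" using tset_third_ex[OF assms(3)] by blast
  then show ?thesis
    unfolding third_set_def using assms by (intro image_eqI[of _ _ "(u, t, e)"]) auto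
qed

lemma card_run3: "finite (run3 N l) \<and> card (run3 N l) \<le> 2 * (length l)\<^sup>2"
proof (rule finite_card_image_le)
  show "run3 N l \<subseteq> (\<lambda>w. [w]) ` third_set l" by (auto simp: run3_def intro: back2_third_set)
qed (use card_third_set in auto)

text \<open>Once the final element is chosen from \<open>D\<close>, the one before it is determined
  up to two choices. So the size of \<open>D\<close> replaces the factor \<open>N\<close> of a free
  continuation.\<close>

lemma card_share_to:
  assumes "finite D" "card D \<le> M" "\<And>e. e \<in> share_ext N l \<Longrightarrow> P e \<Longrightarrow> last e \<in> D"
  shows "finite {e \<in> share_ext N l. P e} \<and> card {e \<in> share_ext N l. P e} \<le> 2 * M"
proof (rule finite_card_image_le)
  show "{e \<in> share_ext N l. P e} \<subseteq> (\<lambda>(d, e). [third e (last l) d, d]) ` (D \<times> (UNIV :: bool set))"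
  proof
    fix x assume xs: "x \<in> {e \<in> share_ext N l. P e}"
    then obtain c d where x: "x = [c, d]" "tset N {last l, c, d}" by (auto simp: share_ext_def)
    have "{last l, c, d} = {last l, d, c}" by auto
    then obtain e where "c = third e (last l) d" using tset_third_ex[of N "last l" d c] x(2) by auto
    moreover have "d \<in> D" using assms(3)[of x] xs x(1) by simp
    ultimately show "x \<in> (\<lambda>(d, e). [third e (last l) d, d]) ` (D \<times> (UNIV :: bool set))"
      using x by (intro image_eqI[of _ _ "(d, e)"]) auto
  qed
qed (use assms in \<open>auto simp: card_cartesian_product\<close>)

lemma card_link_to:
  assumes "finite D" "card D \<le> M" "\<And>e. e \<in> link_ext n N l \<Longrightarrow> P e \<Longrightarrow> last e \<in> D"
  shows "finite {e \<in> link_ext n N l. P e} \<and> card {e \<in> link_ext n N l. P e} \<le> 2 * (n - N) * M"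
proof (rule finite_card_image_le)
  let ?W = "{w. gadj n N (last l) w}"
  show "{e \<in> link_ext n N l. P e} \<subseteq> (\<lambda>(w, d, e). [w, third e w d, d]) ` (?W \<times> D \<times> (UNIV :: bool set))"
  proof
    fix x assume xs: "x \<in> {e \<in> link_ext n N l. P e}"
    then obtain w c d where x: "x = [w, c, d]" "gadj n N (last l) w" "tset N {w, c, d}" by (auto simp: link_ext_def)
    have "{w, c, d} = {w, d, c}" by auto
    then obtain e where "c = third e w d" using tset_third_ex[of N w d c] x(3) by auto
    moreover have "d \<in> D" using assms(3)[of x] xs x(1) by simp
    ultimately show "x \<in> (\<lambda>(w, d, e). [w, third e w d, d]) ` (?W \<times> D \<times> (UNIV :: bool set))"
      using x by (intro image_eqI[of _ _ "(w, d, e)"]) auto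
  qed
  show "finite (?W \<times> D \<times> (UNIV :: bool set))" using finite_gadj assms(1) by auto
  have "card ?W * card D \<le> (n - N) * M" by (intro mult_le_mono card_gadj_le assms)
  moreover have "card (?W \<times> D \<times> (UNIV :: bool set)) = 2 * (card ?W * card D)"
    by (simp add: card_cartesian_product)
  ultimately show "card (?W \<times> D \<times> (UNIV :: bool set)) \<le> 2 * (n - N) * M" by linarith
qed

definition back_set :: "nat \<Rightarrow> nat \<Rightarrow> nat list \<Rightarrow> nat set" where
  "back_set n N l = (\<Union>w\<in>set (take 3 l). {d. gadj n N w d})"

lemma card_back_set: "finite (back_set n N l) \<and> card (back_set n N l) \<le> 3 * (n - N)"
proof
  show "finite (back_set n N l)" unfolding back_set_def using finite_gadj by auto
  have "card (back_set n N l) \<le> (\<Sum>w\<in>set (take 3 l). card {d. gadj n N w d})"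
    unfolding back_set_def by (rule card_UN_le) simp
  also have "\<dots> \<le> (\<Sum>w\<in>set (take 3 l). n - N)" by (intro sum_mono card_gadj_le)
  also have "\<dots> \<le> 3 * (n - N)" using card_take3[of l] by simp
  finally show "card (back_set n N l) \<le> 3 * (n - N)" .
qed

lemma back1_back_set: "back1 n N l d \<Longrightarrow> d \<in> back_set n N l"
  by (auto simp: back1_def back_set_def intro: gadj_sym)

lemma closing_props:
  assumes l: "l \<in> closing n N k"
  shows "distinct l \<and> set l \<subseteq> {1..N} \<and> k \<le> N"
proof -
  obtain l' e where le: "l' \<in> paths n N k" "l = l' @ e" "distinct (l' @ e)"
    and e: "e \<in> run1 N l' \<or> e \<in> run2 n N l' \<or> e \<in> run3 N l' \<or> e \<in> share_ext N l' \<or> e \<in> link_ext n N l'"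
    using l unfolding closing_def extend_def by blast
  note p = paths_props(2)[OF le(1)]
  have "set e \<subseteq> {1..N}"
    using e by (auto simp: run1_def run2_def run3_def share_ext_def link_ext_def dest!: tset_subset)
  moreover have "length l' \<le> N" using p card_mono[of "{1..N}" "set l'"] distinct_card[of l'] by simp
  ultimately show ?thesis using le p by auto
qed

lemma wsum_extend_both:
  assumes "finite L" "\<And>l. l \<in> L \<Longrightarrow> finite (X l) \<and> card (X l) \<le> M"
    and "\<And>l e. l \<in> L \<Longrightarrow> e \<in> X l \<Longrightarrow> length e = j" and "0 \<le> p"
  shows "finite (extend L X) \<and> wsum p (extend L X) \<le> real M * p ^ j * wsum p L"
proof
  show "finite (extend L X)"
    by (rule wsum_extend(1)[where X = X and M = M and j = j and p = p]; fact assms)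
  show "wsum p (extend L X) \<le> real M * p ^ j * wsum p L"
    by (rule wsum_extend(2)[where X = X and M = M and j = j and p = p]; fact assms)
qed

text \<open>The closing compensates the factor \<open>n\<^sup>2 * p ^ 3\<close> of the first triple:
  with \<open>p\<close>, \<open>s * p\<^sup>2\<close> and \<open>s\<^sup>2 * p ^ 3\<close> it
  becomes \<open>\<alpha>\<^sup>2\<close>, \<open>\<alpha> * \<beta>\<close> and
  \<open>\<beta>\<^sup>2\<close>. The square of \<open>k + 1\<close> stems from \<open>run3\<close>
  and \<open>back2\<close>, where two entries are chosen freely from a path with at most
  \<open>3 * (k + 1)\<close> of them.\<close>

lemma closing_weight:
  fixes p :: real and n N s k :: nat
  assumes p: "0 \<le> p" "p \<le> 1" and N: "N \<le> n" and s: "s = n - N"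
  defines "\<alpha> \<equiv> n * p\<^sup>2" and "\<beta> \<equiv> n * s * p ^ 3"
  shows "finite (closing n N k)"
    and "wsum p (closing n N k) \<le> 2 * (60 * \<alpha>\<^sup>2 + 48 * \<alpha> * \<beta> + 6 * \<beta>\<^sup>2) * ((real k + 1)\<^sup>2 * (2 * \<alpha> + 2 * \<beta>) ^ k)"
proof -
  let ?L = "paths n N k"
  define W where "W = wsum p ?L"
  define r where "r = (real k + 1)\<^sup>2"
  have r1: "1 \<le> r" unfolding r_def by (rule one_le_power) simp
  have W0: "0 \<le> W" unfolding W_def wsum_def using p by (intro sum_nonneg) auto
  note f = paths_props(1)[of n N k]
  have len: "(length l)\<^sup>2 \<le> 9 * (Suc k)\<^sup>2" if "l \<in> ?L" for l
  proof -
    have "length l \<le> 3 * Suc k" using paths_props(2)[OF that] by blast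
    then have "(length l)\<^sup>2 \<le> (3 * Suc k)\<^sup>2" by (rule power_mono) simp
    then show ?thesis by (simp only: power_mult_distrib) simp
  qed
  have D: "finite (third_set l) \<and> card (third_set l) \<le> 18 * (Suc k)\<^sup>2" if "l \<in> ?L" for l
    using card_third_set[of l] len[OF that] by linarith
  have r3: "finite (run3 N l) \<and> card (run3 N l) \<le> 18 * (Suc k)\<^sup>2" if "l \<in> ?L" for l
    using card_run3[of N l] len[OF that] by linarith
  have b1: "finite {e \<in> share_ext N l. back1 n N l (last e)} \<and> card {e \<in> share_ext N l. back1 n N l (last e)} \<le> 2 * (3 * s)" for l
    unfolding s using card_back_set[of n N l] by (intro card_share_to) (auto intro: back1_back_set)
  have b2: "finite {e \<in> link_ext n N l. back1 n N l (last e)} \<and> card {e \<in> link_ext n N l. back1 n N l (last e)} \<le> 2 * s * (3 * s)" for l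
    unfolding s using card_back_set[of n N l] by (intro card_link_to) (auto intro: back1_back_set)
  have b3: "finite {e \<in> share_ext N l. back2 N l (last e)} \<and> card {e \<in> share_ext N l. back2 N l (last e)} \<le> 2 * (18 * (Suc k)\<^sup>2)"
    if "l \<in> ?L" for l
    using D[OF that] by (intro card_share_to) (auto simp: back2_def intro: back2_third_set)
  have b4: "finite {e \<in> link_ext n N l. back2 N l (last e)} \<and> card {e \<in> link_ext n N l. back2 N l (last e)} \<le> 2 * s * (18 * (Suc k)\<^sup>2)"
    if "l \<in> ?L" for l
    unfolding s using D[OF that] by (intro card_link_to) (auto simp: back2_def intro: back2_third_set)
  have e1: "finite (extend ?L (run1 N)) \<and> wsum p (extend ?L (run1 N)) \<le> real 6 * p ^ 1 * W"
    unfolding W_def by (rule wsum_extend_both[OF f card_run1 _ p(1)]) (auto simp: run1_def)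
  have e2: "finite (extend ?L (run2 n N)) \<and> wsum p (extend ?L (run2 n N)) \<le> real (6 * s) * p\<^sup>2 * W"
    unfolding W_def s by (rule wsum_extend_both[OF f card_run2 _ p(1)]) (auto simp: run2_def)
  have e3: "finite (extend ?L (run3 N)) \<and> wsum p (extend ?L (run3 N)) \<le> real (18 * (Suc k)\<^sup>2) * p ^ 1 * W"
    unfolding W_def by (rule wsum_extend_both[OF f r3 _ p(1)]) (auto simp: run3_def)
  have e4: "finite (extend ?L (\<lambda>l. {e \<in> share_ext N l. back1 n N l (last e)})) \<and>
      wsum p (extend ?L (\<lambda>l. {e \<in> share_ext N l. back1 n N l (last e)})) \<le> real (2 * (3 * s)) * p\<^sup>2 * W"
    unfolding W_def by (rule wsum_extend_both[OF f b1 _ p(1)]) (auto dest: length_ext(1))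
  have e5: "finite (extend ?L (\<lambda>l. {e \<in> link_ext n N l. back1 n N l (last e)})) \<and>
      wsum p (extend ?L (\<lambda>l. {e \<in> link_ext n N l. back1 n N l (last e)})) \<le> real (2 * s * (3 * s)) * p ^ 3 * W"
    unfolding W_def by (rule wsum_extend_both[OF f b2 _ p(1)]) (auto dest: length_ext(2))
  have e6: "finite (extend ?L (\<lambda>l. {e \<in> share_ext N l. back2 N l (last e)})) \<and>
      wsum p (extend ?L (\<lambda>l. {e \<in> share_ext N l. back2 N l (last e)})) \<le> real (2 * (18 * (Suc k)\<^sup>2)) * p\<^sup>2 * W"
    unfolding W_def by (rule wsum_extend_both[OF f b3 _ p(1)]) (auto dest: length_ext(1))
  have e7: "finite (extend ?L (\<lambda>l. {e \<in> link_ext n N l. back2 N l (last e)})) \<and>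
      wsum p (extend ?L (\<lambda>l. {e \<in> link_ext n N l. back2 N l (last e)})) \<le> real (2 * s * (18 * (Suc k)\<^sup>2)) * p ^ 3 * W"
    unfolding W_def by (rule wsum_extend_both[OF f b4 _ p(1)]) (auto dest: length_ext(2))
  note fin = e1[THEN conjunct1] e2[THEN conjunct1] e3[THEN conjunct1] e4[THEN conjunct1] e5[THEN conjunct1]
    e6[THEN conjunct1] e7[THEN conjunct1]
  show "finite (closing n N k)" unfolding closing_def by (intro finite_UnI fin)
  have rk: "real ((Suc k)\<^sup>2) = r" by (simp add: r_def add.commute)
  have "wsum p (closing n N k) \<le> ((real 6 * p ^ 1 * W + real (6 * s) * p\<^sup>2 * W) + real (18 * (Suc k)\<^sup>2) * p ^ 1 * W)
     + ((real (2 * (3 * s)) * p\<^sup>2 * W + real (2 * s * (3 * s)) * p ^ 3 * W)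
     + (real (2 * (18 * (Suc k)\<^sup>2)) * p\<^sup>2 * W + real (2 * s * (18 * (Suc k)\<^sup>2)) * p ^ 3 * W))"
    unfolding closing_def
    by (rule order_trans[OF wsum_Un_le add_mono] | rule e1[THEN conjunct2] e2[THEN conjunct2] e3[THEN conjunct2]
        e4[THEN conjunct2] e5[THEN conjunct2] e6[THEN conjunct2] e7[THEN conjunct2] fin finite_UnI p(1))+
  also have "\<dots> = W * (6 * p + 12 * (s * p\<^sup>2) + 18 * r * p + 6 * (real s ^ 2 * p ^ 3) + 36 * r * p\<^sup>2 + 36 * r * (s * p ^ 3))"
    by (simp only: of_nat_mult of_nat_numeral rk) (simp add: algebra_simps power2_eq_square)
  \<comment> \<open>60 = 6 + 18 + 36 and 48 = 12 + 36, after \<open>p\<^sup>2 \<le> p\<close> and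
    \<open>p ^ 3 \<le> p\<^sup>2\<close>.\<close>
  also have "\<dots> \<le> W * (r * (60 * p + 48 * (s * p\<^sup>2) + 6 * (real s ^ 2 * p ^ 3)))"
  proof (intro mult_left_mono W0)
    have "p\<^sup>2 \<le> p ^ 1" "p ^ 3 \<le> p\<^sup>2" using p by (intro power_decreasing; simp)+
    then have q: "36 * r * p\<^sup>2 \<le> 36 * r * p" "36 * r * (s * p ^ 3) \<le> 36 * r * (s * p\<^sup>2)"
      using r1 by (auto intro!: mult_left_mono)
    have "1 * p \<le> r * p" "1 * (s * p\<^sup>2) \<le> r * (s * p\<^sup>2)" "1 * (real s ^ 2 * p ^ 3) \<le> r * (real s ^ 2 * p ^ 3)"
      using r1 p by (intro mult_right_mono; simp)+
    then show "6 * p + 12 * (s * p\<^sup>2) + 18 * r * p + 6 * (real s ^ 2 * p ^ 3) + 36 * r * p\<^sup>2 + 36 * r * (s * p ^ 3)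
      \<le> r * (60 * p + 48 * (s * p\<^sup>2) + 6 * (real s ^ 2 * p ^ 3))"
      using q by (simp add: algebra_simps)
  qed
  also have "\<dots> \<le> (2 * real n ^ 2 * p ^ 3 * (2 * \<alpha> + 2 * \<beta>) ^ k) * (r * (60 * p + 48 * (s * p\<^sup>2) + 6 * (real s ^ 2 * p ^ 3)))"
  proof (rule mult_right_mono)
    have "W \<le> 2 * real N ^ 2 * p ^ 3 * (2 * real N * p\<^sup>2 + 2 * real N * real (n - N) * p ^ 3) ^ k"
      unfolding W_def by (rule paths_weight[OF p(1)])
    also have "\<dots> \<le> 2 * real n ^ 2 * p ^ 3 * (2 * \<alpha> + 2 * \<beta>) ^ k"
    proof (intro mult_mono power_mono)
      have "real N * p\<^sup>2 \<le> n * p\<^sup>2" "real N * (real s * p ^ 3) \<le> n * (real s * p ^ 3)"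
        using N p by (intro mult_right_mono; simp)+
      then show "2 * real N * p\<^sup>2 + 2 * real N * real (n - N) * p ^ 3 \<le> 2 * \<alpha> + 2 * \<beta>"
        unfolding \<alpha>_def \<beta>_def s[symmetric] by simp
    qed (use N p in auto)
    finally show "W \<le> 2 * real n ^ 2 * p ^ 3 * (2 * \<alpha> + 2 * \<beta>) ^ k" .
  qed (use r1 p in simp)
  also have "\<dots> = 2 * (60 * \<alpha>\<^sup>2 + 48 * \<alpha> * \<beta> + 6 * \<beta>\<^sup>2) * (r * (2 * \<alpha> + 2 * \<beta>) ^ k)"
  proof -
    have "real n ^ 2 * p ^ 3 * (60 * p + 48 * (s * p\<^sup>2) + 6 * (real s ^ 2 * p ^ 3)) = 60 * \<alpha>\<^sup>2 + 48 * \<alpha> * \<beta> + 6 * \<beta>\<^sup>2"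
      by (simp add: \<alpha>_def \<beta>_def power2_eq_square power3_eq_cube algebra_simps)
    then show ?thesis by (simp add: mult_ac)
  qed
  finally show "wsum p (closing n N k) \<le> 2 * (60 * \<alpha>\<^sup>2 + 48 * \<alpha> * \<beta> + 6 * \<beta>\<^sup>2) * ((real k + 1)\<^sup>2 * (2 * \<alpha> + 2 * \<beta>) ^ k)"
    by (simp add: r_def)
qed

lemma sum_square_power_le:
  fixes \<epsilon> :: real
  assumes "0 \<le> \<epsilon>" "\<epsilon> \<le> 1 / 4"
  shows "(\<Sum>k\<le>K. (real k + 1)\<^sup>2 * \<epsilon> ^ k) \<le> 8"
proof -
  \<comment> \<open>Against \<open>(1 / 4) ^ k\<close> this leaves a geometric series of ratio 1/2
    with first term 4.\<close>
  have sq: "(k + 1)\<^sup>2 \<le> 4 * 2 ^ k" for k :: nat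
  proof (induction k)
    case (Suc k)
    show ?case
    proof (cases "k \<le> 1")
      case True
      then consider "k = 0" | "k = 1" by linarith
      then show ?thesis by cases (simp_all add: power2_eq_square)
    next
      case False
      have "2 * 2 \<le> k * k" using False by (intro mult_le_mono) auto
      then have "(Suc k + 1)\<^sup>2 \<le> 2 * (k + 1)\<^sup>2" by (simp add: power2_eq_square algebra_simps)
      then show ?thesis using Suc.IH by simp
    qed
  qed simp
  have "(real k + 1)\<^sup>2 * \<epsilon> ^ k \<le> 4 * (1 / 2) ^ k" for k
  proof -
    have "real ((k + 1)\<^sup>2) \<le> real (4 * 2 ^ k)" using sq[of k] by (simp only: of_nat_le_iff)
    then have "(real k + 1)\<^sup>2 * \<epsilon> ^ k \<le> (4 * 2 ^ k) * (1 / 4) ^ k"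
      using assms by (intro mult_mono power_mono) (auto simp: add.commute)
    also have "\<dots> = 4 * (1 / 2) ^ k" by (simp add: power_mult_distrib[symmetric])
    finally show ?thesis .
  qed
  then have "(\<Sum>k\<le>K. (real k + 1)\<^sup>2 * \<epsilon> ^ k) \<le> (\<Sum>k\<le>K. 4 * (1 / 2) ^ k)" by (intro sum_mono)
  also have "\<dots> = 4 * (\<Sum>k\<le>K. (1 / 2) ^ k)" by (simp add: sum_distrib_left)
  also have "(\<Sum>k\<le>K. (1 / 2 :: real) ^ k) = 2 - (1 / 2) ^ K" by (induction K) auto
  also have "4 * (2 - (1 / 2 :: real) ^ K) \<le> 8" by simp
  finally show ?thesis .
qed

section \<open>The non-Schur case\<close>

lemma wsum_const_le:
  assumes "\<And>l. l \<in> L \<Longrightarrow> length l = j" "card L \<le> M" "0 \<le> p"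
  shows "wsum p L \<le> real M * p ^ j"
proof -
  have "wsum p L = real (card L) * p ^ j" using assms(1) by (simp add: wsum_def)
  also have "\<dots> \<le> real M * p ^ j" using assms by (intro mult_right_mono) auto
  finally show ?thesis .
qed

lemma card_doubles: "finite (doubles N) \<and> card (doubles N) \<le> N"
  by (rule finite_card_image_le[of _ "\<lambda>x. [x, 2 * x]" "{1..N}"]) (auto simp: doubles_def)

lemma card_forced: "finite (forced n N) \<and> card (forced n N) \<le> 2 * (n - N)"
proof -
  have "finite {x. N < 2 * x \<and> 2 * x \<le> n}" by (rule finite_subset[of _ "{..n}"]) auto
  moreover have "card {x. N < 2 * x \<and> 2 * x \<le> n} \<le> card {N<..n}"
    by (rule card_inj_on_le[of "\<lambda>x. 2 * x"]) (auto simp: inj_on_def)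
  ultimately show ?thesis
    unfolding forced_def using card_Un_le[of "{1..n - N}" "{x. N < 2 * x \<and> 2 * x \<le> n}"] by simp
qed

lemma card_forced_triples: "finite (forced_triples n N) \<and> card (forced_triples n N) \<le> 4 * N * (n - N)"
proof (rule finite_card_image_le)
  show "forced_triples n N \<subseteq> (\<lambda>(x, c, e). [x, c, third e x c]) ` (forced n N \<times> {1..N} \<times> (UNIV :: bool set))"
  proof
    fix l assume "l \<in> forced_triples n N"
    then obtain x c d where l: "l = [x, c, d]" "x \<in> forced n N" "tset N {x, c, d}" by (auto simp: forced_triples_def)
    obtain e where "d = third e x c" using tset_third_ex[OF l(3)] by blast
    then show "l \<in> (\<lambda>(x, c, e). [x, c, third e x c]) ` (forced n N \<times> {1..N} \<times> (UNIV :: bool set))"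
      using l tset_mem[OF l(3)] by (intro image_eqI[of _ _ "(x, c, e)"]) auto
  qed
  have "card (forced n N) * (N * 2) \<le> 2 * (n - N) * (N * 2)"
    using card_forced[of n N] by (intro mult_le_mono) auto
  then show "card (forced n N \<times> {1..N} \<times> (UNIV :: bool set)) \<le> 4 * N * (n - N)"
    by (simp add: card_cartesian_product algebra_simps)
qed (use card_forced in auto)

lemma card_crossing_triples: "finite (crossing_triples N) \<and> card (crossing_triples N) \<le> 4 * N\<^sup>2"
proof (rule finite_card_image_le)
  let ?Y = "{1..N} \<times> {1..N} \<times> (UNIV :: bool set) \<times> (UNIV :: bool set)"
  show "crossing_triples N \<subseteq> (\<lambda>(u, v, e, e'). [u, v, third e u v, third e' u v]) ` ?Y"
  proof
    fix l assume "l \<in> crossing_triples N"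
    then obtain u v t t' where l: "l = [u, v, t, t']" "tset N {u, v, t}" "tset N {u, v, t'}"
      by (auto simp: crossing_triples_def)
    obtain e where "t = third e u v" using tset_third_ex[OF l(2)] by blast
    moreover obtain e' where "t' = third e' u v" using tset_third_ex[OF l(3)] by blast
    ultimately show "l \<in> (\<lambda>(u, v, e, e'). [u, v, third e u v, third e' u v]) ` ?Y"
      using l tset_mem[OF l(2)] by (intro image_eqI[of _ _ "(u, v, e, e')"]) auto
  qed
qed (auto simp: card_cartesian_product power2_eq_square)

text \<open>The last entry \<open>z\<close> has at most \<open>n - N\<close> neighbours
  \<open>w\<close>, so the edge inside the triple replaces a factor \<open>N\<close> by
  \<open>n - N\<close>. The other entry is given up to two choices, and a second Boolean says which
  position \<open>w\<close> takes.\<close>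

lemma card_base_closed: "finite (base_closed n N) \<and> card (base_closed n N) \<le> 4 * N * (n - N)"
proof (rule finite_card_image_le)
  let ?Y = "(SIGMA z : {1..N}. {w. gadj n N z w}) \<times> (UNIV :: bool set) \<times> (UNIV :: bool set)"
  let ?f = "\<lambda>((z, w), e, e'). if e' then [w, third e z w, z] else [third e z w, w, z]"
  show "base_closed n N \<subseteq> ?f ` ?Y"
  proof
    fix l assume "l \<in> base_closed n N"
    then obtain x y z w where l: "l = [x, y, z]" "tset N {x, y, z}" "w \<in> {x, y, z}" "gadj n N z w"
      by (auto simp: base_closed_def base_paths_def)
    have z: "z \<in> {1..N}" using tset_mem[OF l(2)] by auto
    have "w \<noteq> z" using l(4) by (auto simp: gadj_def)
    then consider "w = x" | "w = y" using l(3) by auto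
    then show "l \<in> ?f ` ?Y"
    proof cases
      case 1
      have "{x, y, z} = {z, w, y}" using 1 by auto
      then obtain e where "y = third e z w" using tset_third_ex[of N z w y] l(2) by auto
      then show ?thesis using l z 1 by (intro image_eqI[of _ _ "((z, w), e, True)"]) auto
    next
      case 2
      have "{x, y, z} = {z, w, x}" using 2 by auto
      then obtain e where "x = third e z w" using tset_third_ex[of N z w x] l(2) by auto
      then show ?thesis using l z 2 by (intro image_eqI[of _ _ "((z, w), e, False)"]) auto
    qed
  qed
  show "finite ?Y" using finite_gadj by auto
  have "card (SIGMA z : {1..N}. {w. gadj n N z w}) = (\<Sum>z\<in>{1..N}. card {w. gadj n N z w})"
    using finite_gadj by (intro card_SigmaI) auto
  also have "\<dots> \<le> (\<Sum>z\<in>{1..N}. n - N)" by (intro sum_mono card_gadj_le)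
  finally have "card (SIGMA z : {1..N}. {w. gadj n N z w}) \<le> N * (n - N)" by simp
  moreover have "card ?Y = card (SIGMA z : {1..N}. {w. gadj n N z w}) * 4" unfolding card_cartesian_product by simp
  ultimately show "card ?Y \<le> 4 * N * (n - N)" by linarith
qed

text \<open>Union bound over the short obstructions in \<open>L\<close> and the closed paths in
  \<open>L'\<close>. In the bound, 8 = 4 + 4 comes from \<open>forced_triples\<close> and
  \<open>base_closed\<close>, and 16 = 2 * 8 contains the value 8 of the series over the path
  length, whose ratio \<open>small\<close> keeps at 1/4 or below.\<close>

lemma prob_schur_le:
  fixes p :: real and n s :: nat
  assumes s: "0 < s" "2 * s \<le> n" and p: "0 \<le> p" "p \<le> 1"
  defines "\<alpha> \<equiv> n * p\<^sup>2" and "\<beta> \<equiv> n * s * p ^ 3"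
  assumes small: "\<alpha> + \<beta> \<le> 1 / 8"
  shows "probR n p {R. is_schur ({n - s + 1..n} \<union> R)}
    \<le> \<alpha> + 8 * \<beta> + 4 * \<alpha>\<^sup>2 + 16 * (60 * \<alpha>\<^sup>2 + 48 * \<alpha> * \<beta> + 6 * \<beta>\<^sup>2)"
proof -
  define N where "N = n - s"
  have N: "N < n" "n \<le> 2 * N" "N \<le> n" "s = n - N" using s by (auto simp: N_def)
  have ab: "0 \<le> \<alpha>" "0 \<le> \<beta>" using p by (auto simp: \<alpha>_def \<beta>_def)
  define L where "L = (doubles N \<union> forced_triples n N) \<union> (crossing_triples N \<union> base_closed n N)"
  define L' where "L' = (\<Union>k\<le>N. closing n N k)"
  note fin4 = card_doubles[of N, THEN conjunct1] card_forced_triples[of n N, THEN conjunct1]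
    card_crossing_triples[of N, THEN conjunct1] card_base_closed[of n N, THEN conjunct1]
  have finL: "finite L" unfolding L_def by (intro finite_UnI fin4)
  have finc: "finite (closing n N k)" for k by (rule closing_weight(1)[OF p N(3,4)])
  have finL': "finite L'" unfolding L'_def using finc by auto
  have d: "distinct l \<and> set l \<subseteq> {1..n}" if l: "l \<in> L \<union> L'" for l
  proof -
    have c3: "distinct [a, b, c]" if "tset N {a, b, c}" for a b c
    proof -
      have "card {a, b, c} = 3" using that by (simp add: tset_def)
      then show ?thesis by (auto simp: card_insert_if split: if_splits)
    qed
    have "distinct l \<and> set l \<subseteq> {1..N}"
    proof -
      consider "l \<in> doubles N" | "l \<in> forced_triples n N" | "l \<in> crossing_triples N" | "l \<in> base_closed n N"
        | k where "l \<in> closing n N k" using l by (auto simp: L_def L'_def)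
      then show ?thesis
      proof cases
        case 1
        then show ?thesis by (auto simp: doubles_def)
      next
        case 2
        then obtain x c d where "l = [x, c, d]" "tset N {x, c, d}" by (auto simp: forced_triples_def)
        then show ?thesis using c3[of x c d] tset_subset[of N "{x, c, d}"] by simp
      next
        case 3
        then obtain u v t t' where "l = [u, v, t, t']" "tset N {u, v, t}" "tset N {u, v, t'}" "t \<noteq> t'"
          by (auto simp: crossing_triples_def)
        then show ?thesis using c3[of u v t] c3[of u v t'] tset_subset[of N "{u, v, t}"] tset_subset[of N "{u, v, t'}"]
          by simp
      next
        case 4
        then obtain x c d where "l = [x, c, d]" "tset N {x, c, d}" by (auto simp: base_closed_def base_paths_def)
        then show ?thesis using c3[of x c d] tset_subset[of N "{x, c, d}"] by simp
      next
        case 5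
        then show ?thesis using closing_props by blast
      qed
    qed
    then show ?thesis using N(3) by (meson atLeastatMost_subset_iff order_refl order_trans)
  qed
  have "probR n p {R. is_schur ({n - s + 1..n} \<union> R)} \<le> probR n p {R. \<exists>l\<in>L \<union> L'. set l \<subseteq> R}"
  proof (rule prob_mono_support)
    fix R assume R: "R \<subseteq> {1..n}" and "R \<in> {R. is_schur ({n - s + 1..n} \<union> R)}"
    then have sch: "is_schur ({N + 1..n} \<union> R)" by (simp add: N_def)
    show "R \<in> {R. \<exists>l\<in>L \<union> L'. set l \<subseteq> R}"
    proof (rule ccontr)
      assume "R \<notin> {R. \<exists>l\<in>L \<union> L'. set l \<subseteq> R}"
      then have av: "\<not> set l \<subseteq> R" if "l \<in> L \<union> L'" for l using that by auto
      \<comment> \<open>The entries are distinct elements of \<open>{1..N}\<close>, so closings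
        exist only for \<open>k \<le> N\<close>, and the finite union \<open>L'\<close> contains
        them all.\<close>
      have av': "\<not> set l \<subseteq> R" if "l \<in> closing n N k" for l k
      proof (rule av)
        have "k \<le> N" using closing_props[OF that] by blast
        then show "l \<in> L \<union> L'" using that unfolding L'_def by auto
      qed
      have "\<not> is_schur ({N + 1..n} \<union> R)"
        by (rule not_schur_if_avoids[OF N(1,2) R]) (rule av, simp add: L_def, rule av, simp add: L_def,
          rule av, simp add: L_def, rule av, simp add: L_def, rule av', assumption)
      with sch show False by blast
    qed
  qed
  also have "\<dots> \<le> wsum p (L \<union> L')" by (rule prob_lists_le[OF _ d p]) (use finL finL' in auto)
  also have "\<dots> \<le> wsum p L + wsum p L'" by (rule wsum_Un_le[OF finL finL' p(1)])
  also have "wsum p L \<le> (\<alpha> + 4 * \<beta>) + (4 * \<alpha>\<^sup>2 + 4 * \<beta>)"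
  proof -
    have Nn: "real N * x \<le> real n * x" if "0 \<le> x" for x using N(3) that by (intro mult_right_mono) auto
    have w1: "wsum p (doubles N) \<le> \<alpha>"
    proof -
      have "wsum p (doubles N) \<le> real N * p\<^sup>2"
        using card_doubles[of N] p by (intro wsum_const_le) (auto simp: doubles_def)
      then show ?thesis using Nn[of "p\<^sup>2"] by (simp add: \<alpha>_def)
    qed
    have b3: "real (4 * N * (n - N)) * p ^ 3 \<le> 4 * \<beta>"
      using Nn[of "real s * p ^ 3"] p unfolding N(4)[symmetric] \<beta>_def by simp
    have w2: "wsum p (forced_triples n N) \<le> 4 * \<beta>"
      by (rule order_trans[OF wsum_const_le b3]) (use card_forced_triples[of n N] p in \<open>auto simp: forced_triples_def\<close>)
    have w4: "wsum p (base_closed n N) \<le> 4 * \<beta>"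
      by (rule order_trans[OF wsum_const_le b3])
        (use card_base_closed[of n N] p in \<open>auto simp: base_closed_def base_paths_def\<close>)
    have w3: "wsum p (crossing_triples N) \<le> 4 * \<alpha>\<^sup>2"
    proof -
      have "wsum p (crossing_triples N) \<le> real (4 * N\<^sup>2) * p ^ 4"
        using card_crossing_triples[of N] p by (intro wsum_const_le) (auto simp: crossing_triples_def)
      also have "\<dots> = 4 * (real N * p\<^sup>2)\<^sup>2" by (simp add: power2_eq_square eval_nat_numeral)
      also have "\<dots> \<le> 4 * (real n * p\<^sup>2)\<^sup>2"
        using Nn[of "p\<^sup>2"] p by (intro mult_left_mono power_mono) auto
      finally show ?thesis by (simp add: \<alpha>_def)
    qed
    have "wsum p L \<le> wsum p (doubles N \<union> forced_triples n N) + wsum p (crossing_triples N \<union> base_closed n N)"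
      unfolding L_def by (intro wsum_Un_le finite_UnI fin4 p(1))
    also have "\<dots> \<le> (wsum p (doubles N) + wsum p (forced_triples n N)) + (wsum p (crossing_triples N) + wsum p (base_closed n N))"
      by (intro add_mono wsum_Un_le fin4 p(1))
    also have "\<dots> \<le> (\<alpha> + 4 * \<beta>) + (4 * \<alpha>\<^sup>2 + 4 * \<beta>)" by (intro add_mono w1 w2 w3 w4)
    finally show ?thesis .
  qed
  also have "wsum p L' \<le> 2 * (60 * \<alpha>\<^sup>2 + 48 * \<alpha> * \<beta> + 6 * \<beta>\<^sup>2) * 8"
  proof -
    let ?q = "2 * (60 * \<alpha>\<^sup>2 + 48 * \<alpha> * \<beta> + 6 * \<beta>\<^sup>2)"
    have UN: "wsum p (\<Union>k\<in>K. closing n N k) \<le> (\<Sum>k\<in>K. wsum p (closing n N k))" if "finite K" for K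
      using that
    proof (induction K rule: finite_induct)
      case (insert k K)
      have "finite (\<Union>k\<in>K. closing n N k)" using insert.hyps finc by auto
      from wsum_Un_le[OF finc[of k] this p(1)] show ?case using insert by simp
    qed (simp add: wsum_def)
    have "wsum p L' \<le> (\<Sum>k\<le>N. wsum p (closing n N k))" unfolding L'_def by (rule UN) simp
    also have "\<dots> \<le> (\<Sum>k\<le>N. ?q * ((real k + 1)\<^sup>2 * (2 * \<alpha> + 2 * \<beta>) ^ k))"
      unfolding \<alpha>_def \<beta>_def by (intro sum_mono closing_weight(2)[OF p N(3,4)])
    also have "\<dots> = ?q * (\<Sum>k\<le>N. (real k + 1)\<^sup>2 * (2 * \<alpha> + 2 * \<beta>) ^ k)" by (simp add: sum_distrib_left)
    also have "\<dots> \<le> ?q * 8"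
      using ab small by (intro mult_left_mono sum_square_power_le) auto
    finally show ?thesis .
  qed
  finally show ?thesis by simp
qed

lemma not_schur_part:
  fixes s :: "nat \<Rightarrow> nat" and p :: "nat \<Rightarrow> real"
  assumes s_pos: "\<And>n. s n > 0"
    and s_lower: "(\<lambda>n. real (s n)) \<in> \<Omega>(\<lambda>n. real n powr (1/2))"
    and s_upper: "eventually (\<lambda>n. real (s n) \<le> real n / 2) sequentially"
    and p: "\<And>n. 0 \<le> p n \<and> p n \<le> 1"
    and p_upper: "p \<in> o(\<lambda>n. (real n * real (s n)) powr (-1/3))"
  shows "(\<lambda>n. probR n (p n) {R. \<not> is_schur ({n - s n + 1..n} \<union> R)}) \<longlonglongrightarrow> 1"
proof -
  obtain c where c: "c > 0" and s_ge: "eventually (\<lambda>n. c * real n powr (1/2) \<le> s n) sequentially"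
    using landau_omega.bigE[OF s_lower] by (auto simp: abs_of_nonneg)
  define q where "q = (\<lambda>n. p n / (real n * real (s n)) powr (-1/3))"
  have q0: "q \<longlonglongrightarrow> 0" unfolding q_def by (rule smalloD_tendsto[OF p_upper])
  define \<alpha> where "\<alpha> = (\<lambda>n. real n * (p n)\<^sup>2)"
  define \<beta> where "\<beta> = (\<lambda>n. real n * real (s n) * p n ^ 3)"
  have pos: "eventually (\<lambda>n. real n * real (s n) > 0) sequentially"
    using eventually_gt_at_top[of 0] by eventually_elim (use s_pos in simp)
  have b0: "\<beta> \<longlonglongrightarrow> 0"
  proof -
    have "(\<lambda>n. q n ^ 3) \<longlonglongrightarrow> 0 ^ 3" by (intro tendsto_power q0)
    moreover have "eventually (\<lambda>n. q n ^ 3 = \<beta> n) sequentially"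
      using pos
    proof eventually_elim
      case (elim n)
      have "((real n * real (s n)) powr (-1/3)) ^ 3 = 1 / (real n * real (s n))"
      proof -
        have "((real n * real (s n)) powr (-1/3)) ^ 3 = (real n * real (s n)) powr (real 3 * (-1/3))"
          by (rule powr_power[OF less_imp_neq[OF elim, symmetric]])
        also have "\<dots> = (real n * real (s n)) powr (- 1)" by simp
        also have "\<dots> = 1 / (real n * real (s n)) powr 1" by (rule powr_minus_divide)
        also have "\<dots> = 1 / (real n * real (s n))" using elim by (subst powr_one) auto
        finally show ?thesis .
      qed
      then show ?case by (simp add: q_def \<beta>_def power_divide)
    qed
    ultimately show ?thesis using tendsto_cong by force
  qed
  have a0: "\<alpha> \<longlonglongrightarrow> 0"
  proof (rule tendsto_sandwich)
    show "eventually (\<lambda>n. 0 \<le> \<alpha> n) sequentially" by (simp add: \<alpha>_def)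
    show "eventually (\<lambda>n. \<alpha> n \<le> c powr (-2/3) * (q n)\<^sup>2) sequentially"
      using pos s_ge
    proof eventually_elim
      case (elim n)
      have n: "real n > 0" using elim(1) s_pos[of n] by (simp add: zero_less_mult_iff)
      \<comment> \<open>The lower bound on \<open>s\<close> makes \<open>n * s\<close> at least
        \<open>c * n powr (3/2)\<close>, so \<open>(n * s) powr (2/3)\<close> is at least a constant
        times \<open>n\<close>. Hence \<alpha> is bounded by a constant times the square of
        \<open>q\<close>.\<close>
      have "c * real n powr (3/2) = real n * (c * real n powr (1/2))"
        using n powr_add[of "real n" 1 "1/2"] by simp
      also have "\<dots> \<le> real n * real (s n)" using elim(2) n by (intro mult_left_mono) auto
      finally have "(c * real n powr (3/2)) powr (2/3) \<le> (real n * real (s n)) powr (2/3)"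
        using c by (intro powr_mono2) auto
      then have "c powr (2/3) * real n \<le> (real n * real (s n)) powr (2/3)"
        using c n by (simp add: powr_mult powr_powr)
      then have "c powr (2/3) * real n * (p n)\<^sup>2 \<le> (real n * real (s n)) powr (2/3) * (p n)\<^sup>2"
        by (intro mult_right_mono) auto
      also have "\<dots> = (q n)\<^sup>2"
      proof -
        let ?x = "real n * real (s n)"
        have "(?x powr (-1/3))\<^sup>2 = ?x powr (real 2 * (-1/3))" by (rule powr_power[OF less_imp_neq[OF elim(1), symmetric]])
        also have "\<dots> = ?x powr (- (2/3))" by simp
        also have "\<dots> = 1 / ?x powr (2/3)" by (rule powr_minus_divide)
        finally show ?thesis by (simp only: q_def power_divide) simp
      qed
      finally have "c powr (-2/3) * (c powr (2/3) * \<alpha> n) \<le> c powr (-2/3) * (q n)\<^sup>2"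
        by (intro mult_left_mono) (auto simp: \<alpha>_def mult.assoc)
      moreover have "c powr (-2/3) * (c powr (2/3) * \<alpha> n) = \<alpha> n"
        using c by (simp add: mult.assoc[symmetric] powr_add[symmetric])
      ultimately show ?case by (simp only:)
    qed
    show "(\<lambda>n. c powr (-2/3) * (q n)\<^sup>2) \<longlonglongrightarrow> 0"
      using tendsto_mult[OF tendsto_const tendsto_power[OF q0, of 2], of "c powr (-2/3)"] by simp
  qed simp
  define B where "B = (\<lambda>n. \<alpha> n + 8 * \<beta> n + 4 * (\<alpha> n)\<^sup>2 + 16 * (60 * (\<alpha> n)\<^sup>2 + 48 * \<alpha> n * \<beta> n + 6 * (\<beta> n)\<^sup>2))"
  have "B \<longlonglongrightarrow> 0 + 8 * 0 + 4 * 0\<^sup>2 + 16 * (60 * 0\<^sup>2 + 48 * 0 * 0 + 6 * 0\<^sup>2)"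
    unfolding B_def by (intro tendsto_intros a0 b0)
  then have B0: "B \<longlonglongrightarrow> 0" by simp
  have "(\<lambda>n. \<alpha> n + \<beta> n) \<longlonglongrightarrow> 0 + 0" by (intro tendsto_add a0 b0)
  then have sm: "eventually (\<lambda>n. \<alpha> n + \<beta> n < 1 / 8) sequentially" by (rule order_tendstoD) simp
  have le: "eventually (\<lambda>n. probR n (p n) {R. is_schur ({n - s n + 1..n} \<union> R)} \<le> B n) sequentially"
    using sm s_upper
  proof eventually_elim
    case (elim n)
    have "2 * s n \<le> n" using elim(2) by linarith
    from prob_schur_le[OF s_pos this, of "p n"] p[of n] elim(1)
    show ?case by (simp add: B_def \<alpha>_def \<beta>_def)
  qed
  have "(\<lambda>n. probR n (p n) {R. is_schur ({n - s n + 1..n} \<union> R)}) \<longlonglongrightarrow> 0"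
    by (rule tendsto_sandwich[OF _ le tendsto_const B0]) (auto simp: always_eventually)
  then have "(\<lambda>n. 1 - probR n (p n) {R. is_schur ({n - s n + 1..n} \<union> R)}) \<longlonglongrightarrow> 1 - 0"
    by (intro tendsto_diff tendsto_const)
  moreover have "1 - probR n (p n) {R. is_schur (A \<union> R)} = probR n (p n) {R. \<not> is_schur (A \<union> R)}" for n A
  proof -
    have "{R. \<not> is_schur (A \<union> R)} = UNIV - {R. is_schur (A \<union> R)}" by auto
    then show ?thesis using measure_pmf.prob_compl[of "{R. is_schur (A \<union> R)}"] by simp
  qed
  ultimately show ?thesis by simp
qed

theorem theorem1p6:
  fixes s :: "nat \<Rightarrow> nat"
  assumes s_pos: "\<And>n. s n > 0"
    and s_lower: "(\<lambda>n. real (s n)) \<in> \<Omega>(\<lambda>n. real n powr (1/2))"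
    and s_upper: "eventually (\<lambda>n. real (s n) \<le> real n / 2) sequentially"
  shows
    "(\<exists>A :: nat \<Rightarrow> nat set.
        eventually (\<lambda>n. A n \<subseteq> {1..n} \<and> card (A n) = s n) sequentially \<and>
        (\<forall>p :: nat \<Rightarrow> real.
           (\<forall>n. 0 \<le> p n \<and> p n \<le> 1) \<longrightarrow>
           p \<in> o(\<lambda>n. (real n * real (s n)) powr (-1/3)) \<longrightarrow>
           (\<lambda>n. measure_pmf.prob (random_subset n (p n)) {R. \<not> is_schur (A n \<union> R)})
             \<longlonglongrightarrow> 1))
     \<and>
     (\<forall>A :: nat \<Rightarrow> nat set.
        eventually (\<lambda>n. A n \<subseteq> {1..n} \<and> card (A n) = s n) sequentially \<longrightarrow>
        (\<forall>p :: nat \<Rightarrow> real.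
           (\<forall>n. 0 \<le> p n \<and> p n \<le> 1) \<longrightarrow>
           p \<in> \<omega>(\<lambda>n. (real n ^ 13 * real (s n)) powr (-1/27) * ln (real n)) \<longrightarrow>
           (\<lambda>n. measure_pmf.prob (random_subset n (p n)) {R. is_schur (A n \<union> R)})
             \<longlonglongrightarrow> 1))"
proof (intro conjI exI[of _ "\<lambda>n. {n - s n + 1..n}"] allI impI)
  show "eventually (\<lambda>n. {n - s n + 1..n} \<subseteq> {1..n} \<and> card {n - s n + 1..n} = s n) sequentially"
    using s_upper
  proof eventually_elim
    case (elim n)
    then have "s n \<le> n" by linarith
    then show ?case by auto
  qed
next
  fix p :: "nat \<Rightarrow> real"
  assume "\<forall>n. 0 \<le> p n \<and> p n \<le> 1" "p \<in> o(\<lambda>n. (real n * real (s n)) powr (-1/3))"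
  then show "(\<lambda>n. measure_pmf.prob (random_subset n (p n)) {R. \<not> is_schur ({n - s n + 1..n} \<union> R)}) \<longlonglongrightarrow> 1"
    by (intro not_schur_part[OF s_pos s_lower s_upper]) auto
next
  fix A :: "nat \<Rightarrow> nat set" and p :: "nat \<Rightarrow> real"
  assume "eventually (\<lambda>n. A n \<subseteq> {1..n} \<and> card (A n) = s n) sequentially"
    "\<forall>n. 0 \<le> p n \<and> p n \<le> 1" "p \<in> \<omega>(\<lambda>n. (real n ^ 13 * real (s n)) powr (-1/27) * ln (real n))"
  then show "(\<lambda>n. measure_pmf.prob (random_subset n (p n)) {R. is_schur (A n \<union> R)}) \<longlonglongrightarrow> 1"
    by (intro schur_part[OF s_pos s_lower]) auto
qed

end
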